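(* Let $k\ge0$ be an integer. Let $(\mathbf q_h,u_h,\lambda_h)\in\mathcal M_h\times\Lambda_h$ be the solution of the hybridized WG-MFEM scheme and let $(\bar{\mathbf q}_h,\bar u_h)\in V_h\times W_h$ be the solution of the WG-MFEM scheme (both schemes are stated in the context, with the same data $\alpha,f,g$). Then $\mathbf q_h=\bar{\mathbf q}_h$ and $u_h=\bar u_h$. Moreover, the hybridized WG-MFEM scheme has one and only one solution.
   Context: Domain and data: $\Omega\subset\mathbb R^d$ ($d=2,3$) is an open bounded polygonal or polyhedral domain (connected); $\alpha\in[L^\infty(\Omega)]^{d\times d}$ is a symmetric, uniformly positive definite matrix function; $f\in L^2(\Omega)$ and $g\in L^2(\partial\Omega)$ are given. The underlying problem is $\alpha\mathbf q+\nabla u=0$, $\nabla\cdot\mathbf q=f$ in $\Omega$, $u=g$ on $\partial\Omega$. Here $(\cdot,\cdot)_D$ and $\langle\cdot,\cdot\rangle_{\partial D}$ are the $L^2$ inner products on $D$ and $\partial D$, and $(\cdot,\cdot)=(\cdot,\cdot)_\Omega$. Mesh: $\mathcal T_h$ is a finite partition of $\Omega$ into polygons ($d=2$) or polyhedra ($d=3$), with $h_T$ the diameter of $T$, $h=\max_T h_T$; $\mathcal E_h$ is the set of all edges/flat faces, $\mathcal E_h^0=\mathcal E_h\setminus\partial\Omega$ the set of interior ones. $\mathbf n$ is the outward unit normal on $\partial T$. $P_r(D)$ denotes polynomials of degree at most $r$ on $D$. The partition is shape regular: (A1) there are $\rho_v,\rho_e>0$ with $\rho_v h_T^d\le|T|$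 and $\rho_e h_e^{d-1}\le|e|$ for all $T\in\mathcal T_h$, $e\in\mathcal E_h$ ($h_e$ the diameter of $e$); (A2) there is $\kappa>0$ with $\kappa h_T\le h_e$ for each edge/face $e\subset\partial T$; (A3) edges/faces are flat, and for each $T$ and each $e\subset\partial T$ there is a pyramid contained in $T$ with base $e$, apex $A_e\in T$ and height $\sigma_e h_T$, $\sigma_e\ge\sigma^*>0$ for a fixed $\sigma^*$, such that for every $x_e\in e$ the angle between $x_e-A_e$ and the outward normal of $e$ lies in $[0,\theta_0]$ for a fixed $\theta_0<\pi/2$; (A4) each $T$ has a shape-regular circumscribed simplex $S(T)$ with diameter at most $\gamma_* h_T$ ($\gamma_*$ independent of $T$), and each $S(T)$ intersects at most a fixed finite number of the simplices of the other elements. Spaces: $W_{k+1}(T)=P_{k+1}(T)$; $V_k(T)=\{\mathbf v=\{\mathbf v_0,\mathbf v_b\}:\ \mathbf v_0\in[P_k(T)]^d,\ \mathbf v_b|_e=v_b\mathbf n,\ v_b\in P_k(e),\ e\subset\partial T\}$ ($\mathbf v_b$ is independent of the trace of $\mathbf v_0$); $\mathcal M_h=\bigotimes_{T\in\mathcal T_h}V_k(T)\times W_{k+1}(T)$, $\tilde V_h=\bigotimes_{T\in\mathcal T_h}V_k(T)$ (no continuity between elements, so $\mathbf v_b$ may take two values on an interior edge/face), $W_h=\bigotimes_{T\in\mathcal T_h}W_{k+1}(T)$; $\Lambda_h=\{\lambda:\lambda|_e\in P_k(e)\ \forall e\in\mathcal E_h\}$ (single-valued on each $e$); $\Lambda_h^0=\{\lambda\in\Lambda_h:\lambda|_e=0\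 \forall e\subset\partial\Omega\}$. $(Q_bg)|_e\in P_k(e)$ is the $L^2(e)$ projection of $g$ on each $e\subset\partial\Omega$. For $\mathbf v\in\tilde V_h$ and $e\in\mathcal E_h^0$ shared by $T_1,T_2\in\mathcal T_h$, the jump is $[\![\mathbf v]\!]_e=\mathbf v_b|_{\partial T_1}\cdot\mathbf n_1+\mathbf v_b|_{\partial T_2}\cdot\mathbf n_2$, with $\mathbf n_i$ the outward unit normal on $e$ seen from $T_i$; and $V_h=\{\mathbf v\in\tilde V_h:\ [\![\mathbf v]\!]_e=0\ \forall e\in\mathcal E_h^0\}$. Discrete weak divergence: for $\mathbf v\in V_k(T)$, $\nabla_w\cdot\mathbf v\in P_{k+1}(T)$ is the unique polynomial with $(\nabla_w\cdot\mathbf v,\varphi)_T=-(\mathbf v_0,\nabla\varphi)_T+\langle\mathbf v_b\cdot\mathbf n,\varphi\rangle_{\partial T}$ for all $\varphi\in P_{k+1}(T)$. Forms: $s_T(\mathbf r,\mathbf v)=h_T\langle(\mathbf r_0-\mathbf r_b)\cdot\mathbf n,(\mathbf v_0-\mathbf v_b)\cdot\mathbf n\rangle_{\partial T}$, $a_{s,T}(\mathbf r,\mathbf v)=(\alpha\mathbf r_0,\mathbf v_0)_T+s_T(\mathbf r,\mathbf v)$, $b_T(\mathbf v,w)=(\nabla_w\cdot\mathbf v,w)_T$. Hybridized WG-MFEM scheme: find $(\mathbf q_h,u_h,\lambda_h)\in\mathcal M_h\times\Lambda_h$, $\mathbf q_h=\{\mathbf q_0,\mathbf q_b\}$, with $\lambda_h=Q_bg$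 on $\partial\Omega$ and (i) $s_T(\mathbf q_h,\mathbf v)+(\alpha\mathbf q_0,\mathbf v_0)_T-(\nabla_w\cdot\mathbf v,u_h)_T=-\langle\lambda_h,\mathbf v_b\cdot\mathbf n\rangle_{\partial T}$ for all $\mathbf v\in V_k(T)$, $T\in\mathcal T_h$; (ii) $(\nabla_w\cdot\mathbf q_h,w)_T=(f,w)_T$ for all $w\in W_{k+1}(T)$, $T\in\mathcal T_h$; (iii) $\sum_{T\in\mathcal T_h}\langle\mathbf q_b\cdot\mathbf n,\phi\rangle_{\partial T}=0$ for all $\phi\in\Lambda_h^0$. WG-MFEM scheme: find $\bar{\mathbf q}_h=\{\bar{\mathbf q}_0,\bar{\mathbf q}_b\}\in V_h$ and $\bar u_h\in W_h$ such that $\sum_{T}a_{s,T}(\bar{\mathbf q}_h,\mathbf v)-\sum_{T}b_T(\mathbf v,\bar u_h)=-\langle g,\mathbf v_b\cdot\mathbf n\rangle_{\partial\Omega}$ for all $\mathbf v\in V_h$, and $\sum_{T}b_T(\bar{\mathbf q}_h,w)=(f,w)$ for all $w\in W_h$ (sums over $T\in\mathcal T_h$). It is known from earlier work that this scheme has exactly one solution. *)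

theory Defs
  imports "HOL-Analysis.Analysis"
begin

section \<open>Measure and integration\<close>

text \<open>For an affine hyperplane \<open>H\<close>, the slab of all points at distance at most \<open>1/2\<close> from \<open>H\<close> has
  thickness one and \<open>closest_point H\<close> is the orthogonal projection onto \<open>H\<close>. The image of Lebesgue
  measure on the slab under this projection is therefore the \<open>(d - 1)\<close>-dimensional Lebesgue
  (surface) measure of \<open>H\<close>, regarded as a measure on the whole space. It is completed so that
  changing a function on a null set of \<open>H\<close> does not affect measurability.\<close>

definition hyperplane_measure :: "'a::euclidean_space set \<Rightarrow> 'a measure" where
  "hyperplane_measure H =
     completion (distr (restrict_space lborel {x. infdist x H \<le> 1/2}) borel (closest_point H))"

definition face_measure :: "'a::euclidean_space set \<Rightarrow> 'a measure" where
  "face_measure e = hyperplane_measure (affine hull e)"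

definition face_integral :: "'a::euclidean_space set \<Rightarrow> ('a \<Rightarrow> real) \<Rightarrow> real" where
  "face_integral e F = (LINT x:e|face_measure e. F x)"

definition cell_integral :: "'a::euclidean_space set \<Rightarrow> ('a \<Rightarrow> real) \<Rightarrow> real" where
  "cell_integral T F = (LINT x:T|lebesgue. F x)"

definition L2_on :: "'a measure \<Rightarrow> 'a set \<Rightarrow> ('a \<Rightarrow> real) \<Rightarrow> bool" where
  "L2_on M S f \<longleftrightarrow> set_borel_measurable M S f \<and> set_integrable M S (\<lambda>x. (f x)\<^sup>2)"

text \<open>The boundary of a polyhedral domain lies in finitely many hyperplanes and meets all other
  hyperplanes in null sets. Hence \<open>g\<close> is in \<open>L\<^sup>2(\<partial>\<Omega>)\<close> iff it is square integrable on the part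
  of \<open>\<partial>\<Omega>\<close> in each hyperplane.\<close>

definition L2_boundary :: "'a::euclidean_space set \<Rightarrow> ('a \<Rightarrow> real) \<Rightarrow> bool" where
  "L2_boundary \<Omega> g \<longleftrightarrow>
     (\<forall>H. affine H \<and> aff_dim H = int DIM('a) - 1 \<longrightarrow> L2_on (hyperplane_measure H) (frontier \<Omega>) g)"

section \<open>Domain, data and mesh\<close>

text \<open>Closed, possibly non-convex, \<open>m\<close>-dimensional polyhedral sets: \<open>m = d\<close> gives the polygons and
  polyhedra of the mesh, \<open>m = d - 1\<close> their edges and flat faces.\<close>

definition polyhedral_cell :: "int \<Rightarrow> 'a::euclidean_space set \<Rightarrow> bool" where
  "polyhedral_cell m P \<longleftrightarrow>
     (\<exists>F. finite F \<and> (\<forall>C\<in>F. polytope C \<and> aff_dim C = m) \<and> P = \<Union>F) \<and>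
     aff_dim P = m \<and> connected (rel_interior P)"

text \<open>The condition \<open>interior (closure \<Omega>) = \<Omega>\<close> excludes slits and other removed lower-dimensional sets.\<close>

definition polyhedral_domain :: "'a::euclidean_space set \<Rightarrow> bool" where
  "polyhedral_domain \<Omega> \<longleftrightarrow>
     open \<Omega> \<and> bounded \<Omega> \<and> connected \<Omega> \<and> interior (closure \<Omega>) = \<Omega> \<and>
     polyhedral_cell (int DIM('a)) (closure \<Omega>)"

definition admissible_coefficient ::
    "(real^'n) set \<Rightarrow> (real^'n \<Rightarrow> real^'n^'n) \<Rightarrow> bool" where
  "admissible_coefficient \<Omega> \<alpha> \<longleftrightarrow>
     \<alpha> \<in> borel_measurable (lebesgue_on \<Omega>) \<and>
     (\<exists>C. AE x in lebesgue_on \<Omega>. \<forall>i j. \<bar>\<alpha> x $ i $ j\<bar> \<le> C) \<and>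
     (AE x in lebesgue_on \<Omega>. transpose (\<alpha> x) = \<alpha> x) \<and>
     (\<exists>c>0. AE x in lebesgue_on \<Omega>. \<forall>\<xi>. c * (\<xi> \<bullet> \<xi>) \<le> (\<alpha> x *v \<xi>) \<bullet> \<xi>)"

definition faces_of :: "'a::euclidean_space set set \<Rightarrow> 'a set \<Rightarrow> 'a set set" where
  "faces_of \<E> T = {e\<in>\<E>. e \<subseteq> frontier T}"

definition is_outer_normal :: "'a::euclidean_space set \<Rightarrow> 'a set \<Rightarrow> 'a \<Rightarrow> bool" where
  "is_outer_normal T e n \<longleftrightarrow>
     norm n = 1 \<and>
     (\<forall>x\<in>rel_interior e. \<exists>\<epsilon>>0. \<forall>y\<in>ball x \<epsilon>. y \<in> T \<longleftrightarrow> (y - x) \<bullet> n \<le> 0)"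

definition outer_normal :: "'a::euclidean_space set \<Rightarrow> 'a set \<Rightarrow> 'a" where
  "outer_normal T e = (THE n. is_outer_normal T e n)"

text \<open>\<open>\<T>\<close> is the set of elements and \<open>\<E>\<close> the set of edges or flat faces. A flat side of an element may be
  subdivided into several members of \<open>\<E>\<close>, so hanging nodes are allowed. A face is a boundary face
  iff it is a subset of \<open>frontier \<Omega>\<close>; every other face is shared by exactly two elements.\<close>

definition polyhedral_mesh ::
    "'a::euclidean_space set \<Rightarrow> 'a set set \<Rightarrow> 'a set set \<Rightarrow> bool" where
  "polyhedral_mesh \<Omega> \<T> \<E> \<longleftrightarrow>
     finite \<T> \<and> (\<forall>T\<in>\<T>. polyhedral_cell (int DIM('a)) T) \<and>
     closure \<Omega> = \<Union>\<T> \<and>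
     pairwise (\<lambda>T T'. interior T \<inter> interior T' = {}) \<T> \<and>
     finite \<E> \<and> (\<forall>e\<in>\<E>. polyhedral_cell (int DIM('a) - 1) e) \<and>
     pairwise (\<lambda>e e'. rel_interior e \<inter> rel_interior e' = {}) \<E> \<and>
     (\<forall>T\<in>\<T>. frontier T = \<Union>(faces_of \<E> T)) \<and>
     (\<forall>T\<in>\<T>. \<forall>e\<in>faces_of \<E> T. \<exists>n. is_outer_normal T e n) \<and>
     (\<forall>e\<in>\<E>. card {T\<in>\<T>. e \<in> faces_of \<E> T} = (if e \<subseteq> frontier \<Omega> then 1 else 2))"

definition shape_regular_A1 :: "'a::euclidean_space set set \<Rightarrow> 'a set set \<Rightarrow> bool" where
  "shape_regular_A1 \<T> \<E> \<longleftrightarrow>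
     (\<exists>\<rho>v>0. \<exists>\<rho>e>0.
        (\<forall>T\<in>\<T>. \<rho>v * diameter T ^ DIM('a) \<le> measure lebesgue T) \<and>
        (\<forall>e\<in>\<E>. \<rho>e * diameter e ^ (DIM('a) - 1) \<le> measure (face_measure e) e))"

definition shape_regular_A2 :: "'a::euclidean_space set set \<Rightarrow> 'a set set \<Rightarrow> bool" where
  "shape_regular_A2 \<T> \<E> \<longleftrightarrow>
     (\<exists>\<kappa>>0. \<forall>T\<in>\<T>. \<forall>e\<in>faces_of \<E> T. \<kappa> * diameter T \<le> diameter e)"

definition pyramid :: "'a::euclidean_space set \<Rightarrow> 'a \<Rightarrow> 'a set" where
  "pyramid e A = (\<Union>x\<in>e. closed_segment A x)"

definition angle_between :: "'a::euclidean_space \<Rightarrow> 'a \<Rightarrow> real" where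
  "angle_between v w = arccos (v \<bullet> w / (norm v * norm w))"

definition shape_regular_A3 :: "'a::euclidean_space set set \<Rightarrow> 'a set set \<Rightarrow> bool" where
  "shape_regular_A3 \<T> \<E> \<longleftrightarrow>
     (\<exists>\<sigma>s>0. \<exists>\<theta>0<pi/2. \<forall>T\<in>\<T>. \<forall>e\<in>faces_of \<E> T. \<exists>A\<in>T. \<exists>\<sigma>\<ge>\<sigma>s.
        pyramid e A \<subseteq> T \<and>
        infdist A (affine hull e) = \<sigma> * diameter T \<and>
        (\<forall>x\<in>e. angle_between (x - A) (outer_normal T e) \<in> {0..\<theta>0}))"

text \<open>A simplex is shape regular if it contains a ball whose radius is at least a fixed multiple \<open>\<tau>\<close> of
  its diameter.\<close>

definition shape_regular_A4 :: "'a::euclidean_space set set \<Rightarrow> bool" where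
  "shape_regular_A4 \<T> \<longleftrightarrow>
     (\<exists>\<tau>>0. \<exists>\<gamma>>0. \<exists>N::nat. \<exists>S.
        (\<forall>T\<in>\<T>. int DIM('a) simplex S T \<and> T \<subseteq> S T \<and>
           (\<exists>c. ball c (\<tau> * diameter (S T)) \<subseteq> S T) \<and>
           diameter (S T) \<le> \<gamma> * diameter T \<and>
           card {T'\<in>\<T>. T' \<noteq> T \<and> S T \<inter> S T' \<noteq> {}} \<le> N))"

definition shape_regular :: "'a::euclidean_space set set \<Rightarrow> 'a set set \<Rightarrow> bool" where
  "shape_regular \<T> \<E> \<longleftrightarrow>
     shape_regular_A1 \<T> \<E> \<and> shape_regular_A2 \<T> \<E> \<and> shape_regular_A3 \<T> \<E> \<and> shape_regular_A4 \<T>"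

section \<open>Discrete spaces\<close>

definition poly_of_degree :: "nat \<Rightarrow> (real^'n \<Rightarrow> real) \<Rightarrow> bool" where
  "poly_of_degree r p \<longleftrightarrow>
     (\<exists>c :: ('n \<Rightarrow> nat) \<Rightarrow> real.
        \<forall>x. p x = (\<Sum>m | (\<Sum>i\<in>UNIV. m i) \<le> r. c m * (\<Prod>i\<in>UNIV. (x $ i) ^ m i)))"

text \<open>Discrete functions are extensional, i.e. \<open>undefined\<close> outside their domain, so that equality in
  HOL is equality of functions on \<open>D\<close>.\<close>

definition P_space :: "nat \<Rightarrow> (real^'n) set \<Rightarrow> (real^'n \<Rightarrow> real) set" where
  "P_space r D = {restrict p D | p. poly_of_degree r p}"

definition P_vec :: "nat \<Rightarrow> (real^'n) set \<Rightarrow> (real^'n \<Rightarrow> real^'n) set" where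
  "P_vec r D = {v \<in> extensional D. \<forall>i. (\<lambda>x\<in>D. v x $ i) \<in> P_space r D}"

text \<open>A weak vector function is a pair of its interior part and its boundary part. The latter is
  a separate function on every face since it may be discontinuous where faces meet.\<close>

type_synonym 'n weak_fun = "(real^'n \<Rightarrow> real^'n) \<times> ((real^'n) set \<Rightarrow> real^'n \<Rightarrow> real^'n)"

definition V_local :: "nat \<Rightarrow> (real^'n) set set \<Rightarrow> (real^'n) set \<Rightarrow> 'n weak_fun set" where
  "V_local k \<E> T =
     P_vec k T \<times>
     (\<Pi>\<^sub>E e\<in>faces_of \<E> T. {\<lambda>x\<in>e. vb x *\<^sub>R outer_normal T e | vb. vb \<in> P_space k e})"

definition V_broken ::
    "nat \<Rightarrow> (real^'n) set set \<Rightarrow> (real^'n) set set \<Rightarrow> ((real^'n) set \<Rightarrow> 'n weak_fun) set" where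
  "V_broken k \<T> \<E> = (\<Pi>\<^sub>E T\<in>\<T>. V_local k \<E> T)"

definition W_space ::
    "nat \<Rightarrow> (real^'n) set set \<Rightarrow> ((real^'n) set \<Rightarrow> real^'n \<Rightarrow> real) set" where
  "W_space k \<T> = (\<Pi>\<^sub>E T\<in>\<T>. P_space (k + 1) T)"

definition normal_trace :: "'n weak_fun \<Rightarrow> (real^'n) set \<Rightarrow> (real^'n) set \<Rightarrow> real^'n \<Rightarrow> real" where
  "normal_trace v T e x = snd v e x \<bullet> outer_normal T e"

definition V_space ::
    "(real^'n) set \<Rightarrow> nat \<Rightarrow> (real^'n) set set \<Rightarrow> (real^'n) set set \<Rightarrow>
     ((real^'n) set \<Rightarrow> 'n weak_fun) set" where
  "V_space \<Omega> k \<T> \<E> =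
     {v \<in> V_broken k \<T> \<E>.
        \<forall>e\<in>\<E>. \<not> e \<subseteq> frontier \<Omega> \<longrightarrow>
          (\<forall>T1\<in>\<T>. \<forall>T2\<in>\<T>. T1 \<noteq> T2 \<and> e \<in> faces_of \<E> T1 \<and> e \<in> faces_of \<E> T2 \<longrightarrow>
             (\<forall>x\<in>e. normal_trace (v T1) T1 e x + normal_trace (v T2) T2 e x = 0))}"

definition Lambda_space :: "nat \<Rightarrow> (real^'n) set set \<Rightarrow> ((real^'n) set \<Rightarrow> real^'n \<Rightarrow> real) set" where
  "Lambda_space k \<E> = (\<Pi>\<^sub>E e\<in>\<E>. P_space k e)"

definition Lambda0_space ::
    "(real^'n) set \<Rightarrow> nat \<Rightarrow> (real^'n) set set \<Rightarrow> ((real^'n) set \<Rightarrow> real^'n \<Rightarrow> real) set" where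
  "Lambda0_space \<Omega> k \<E> =
     {l \<in> Lambda_space k \<E>. \<forall>e\<in>\<E>. e \<subseteq> frontier \<Omega> \<longrightarrow> (\<forall>x\<in>e. l e x = 0)}"

definition Q_b :: "nat \<Rightarrow> (real^'n \<Rightarrow> real) \<Rightarrow> (real^'n) set \<Rightarrow> real^'n \<Rightarrow> real" where
  "Q_b k g e =
     (THE p. p \<in> P_space k e \<and>
        (\<forall>\<phi>\<in>P_space k e. face_integral e (\<lambda>x. p x * \<phi> x) = face_integral e (\<lambda>x. g x * \<phi> x)))"

section \<open>Weak divergence and bilinear forms\<close>

text \<open>For \<open>\<phi>\<close> in \<open>P_space r T\<close> this is the usual gradient at interior points of \<open>T\<close>; its value
  on the null set \<open>frontier T\<close> is irrelevant in integrals over \<open>T\<close>.\<close>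

definition grad :: "('a::real_inner \<Rightarrow> real) \<Rightarrow> 'a \<Rightarrow> 'a" where
  "grad \<phi> x = (THE D. gderiv \<phi> x D)"

definition boundary_integral ::
    "'a::euclidean_space set set \<Rightarrow> 'a set \<Rightarrow> ('a set \<Rightarrow> 'a \<Rightarrow> real) \<Rightarrow> real" where
  "boundary_integral \<E> T F = (\<Sum>e\<in>faces_of \<E> T. face_integral e (F e))"

definition weak_div ::
    "nat \<Rightarrow> (real^'n) set set \<Rightarrow> (real^'n) set \<Rightarrow> 'n weak_fun \<Rightarrow> real^'n \<Rightarrow> real" where
  "weak_div k \<E> T v =
     (THE p. p \<in> P_space (k + 1) T \<and>
        (\<forall>\<phi>\<in>P_space (k + 1) T.
           cell_integral T (\<lambda>x. p x * \<phi> x) =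
             - cell_integral T (\<lambda>x. fst v x \<bullet> grad \<phi> x)
             + boundary_integral \<E> T (\<lambda>e x. normal_trace v T e x * \<phi> x)))"

definition s_form ::
    "(real^'n) set set \<Rightarrow> (real^'n) set \<Rightarrow> 'n weak_fun \<Rightarrow> 'n weak_fun \<Rightarrow> real" where
  "s_form \<E> T r v =
     diameter T * boundary_integral \<E> T
       (\<lambda>e x. ((fst r x - snd r e x) \<bullet> outer_normal T e) * ((fst v x - snd v e x) \<bullet> outer_normal T e))"

definition a_form ::
    "(real^'n \<Rightarrow> real^'n^'n) \<Rightarrow> (real^'n) set set \<Rightarrow> (real^'n) set \<Rightarrow>
     'n weak_fun \<Rightarrow> 'n weak_fun \<Rightarrow> real" where
  "a_form \<alpha> \<E> T r v = cell_integral T (\<lambda>x. (\<alpha> x *v fst r x) \<bullet> fst v x) + s_form \<E> T r v"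

definition b_form ::
    "nat \<Rightarrow> (real^'n) set set \<Rightarrow> (real^'n) set \<Rightarrow> 'n weak_fun \<Rightarrow> (real^'n \<Rightarrow> real) \<Rightarrow> real" where
  "b_form k \<E> T v w = cell_integral T (\<lambda>x. weak_div k \<E> T v x * w x)"

section \<open>The two schemes\<close>

definition hybrid_solutions ::
    "(real^'n) set \<Rightarrow> (real^'n) set set \<Rightarrow> (real^'n) set set \<Rightarrow> nat \<Rightarrow>
     (real^'n \<Rightarrow> real^'n^'n) \<Rightarrow> (real^'n \<Rightarrow> real) \<Rightarrow> (real^'n \<Rightarrow> real) \<Rightarrow>
     (((real^'n) set \<Rightarrow> 'n weak_fun) \<times> ((real^'n) set \<Rightarrow> real^'n \<Rightarrow> real) \<times>
      ((real^'n) set \<Rightarrow> real^'n \<Rightarrow> real)) set" where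
  "hybrid_solutions \<Omega> \<T> \<E> k \<alpha> f g =
     {(q, u, l). q \<in> V_broken k \<T> \<E> \<and> u \<in> W_space k \<T> \<and> l \<in> Lambda_space k \<E> \<and>
        (\<forall>e\<in>\<E>. e \<subseteq> frontier \<Omega> \<longrightarrow> l e = Q_b k g e) \<and>
        (\<forall>T\<in>\<T>. \<forall>v\<in>V_local k \<E> T.
           s_form \<E> T (q T) v + cell_integral T (\<lambda>x. (\<alpha> x *v fst (q T) x) \<bullet> fst v x)
             - cell_integral T (\<lambda>x. weak_div k \<E> T v x * u T x) =
           - boundary_integral \<E> T (\<lambda>e x. l e x * normal_trace v T e x)) \<and>
        (\<forall>T\<in>\<T>. \<forall>w\<in>P_space (k + 1) T.
           cell_integral T (\<lambda>x. weak_div k \<E> T (q T) x * w x) = cell_integral T (\<lambda>x. f x * w x)) \<and>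
        (\<forall>\<phi>\<in>Lambda0_space \<Omega> k \<E>.
           (\<Sum>T\<in>\<T>. boundary_integral \<E> T (\<lambda>e x. normal_trace (q T) T e x * \<phi> e x)) = 0)}"

text \<open>Since every boundary face belongs to exactly one element, the integral over \<open>\<partial>\<Omega>\<close> of \<open>g\<close> times the
  normal trace of \<open>v\<close> is the sum over all elements and their boundary faces. Likewise the integral
  of \<open>f w\<close> over \<open>\<Omega>\<close> for piecewise given \<open>w\<close> is a sum over the elements.\<close>

definition wg_solutions ::
    "(real^'n) set \<Rightarrow> (real^'n) set set \<Rightarrow> (real^'n) set set \<Rightarrow> nat \<Rightarrow>
     (real^'n \<Rightarrow> real^'n^'n) \<Rightarrow> (real^'n \<Rightarrow> real) \<Rightarrow> (real^'n \<Rightarrow> real) \<Rightarrow>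
     (((real^'n) set \<Rightarrow> 'n weak_fun) \<times> ((real^'n) set \<Rightarrow> real^'n \<Rightarrow> real)) set" where
  "wg_solutions \<Omega> \<T> \<E> k \<alpha> f g =
     {(q, u). q \<in> V_space \<Omega> k \<T> \<E> \<and> u \<in> W_space k \<T> \<and>
        (\<forall>v\<in>V_space \<Omega> k \<T> \<E>.
           (\<Sum>T\<in>\<T>. a_form \<alpha> \<E> T (q T) (v T)) - (\<Sum>T\<in>\<T>. b_form k \<E> T (v T) (u T)) =
           - (\<Sum>T\<in>\<T>. \<Sum>e | e \<in> faces_of \<E> T \<and> e \<subseteq> frontier \<Omega>.
                face_integral e (\<lambda>x. g x * normal_trace (v T) T e x))) \<and>
        (\<forall>w\<in>W_space k \<T>.
           (\<Sum>T\<in>\<T>. b_form k \<E> T (q T) (w T)) = (\<Sum>T\<in>\<T>. cell_integral T (\<lambda>x. f x * w T x)))}"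

end

theory Submission
  imports Defs
begin

text \<open>Both schemes are governed by one observation. If the energy of a flux is zero, then so are its
  interior part, as the coefficient is positive definite, and its normal traces, because of the
  stabilizer (\<open>energy_form_nonneg\<close>). If a potential is orthogonal to the weak divergences of all
  fluxes without jumps, then its gradient is zero, so it is constant on each element; moreover the
  constants agree across interior faces and vanish at boundary faces (\<open>div_form_kernel\<close>). They are all
  zero: otherwise follow a generic ray out of the union of the elements with a given nonzero
  value; it leaves the union through the relative interior of a face, which can neither be an
  interior nor a boundary face (\<open>facewise_equal_imp_zero\<close>).

  Hence the scheme without multiplier has at most one solution (\<open>wg_fields_unique\<close>). A solution of the
  hybridized scheme solves the other one as well: the jump of its flux is itself an admissible test
  multiplier, so it is zero, and for test functions without jumps the multipliers on interior faces
  cancel (\<open>hybrid_imp_wg_fields\<close>). Therefore flux and potential of the two solutions agree, and the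
  hybridized scheme determines them uniquely; its first equation then determines the multiplier
  (\<open>hybrid_multiplier_unique\<close>).

  For existence the hybridized scheme, with the prescribed boundary multipliers moved to the
  right-hand side, is read as one variational equation on a finite-dimensional space. Such an
  equation is solvable if the load vanishes on the right kernel of the form
  (\<open>variational_problem_solvable\<close>), and the same observation shows that it does (\<open>system_kernel\<close>).
  The discrete functions are represented by families of polynomials on the whole space, because
  extensional functions cannot be added.\<close>

section \<open>Polynomials\<close>

lemma finite_multiindices: "finite {m :: 'n::finite \<Rightarrow> nat. (\<Sum>i\<in>UNIV. m i) \<le> r}"
proof (rule finite_subset)
  show "{m :: 'n \<Rightarrow> nat. (\<Sum>i\<in>UNIV. m i) \<le> r} \<subseteq> (UNIV \<rightarrow>\<^sub>E {..r})"
  proof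
    fix m :: "'n \<Rightarrow> nat" assume m: "m \<in> {m. (\<Sum>i\<in>UNIV. m i) \<le> r}"
    have "m i \<le> r" for i
      using m member_le_sum[of i UNIV m] by force
    then show "m \<in> (UNIV \<rightarrow>\<^sub>E {..r})" by auto
  qed
  show "finite ((UNIV :: 'n set) \<rightarrow>\<^sub>E {..r})" by (intro finite_PiE) auto
qed

lemma poly_of_degree_0: "poly_of_degree r (\<lambda>x. 0)"
  unfolding poly_of_degree_def by (rule exI[of _ "\<lambda>_. 0"]) simp

lemma poly_of_degree_lincomb:
  assumes "poly_of_degree r p" "poly_of_degree r q"
  shows "poly_of_degree r (\<lambda>x. a * p x + q x)"
proof -
  obtain c d where
    "\<And>x. p x = (\<Sum>m | (\<Sum>i\<in>UNIV. m i) \<le> r. c m * (\<Prod>i\<in>UNIV. (x $ i) ^ m i))"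
    "\<And>x. q x = (\<Sum>m | (\<Sum>i\<in>UNIV. m i) \<le> r. d m * (\<Prod>i\<in>UNIV. (x $ i) ^ m i))"
    using assms unfolding poly_of_degree_def by blast
  then show ?thesis unfolding poly_of_degree_def
    by (intro exI[of _ "\<lambda>m. a * c m + d m"])
       (simp add: sum_distrib_left sum.distrib algebra_simps)
qed

lemma poly_of_degree_scale: "poly_of_degree r p \<Longrightarrow> poly_of_degree r (\<lambda>x. a * p x)"
  using poly_of_degree_lincomb[OF _ poly_of_degree_0] by fastforce

lemma poly_of_degree_add:
  "poly_of_degree r p \<Longrightarrow> poly_of_degree r q \<Longrightarrow> poly_of_degree r (\<lambda>x. p x + q x)"
  using poly_of_degree_lincomb[of r p q 1] by simp

lemma poly_of_degree_diff:
  "poly_of_degree r p \<Longrightarrow> poly_of_degree r q \<Longrightarrow> poly_of_degree r (\<lambda>x. p x - q x)"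
  using poly_of_degree_lincomb[of r q p "-1"] by simp

lemma poly_of_degree_sum:
  "finite I \<Longrightarrow> (\<And>i. i \<in> I \<Longrightarrow> poly_of_degree r (p i)) \<Longrightarrow> poly_of_degree r (\<lambda>x. \<Sum>i\<in>I. p i x)"
  by (induction I rule: finite_induct) (auto intro: poly_of_degree_0 poly_of_degree_add)

lemma poly_of_degree_monomial:
  assumes "(\<Sum>i\<in>UNIV. m i) \<le> r"
  shows "poly_of_degree r (\<lambda>x. \<Prod>i\<in>UNIV. (x $ i) ^ m i)"
  unfolding poly_of_degree_def
proof (intro exI[of _ "\<lambda>m'. of_bool (m' = m)"] allI)
  fix x :: "real^'a"
  show "(\<Prod>i\<in>UNIV. (x $ i) ^ m i) =
     (\<Sum>m' | (\<Sum>i\<in>UNIV. m' i) \<le> r. of_bool (m' = m) * (\<Prod>i\<in>UNIV. (x $ i) ^ m' i))"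
    using assms by (subst sum.remove[of _ m]) (auto simp: finite_multiindices intro!: sum.neutral)
qed

lemma poly_of_degree_const: "poly_of_degree r (\<lambda>x. c)"
proof -
  have "poly_of_degree r (\<lambda>x. c * (\<Prod>i\<in>UNIV. (x $ i) ^ 0))"
    by (rule poly_of_degree_scale, rule poly_of_degree_monomial) simp
  then show ?thesis by simp
qed

lemma poly_of_degree_continuous: "poly_of_degree r p \<Longrightarrow> continuous_on S p"
  unfolding poly_of_degree_def by (auto intro!: continuous_intros)

text \<open>Differentiating a monomial in the direction of a coordinate axis lowers one exponent by one; the
  truncated subtraction is harmless because the coefficient is zero when the exponent is.\<close>

lemma monomial_gradient:
  assumes "(\<Sum>i\<in>UNIV. m i) \<le> Suc r"
  shows "\<exists>D. (\<forall>i. poly_of_degree r (\<lambda>x. D x $ i)) \<and>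
     (\<forall>x::real^'n. GDERIV (\<lambda>x. \<Prod>i\<in>UNIV. (x $ i) ^ m i) x :> D x)"
proof -
  define D :: "real^'n \<Rightarrow> real^'n" where
    "D x = (\<chi> j. of_nat (m j) * (\<Prod>i\<in>UNIV. (x $ i) ^ (if i = j then m j - 1 else m i)))" for x
  have eq: "D x $ j = of_nat (m j) * (x $ j) ^ (m j - 1) * (\<Prod>i\<in>UNIV - {j}. (x $ i) ^ m i)" for x j
    unfolding D_def by (subst vec_lambda_beta, subst prod.remove[of _ j]) auto
  have "poly_of_degree r (\<lambda>x. D x $ j)" for j
  proof (cases "m j = 0")
    case True
    then show ?thesis by (simp add: D_def poly_of_degree_0)
  next
    case False
    have "(\<Sum>i\<in>UNIV. m i) = Suc (\<Sum>i\<in>UNIV. if i = j then m j - 1 else m i)"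
      using False by (simp add: sum.remove[of _ j])
    then have "(\<Sum>i\<in>UNIV. if i = j then m j - 1 else m i) \<le> r"
      using assms by linarith
    from poly_of_degree_scale[OF poly_of_degree_monomial[OF this], of "of_nat (m j)"]
    show ?thesis by (simp add: D_def)
  qed
  moreover have "GDERIV (\<lambda>x. \<Prod>i\<in>UNIV. (x $ i) ^ m i) x :> D x" for x
  proof -
    have "((\<lambda>x. \<Prod>i\<in>UNIV. (x $ i) ^ m i) has_derivative
       (\<lambda>h. \<Sum>j\<in>UNIV. (of_nat (m j) * h $ j * (x $ j) ^ (m j - 1)) *
          (\<Prod>i\<in>UNIV - {j}. (x $ i) ^ m i))) (at x)"
      by (intro has_derivative_prod has_derivative_power
          bounded_linear.has_derivative[OF bounded_linear_vec_nth] has_derivative_ident)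
    moreover have "(\<lambda>h. \<Sum>j\<in>UNIV. (of_nat (m j) * h $ j * (x $ j) ^ (m j - 1)) *
          (\<Prod>i\<in>UNIV - {j}. (x $ i) ^ m i)) = (\<lambda>h. h \<bullet> D x)"
      by (auto simp: inner_vec_def eq intro!: ext sum.cong)
    ultimately show ?thesis unfolding gderiv_def by simp
  qed
  ultimately show ?thesis by blast
qed

lemma poly_gradient_exists:
  assumes "poly_of_degree (Suc r) p"
  shows "\<exists>D. (\<forall>i. poly_of_degree r (\<lambda>x. D x $ i)) \<and> (\<forall>x::real^'n. GDERIV p x :> D x)"
proof -
  let ?M = "{m :: 'n \<Rightarrow> nat. (\<Sum>i\<in>UNIV. m i) \<le> Suc r}"
  obtain c where c: "p = (\<lambda>x. \<Sum>m\<in>?M. c m * (\<Prod>i\<in>UNIV. (x $ i) ^ m i))"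
    using assms unfolding poly_of_degree_def by blast
  have "\<forall>m\<in>?M. \<exists>D. (\<forall>i. poly_of_degree r (\<lambda>x. D x $ i)) \<and>
     (\<forall>x::real^'n. GDERIV (\<lambda>x. \<Prod>i\<in>UNIV. (x $ i) ^ m i) x :> D x)"
    using monomial_gradient by blast
  then obtain D where D: "\<And>m i. m \<in> ?M \<Longrightarrow> poly_of_degree r (\<lambda>x. D m x $ i)"
    "\<And>m x. m \<in> ?M \<Longrightarrow> GDERIV (\<lambda>x. \<Prod>i\<in>UNIV. (x $ i) ^ m i) x :> D m x"
    by (auto simp: bchoice_iff)
  have "poly_of_degree r (\<lambda>x. (\<Sum>m\<in>?M. c m *\<^sub>R D m x) $ i)" for i
    unfolding sum_component vector_scaleR_component real_scaleR_def
    by (intro poly_of_degree_sum poly_of_degree_scale D(1) finite_multiindices)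
  moreover have "GDERIV p x :> (\<Sum>m\<in>?M. c m *\<^sub>R D m x)" for x
    unfolding c gderiv_def inner_sum_right inner_scaleR_right
    by (intro has_derivative_sum has_derivative_mult_right D(2)[unfolded gderiv_def])
  ultimately show ?thesis
    by (intro exI[of _ "\<lambda>x. \<Sum>m\<in>?M. c m *\<^sub>R D m x"] conjI allI)
qed

lemma grad_eqI:
  assumes "GDERIV \<phi> x :> D"
  shows "grad \<phi> x = D"
proof -
  have "D' = D" if "GDERIV \<phi> x :> D'" for D'
  proof -
    have "(\<lambda>h. h \<bullet> D') = (\<lambda>h. h \<bullet> D)"
      using assms that has_derivative_unique unfolding gderiv_def by blast
    then have "(D' - D) \<bullet> D' = (D' - D) \<bullet> D" by metis
    then show ?thesis
      by (metis inner_diff_right inner_eq_zero_iff right_minus_eq)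
  qed
  then show ?thesis unfolding grad_def using assms by blast
qed

lemma poly_gradient:
  assumes "poly_of_degree (Suc r) p"
  shows poly_of_degree_grad: "poly_of_degree r (\<lambda>x. grad p x $ i)"
    and poly_has_gradient: "GDERIV p x :> grad p x"
proof -
  obtain D where D: "\<And>i. poly_of_degree r (\<lambda>x. D x $ i)" "\<And>x. GDERIV p x :> D x"
    using poly_gradient_exists[OF assms] by blast
  have "grad p = D" using grad_eqI[OF D(2)] by blast
  with D show "poly_of_degree r (\<lambda>x. grad p x $ i)" "GDERIV p x :> grad p x" by auto
qed

lemma poly_vec_continuous:
  assumes "\<And>i. poly_of_degree r (\<lambda>x. v x $ i)"
  shows "continuous_on S (v :: real^'n \<Rightarrow> real^'n)"
proof -
  have "continuous_on S (\<lambda>x. \<chi> i. v x $ i)"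
    using assms by (intro continuous_on_vec_lambda poly_of_degree_continuous)
  then show ?thesis by simp
qed

lemma grad_lincomb:
  assumes "poly_of_degree (Suc r) p" "poly_of_degree (Suc r) q"
  shows "grad (\<lambda>x. a * p x + q x) x = a *\<^sub>R grad p x + grad q x"
proof (rule grad_eqI)
  show "GDERIV (\<lambda>x. a * p x + q x) x :> a *\<^sub>R grad p x + grad q x"
    using poly_has_gradient[OF assms(1), of x] poly_has_gradient[OF assms(2), of x]
    unfolding gderiv_def inner_add_right inner_scaleR_right
    by (intro has_derivative_add has_derivative_mult_right)
qed

section \<open>Solvability of finite-dimensional variational problems\<close>

text \<open>Linearity on a set \<open>V\<close> of real functions, which is closed under linear combinations wherever this
  is used.\<close>

definition linear_functional_on :: "('z \<Rightarrow> real) set \<Rightarrow> (('z \<Rightarrow> real) \<Rightarrow> real) \<Rightarrow> bool" where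
  "linear_functional_on V F \<longleftrightarrow>
     (\<forall>a. \<forall>x\<in>V. \<forall>y\<in>V. F (\<lambda>z. a * x z + y z) = a * F x + F y)"

text \<open>A functional on a space \<open>V\<close> of real functions which vanishes on the common kernel of finitely
  many functionals is a linear combination of them. Neither a basis of \<open>V\<close> nor a count of
  dimensions is needed.\<close>

lemma functional_in_span:
  assumes "finite I"
    and V: "\<And>a x y. x \<in> V \<Longrightarrow> y \<in> V \<Longrightarrow> (\<lambda>z. a * x z + y z) \<in> V"
    and f: "\<And>i. i \<in> I \<Longrightarrow> linear_functional_on V (f i)"
    and "linear_functional_on V g"
    and "\<And>x. x \<in> V \<Longrightarrow> (\<And>i. i \<in> I \<Longrightarrow> f i x = 0) \<Longrightarrow> g x = 0"
  shows "\<exists>c. \<forall>x\<in>V. g x = (\<Sum>i\<in>I. c i * f i x)"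
  using assms(1) f assms(4,5)
proof (induction I arbitrary: g rule: finite_induct)
  case empty
  then show ?case by auto
next
  case (insert j I)
  define K where "K = {x\<in>V. \<forall>i\<in>I. f i x = 0}"
  have linf: "f i (\<lambda>z. a * x z + y z) = a * f i x + f i y"
    if "i \<in> insert j I" "x \<in> V" "y \<in> V" for i a x y
    using insert.prems(1)[OF that(1)] that(2,3) unfolding linear_functional_on_def by blast
  have ling: "g (\<lambda>z. a * x z + y z) = a * g x + g y" if "x \<in> V" "y \<in> V" for a x y
    using insert.prems(2) that unfolding linear_functional_on_def by blast
  obtain b where b: "g x = b * f j x" if "x \<in> K" for x
  proof (cases "\<exists>x0\<in>K. f j x0 \<noteq> 0")
    case True
    then obtain x0 where x0: "x0 \<in> V" "\<And>i. i \<in> I \<Longrightarrow> f i x0 = 0" "f j x0 \<noteq> 0"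
      unfolding K_def by blast
    have "g x = g x0 / f j x0 * f j x" if "x \<in> K" for x
    proof -
      have x: "x \<in> V" "\<And>i. i \<in> I \<Longrightarrow> f i x = 0" using that unfolding K_def by auto
      let ?y = "\<lambda>z. (- f j x / f j x0) * x0 z + x z"
      have "?y \<in> V" by (rule V) fact+
      moreover have "f i ?y = 0" if "i \<in> insert j I" for i
        using that x0 x by (subst linf) auto
      ultimately have "g ?y = 0" by (rule insert.prems(3))
      then show ?thesis using x0 x by (subst (asm) ling) (auto simp: field_simps)
    qed
    then show ?thesis using that by blast
  next
    case False
    have "g x = 0 * f j x" if "x \<in> K" for x
      using False that insert.prems(3)[of x] unfolding K_def by auto
    then show ?thesis using that by blast
  qed
  have "linear_functional_on V (\<lambda>x. g x - b * f j x)"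
    using linf ling unfolding linear_functional_on_def by (simp add: algebra_simps)
  moreover have "g x - b * f j x = 0" if "x \<in> V" "\<And>i. i \<in> I \<Longrightarrow> f i x = 0" for x
    using b that unfolding K_def by auto
  ultimately obtain c where c: "\<forall>x\<in>V. g x - b * f j x = (\<Sum>i\<in>I. c i * f i x)"
    using insert.IH[of "\<lambda>x. g x - b * f j x"] insert.prems(1) by auto
  have "g x = (\<Sum>i\<in>insert j I. (c(j := b)) i * f i x)" if "x \<in> V" for x
  proof -
    have "(\<Sum>i\<in>I. (c(j := b)) i * f i x) = (\<Sum>i\<in>I. c i * f i x)"
      using insert.hyps by (intro sum.cong) auto
    then show ?thesis using c that insert.hyps by fastforce
  qed
  then show ?case by blast
qed

text \<open>Families of polynomials, the \<open>j\<close>-th one of degree at most \<open>r j\<close>, with zero outside the index set.\<close>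

definition poly_family ::
    "'j set \<Rightarrow> ('j \<Rightarrow> nat) \<Rightarrow> ('j \<Rightarrow> real^'n \<Rightarrow> real) set" where
  "poly_family J r = {P. (\<forall>j\<in>J. poly_of_degree (r j) (P j)) \<and> (\<forall>j. j \<notin> J \<longrightarrow> P j = (\<lambda>x. 0))}"

lemma lincomb_poly_family:
  assumes "P \<in> poly_family J r" "Q \<in> poly_family J r"
  shows "(\<lambda>j x. a * P j x + Q j x) \<in> poly_family J r"
  using assms unfolding poly_family_def by (auto intro: poly_of_degree_lincomb)

text \<open>Let \<open>Q\<close> be in the right kernel if \<open>B P Q = 0\<close> for all \<open>P\<close>. If \<open>F\<close> vanishes on the right kernel, then
  \<open>B P Q = F Q\<close> has a solution \<open>P\<close>. The functionals \<open>B P\<close> for single monomials \<open>P\<close> span all of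
  them, so the result follows from the lemma on spans of functionals.\<close>

lemma variational_problem_solvable:
  fixes B :: "('j \<Rightarrow> real^'n \<Rightarrow> real) \<Rightarrow> ('j \<Rightarrow> real^'n \<Rightarrow> real) \<Rightarrow> real"
  assumes "finite J"
    and left: "\<And>a P P' Q. P \<in> poly_family J r \<Longrightarrow> P' \<in> poly_family J r \<Longrightarrow> Q \<in> poly_family J r \<Longrightarrow>
       B (\<lambda>j x. a * P j x + P' j x) Q = a * B P Q + B P' Q"
    and right: "\<And>a P Q Q'. P \<in> poly_family J r \<Longrightarrow> Q \<in> poly_family J r \<Longrightarrow> Q' \<in> poly_family J r \<Longrightarrow>
       B P (\<lambda>j x. a * Q j x + Q' j x) = a * B P Q + B P Q'"
    and F: "\<And>a Q Q'. Q \<in> poly_family J r \<Longrightarrow> Q' \<in> poly_family J r \<Longrightarrow>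
       F (\<lambda>j x. a * Q j x + Q' j x) = a * F Q + F Q'"
    and ker: "\<And>Q. Q \<in> poly_family J r \<Longrightarrow> (\<And>P. P \<in> poly_family J r \<Longrightarrow> B P Q = 0) \<Longrightarrow> F Q = 0"
  shows "\<exists>P\<in>poly_family J r. \<forall>Q\<in>poly_family J r. B P Q = F Q"
proof -
  let ?V = "poly_family J r :: ('j \<Rightarrow> real^'n \<Rightarrow> real) set"
  let ?M = "\<lambda>j. {m :: 'n \<Rightarrow> nat. (\<Sum>i\<in>UNIV. m i) \<le> r j}"
  define I where "I = Sigma J ?M"
  \<comment> \<open>the family with a single monomial as its only nonzero member\<close>
  define e :: "'j \<times> ('n \<Rightarrow> nat) \<Rightarrow> 'j \<Rightarrow> real^'n \<Rightarrow> real" where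
    "e = (\<lambda>(j, m) j' x. of_bool (j' = j) * (\<Prod>i\<in>UNIV. (x $ i) ^ m i))"
  have finI: "finite I" unfolding I_def using assms(1) by (auto simp: finite_multiindices)
  have eV: "e i \<in> ?V" if "i \<in> I" for i
    using that unfolding I_def e_def poly_family_def
    by (auto simp: poly_of_degree_0 poly_of_degree_monomial)
  have zeroV: "(\<lambda>j x. 0) \<in> ?V" unfolding poly_family_def by (simp add: poly_of_degree_0)
  have B0: "B (\<lambda>j x. 0) Q = 0" if "Q \<in> ?V" for Q
    using left[OF zeroV zeroV that, of 1] by simp
  have comb: "(\<lambda>j x. \<Sum>i\<in>I'. c i * e i j x) \<in> ?V \<and>
       (\<forall>Q\<in>?V. B (\<lambda>j x. \<Sum>i\<in>I'. c i * e i j x) Q = (\<Sum>i\<in>I'. c i * B (e i) Q))"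
    if "I' \<subseteq> I" for I' c
    using finite_subset[OF that finI] that
  proof (induction I' rule: finite_induct)
    case empty
    then show ?case using zeroV B0 by simp
  next
    case (insert i I')
    let ?S = "\<lambda>j x. \<Sum>i\<in>I'. c i * e i j x"
    have S: "?S \<in> ?V" "\<forall>Q\<in>?V. B ?S Q = (\<Sum>i\<in>I'. c i * B (e i) Q)"
      using insert by auto
    have "(\<lambda>j x. \<Sum>i\<in>insert i I'. c i * e i j x) = (\<lambda>j x. c i * e i j x + ?S j x)"
      using insert by simp
    then show ?case
      using S lincomb_poly_family[OF eV[of i] S(1), of "c i"] left[OF eV[of i] S(1), of _ "c i"] insert
      by simp
  qed
  have span: "\<exists>c. P = (\<lambda>j x. \<Sum>i\<in>I. c i * e i j x)" if "P \<in> ?V" for P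
  proof -
    have "\<forall>j\<in>J. \<exists>c. \<forall>x. P j x = (\<Sum>m\<in>?M j. c m * (\<Prod>i\<in>UNIV. (x $ i) ^ m i))"
      using that unfolding poly_family_def poly_of_degree_def by blast
    then obtain c where c: "\<And>j x. j \<in> J \<Longrightarrow>
        P j x = (\<Sum>m\<in>?M j. c j m * (\<Prod>i\<in>UNIV. (x $ i) ^ m i))"
      by (auto simp: bchoice_iff)
    have "P j x = (\<Sum>i\<in>I. (case i of (j, m) \<Rightarrow> c j m) * e i j x)" for j x
    proof -
      have "(\<Sum>i\<in>I. (case i of (j, m) \<Rightarrow> c j m) * e i j x) =
         (\<Sum>j'\<in>J. \<Sum>m\<in>?M j'. c j' m * (of_bool (j = j') * (\<Prod>i\<in>UNIV. (x $ i) ^ m i)))"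
        unfolding I_def using assms(1)
        by (subst sum.Sigma) (auto simp: e_def finite_multiindices intro!: sum.cong)
      also have "\<dots> = (\<Sum>j'\<in>J. if j' = j then P j x else 0)"
        by (rule sum.cong) (auto simp: c)
      also have "\<dots> = P j x"
        using assms(1) that unfolding poly_family_def by (auto simp: sum.delta)
      finally show ?thesis by simp
    qed
    then show ?thesis by (intro exI[of _ "\<lambda>(j, m). c j m"]) auto
  qed
  \<comment> \<open>families are curried functions, so the span lemma is applied to their uncurried forms\<close>
  have un: "curry (\<lambda>z. a * x z + y z) = (\<lambda>j t. a * curry x j t + curry y j t)" 
    for a and x y :: "'j \<times> (real^'n) \<Rightarrow> real"
    by (simp add: curry_def)
  have "\<exists>c. \<forall>x\<in>{x. curry x \<in> ?V}. F (curry x) = (\<Sum>i\<in>I. c i * B (e i) (curry x))"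
  proof (rule functional_in_span[OF finI])
    show "(\<lambda>z. a * x z + y z) \<in> {x. curry x \<in> ?V}" if "x \<in> {x. curry x \<in> ?V}" "y \<in> {x. curry x \<in> ?V}" for a x y
      using that lincomb_poly_family[of "curry x" J r "curry y" a] by (simp add: un)
    show "linear_functional_on {x. curry x \<in> ?V} (\<lambda>x. B (e i) (curry x))" if "i \<in> I" for i
      using right[OF eV[OF that]] unfolding linear_functional_on_def un by blast
    show "linear_functional_on {x. curry x \<in> ?V} (\<lambda>x. F (curry x))"
      using F unfolding linear_functional_on_def un by blast
    fix x assume x: "x \<in> {x. curry x \<in> ?V}" and 0: "\<And>i. i \<in> I \<Longrightarrow> B (e i) (curry x) = 0"
    have "B P (curry x) = 0" if P: "P \<in> ?V" for P
    proof -
      obtain c where c: "P = (\<lambda>j x. \<Sum>i\<in>I. c i * e i j x)" using span[OF P] by blast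
      have "B P (curry x) = (\<Sum>i\<in>I. c i * B (e i) (curry x))"
        using comb[of I c] x unfolding c by blast
      also have "\<dots> = 0" by (intro sum.neutral) (simp add: 0)
      finally show ?thesis .
    qed
    then show "F (curry x) = 0" using ker x by blast
  qed
  then obtain c where "\<And>x. curry x \<in> ?V \<Longrightarrow> F (curry x) = (\<Sum>i\<in>I. c i * B (e i) (curry x))"
    by blast
  from this[of "case_prod _"] have c: "F Q = (\<Sum>i\<in>I. c i * B (e i) Q)" if "Q \<in> ?V" for Q
    using that by simp
  show ?thesis
    using comb[of I c] c by (intro bexI[of _ "\<lambda>j x. \<Sum>i\<in>I. c i * e i j x"]) auto
qed

section \<open>Polyhedral cells\<close>

lemma polyhedral_cell_compact: "polyhedral_cell m P \<Longrightarrow> compact P"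
  unfolding polyhedral_cell_def using compact_Union polytope_imp_compact by metis

lemma polyhedral_cell_closure_rel_interior:
  assumes "polyhedral_cell m P"
  shows "P \<subseteq> closure (rel_interior P)"
proof -
  obtain F where F: "\<And>C. C \<in> F \<Longrightarrow> polytope C \<and> aff_dim C = m" "P = \<Union>F" "aff_dim P = m"
    using assms unfolding polyhedral_cell_def by blast
  have "C \<subseteq> closure (rel_interior P)" if "C \<in> F" for C
  proof -
    have "affine hull C = affine hull P"
      using F that by (subst aff_dim_eq_full_gen[symmetric]) auto
    then have "rel_interior C \<subseteq> rel_interior P"
      using F that by (intro subset_rel_interior) auto
    then have "closure (rel_interior C) \<subseteq> closure (rel_interior P)" by (rule closure_mono)
    then show ?thesis
      using F(1)[OF that] convex_closure_rel_interior[of C] closure_subset[of C]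
      by (simp add: polytope_imp_convex)
  qed
  then show ?thesis using F(2) by auto
qed

lemma polyhedral_cell_rel_boundary:
  assumes "polyhedral_cell m P"
  shows "\<exists>\<S>. finite \<S> \<and> (\<forall>S\<in>\<S>. aff_dim S \<le> m - 1) \<and> P - rel_interior P \<subseteq> \<Union>\<S>"
proof -
  obtain F where F: "finite F" "\<And>C. C \<in> F \<Longrightarrow> polytope C \<and> aff_dim C = m" "P = \<Union>F" "aff_dim P = m"
    using assms unfolding polyhedral_cell_def by blast
  have sub: "C - rel_interior P \<subseteq> \<Union>{S. S facet_of C}" if "C \<in> F" for C
  proof -
    have "affine hull C = affine hull P"
      using F that by (subst aff_dim_eq_full_gen[symmetric]) auto
    then have "rel_interior C \<subseteq> rel_interior P"
      using F that by (intro subset_rel_interior) auto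
    then show ?thesis
      using rel_boundary_of_polyhedron[of C] F(2)[OF that] polytope_imp_polyhedron by blast
  qed
  show ?thesis
  proof (intro exI[of _ "\<Union>C\<in>F. {S. S facet_of C}"] conjI ballI)
    show "finite (\<Union>C\<in>F. {S. S facet_of C})"
      using F by (auto intro!: finite_polytope_facets)
    show "aff_dim S \<le> m - 1" if "S \<in> (\<Union>C\<in>F. {S. S facet_of C})" for S
      using that F(2) by (auto simp: facet_of_def)
    show "P - rel_interior P \<subseteq> \<Union>(\<Union>C\<in>F. {S. S facet_of C})"
      using sub F(3) by blast
  qed
qed

lemma polyhedral_cell_meets_rel_interior:
  assumes "polyhedral_cell m P" "open U" "P \<inter> U \<noteq> {}"
  obtains x where "x \<in> rel_interior P" "x \<in> U"
proof -
  have "closure (rel_interior P) \<inter> U \<noteq> {}"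
    using assms polyhedral_cell_closure_rel_interior by blast
  then show ?thesis using that open_Int_closure_eq_empty[OF assms(2)] by blast
qed

lemma polyhedral_cell_nonempty: "polyhedral_cell m P \<Longrightarrow> 0 \<le> m \<Longrightarrow> P \<noteq> {}"
  unfolding polyhedral_cell_def by auto

lemma full_cell_rel_interior:
  fixes T :: "'a::euclidean_space set"
  assumes "polyhedral_cell (int DIM('a)) T"
  shows "rel_interior T = interior T"
  using assms unfolding polyhedral_cell_def by (intro interior_rel_interior) blast

lemma negligible_aff_dim:
  fixes S :: "'a::euclidean_space set"
  assumes "aff_dim S < int DIM('a)"
  shows "negligible S"
proof -
  obtain a b where "a \<noteq> 0" "S \<subseteq> {x. a \<bullet> x = b}"
    using aff_lowdim_subset_hyperplane[OF assms] by blast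
  then show ?thesis using negligible_hyperplane negligible_subset by blast
qed

section \<open>Measures on cells and faces\<close>

text \<open>The common features of Lebesgue measure on an element and of surface measure on a face: continuous
  functions are integrable and a continuous function whose square has integral zero vanishes
  everywhere.\<close>

definition full_support :: "'a::euclidean_space measure \<Rightarrow> 'a set \<Rightarrow> bool" where
  "full_support M K \<longleftrightarrow> compact K \<and> sets borel \<subseteq> sets M \<and> space M = UNIV \<and> emeasure M K < \<infinity> \<and>
     (\<forall>U. open U \<and> K \<inter> U \<noteq> {} \<longrightarrow> emeasure M (K \<inter> U) \<noteq> 0)"

lemma borel_measurable_of_finer:
  assumes "sets borel \<subseteq> sets M" "space M = UNIV" "f \<in> borel_measurable borel"
  shows "f \<in> borel_measurable M"
  using assms(3) measurable_mono[of borel borel borel M] assms(1,2) by auto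

lemma full_support_set_measurable:
  assumes "full_support M K" "continuous_on K (F :: _ \<Rightarrow> real)"
  shows "set_borel_measurable M K F"
  unfolding set_borel_measurable_def
  using assms unfolding full_support_def
  by (intro borel_measurable_of_finer[of M] borel_measurable_continuous_on_indicator borel_compact) auto

lemma set_integrable_bounded:
  fixes g :: "_ \<Rightarrow> real"
  assumes "full_support M K" "set_borel_measurable M K g" "AE x in M. x \<in> K \<longrightarrow> \<bar>g x\<bar> \<le> C"
  shows "set_integrable M K g"
  unfolding set_integrable_def
proof (rule integrableI_bounded_set[of K _ _ C])
  show "K \<in> sets M" "emeasure M K < \<infinity>"
    using assms(1) borel_compact unfolding full_support_def by auto
  show "(\<lambda>x. indicat_real K x *\<^sub>R g x) \<in> borel_measurable M"
    using assms(2) unfolding set_borel_measurable_def .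
  show "AE x in M. x \<in> K \<longrightarrow> norm (indicat_real K x *\<^sub>R g x) \<le> C"
    using assms(3) by (auto simp: indicator_def)
qed (simp add: indicator_def)

lemma full_support_integrable:
  assumes "full_support M K" "continuous_on K (F :: _ \<Rightarrow> real)"
  shows "set_integrable M K F"
proof -
  have "compact (F ` K)"
    using assms unfolding full_support_def by (intro compact_continuous_image) auto
  then obtain C where "\<forall>y\<in>F ` K. norm y \<le> C"
    using compact_imp_bounded bounded_iff by blast
  then show ?thesis
    by (intro set_integrable_bounded[OF assms(1) full_support_set_measurable[OF assms], of C]) auto
qed

lemma set_borel_measurable_mult:
  fixes g h :: "_ \<Rightarrow> real"
  assumes "set_borel_measurable M K g" "set_borel_measurable M K h"
  shows "set_borel_measurable M K (\<lambda>x. g x * h x)"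
proof -
  have "(\<lambda>x. indicator K x *\<^sub>R (g x * h x)) =
      (\<lambda>x. (indicator K x *\<^sub>R g x) * (indicator K x *\<^sub>R h x))"
    by (auto simp: indicator_def)
  then show ?thesis
    using assms unfolding set_borel_measurable_def by simp
qed

lemma set_integrable_bounded_mult:
  fixes g F :: "_ \<Rightarrow> real"
  assumes "full_support M K" "set_borel_measurable M K g" "AE x in M. x \<in> K \<longrightarrow> \<bar>g x\<bar> \<le> C"
    "continuous_on K F"
  shows "set_integrable M K (\<lambda>x. g x * F x)"
proof (rule set_integrable_bound)
  show "set_integrable M K (\<lambda>x. C * F x)"
    using assms by (intro full_support_integrable continuous_intros)
  show "set_borel_measurable M K (\<lambda>x. g x * F x)"
    by (rule set_borel_measurable_mult[OF assms(2) full_support_set_measurable[OF assms(1,4)]])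
  show "AE x in M. x \<in> K \<longrightarrow> norm (g x * F x) \<le> norm (C * F x)"
    using assms(3) by eventually_elim (auto simp: abs_mult intro!: mult_right_mono)
qed

lemma set_integrable_L2_mult:
  assumes "full_support M K" "L2_on M K g" "continuous_on K F"
  shows "set_integrable M K (\<lambda>x. g x * F x)"
proof (rule set_integrable_bound)
  show "set_integrable M K (\<lambda>x. (g x)\<^sup>2 + (F x)\<^sup>2)"
    using assms(2) full_support_integrable[OF assms(1) continuous_on_power[OF assms(3)]]
    unfolding L2_on_def by (intro set_integral_add(1)) auto
  show "set_borel_measurable M K (\<lambda>x. g x * F x)"
    using assms(2) full_support_set_measurable[OF assms(1,3)] unfolding L2_on_def
    by (intro set_borel_measurable_mult) auto
  have "\<bar>a * b\<bar> \<le> \<bar>a\<^sup>2 + b\<^sup>2\<bar>" for a b :: real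
  proof -
    have "2 * (\<bar>a\<bar> * \<bar>b\<bar>) \<le> a\<^sup>2 + b\<^sup>2"
      using sum_squares_bound[of "\<bar>a\<bar>" "\<bar>b\<bar>"] by simp
    moreover have "0 \<le> \<bar>a\<bar> * \<bar>b\<bar>" by simp
    ultimately have "\<bar>a\<bar> * \<bar>b\<bar> \<le> a\<^sup>2 + b\<^sup>2" by linarith
    then show ?thesis by (simp add: abs_mult)
  qed
  then show "AE x in M. x \<in> K \<longrightarrow> norm (g x * F x) \<le> norm ((g x)\<^sup>2 + (F x)\<^sup>2)"
    by (simp only: real_norm_def) simp
qed

lemma full_support_zero:
  assumes M: "full_support M K" and F: "continuous_on K (F :: _ \<Rightarrow> real)"
    and "(LINT x:K|M. (F x)\<^sup>2) = 0" "x \<in> K"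
  shows "F x = 0"
proof (rule ccontr)
  assume "F x \<noteq> 0"
  have "openin (top_of_set K) (K \<inter> F -` (- {0}))"
    using F by (intro continuous_openin_preimage_gen) auto
  then obtain U where U: "open U" "K \<inter> F -` (- {0}) = K \<inter> U"
    unfolding openin_open by blast
  with \<open>F x \<noteq> 0\<close> \<open>x \<in> K\<close> have "K \<inter> U \<noteq> {}" by auto
  with M U(1) have pos: "emeasure M (K \<inter> U) \<noteq> 0"
    unfolding full_support_def by blast
  have "set_integrable M K (\<lambda>x. (F x)\<^sup>2)"
    using F by (intro full_support_integrable[OF M] continuous_intros)
  then have "AE x in M. indicator K x *\<^sub>R (F x)\<^sup>2 = 0"
    using assms(3) unfolding set_integrable_def set_lebesgue_integral_def
    by (subst (asm) integral_nonneg_eq_0_iff_AE) auto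
  then have "AE x in M. \<not> x \<in> K \<inter> U"
    using U(2) by (auto elim!: eventually_mono simp: indicator_def split: if_splits)
  moreover have "K \<inter> U \<in> sets M"
  proof -
    have "K \<inter> U \<in> sets borel"
      using M U(1) unfolding full_support_def by (intro sets.Int borel_compact borel_open) auto
    then show ?thesis using M unfolding full_support_def by blast
  qed
  ultimately have "emeasure M (K \<inter> U) = 0"
    using AE_iff_measurable[of "K \<inter> U" M "\<lambda>x. \<not> x \<in> K \<inter> U"] M unfolding full_support_def by auto
  with pos show False ..
qed

lemma full_support_lebesgue:
  fixes T :: "'a::euclidean_space set"
  assumes T: "polyhedral_cell (int DIM('a)) T"
  shows "full_support lebesgue T"
  unfolding full_support_def
proof (intro conjI allI impI)
  show cT: "compact T" using polyhedral_cell_compact[OF T] .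
  show "emeasure lebesgue T < \<infinity>"
    using emeasure_bounded_finite[OF compact_imp_bounded[OF cT]] cT
    by (simp add: borel_compact)
  fix U assume U: "open U \<and> T \<inter> U \<noteq> {}"
  then obtain x where "x \<in> interior T" "x \<in> U"
    using polyhedral_cell_meets_rel_interior[OF T, of U] full_cell_rel_interior[OF T] by auto
  then have "interior T \<inter> U \<noteq> {}" "open (interior T \<inter> U)" using U by auto
  then have "\<not> negligible (interior T \<inter> U)" using open_not_negligible by blast
  then have "\<not> negligible (T \<inter> U)"
    using negligible_subset[of "T \<inter> U" "interior T \<inter> U"] interior_subset[of T] by blast
  moreover have "T \<inter> U \<in> sets lebesgue"
    using sets.Int[of T borel U] borel_compact[OF cT] borel_open[of U] U
    by (simp add: sets_completionI_sets)
  ultimately show "emeasure lebesgue (T \<inter> U) \<noteq> 0"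
    by (auto simp: negligible_iff_null_sets null_sets_def)
qed auto

lemma closest_point_measurable:
  assumes "affine H" "H \<noteq> {}"
  shows "closest_point H \<in> measurable (restrict_space lborel {x. infdist x H \<le> 1/2}) borel"
proof (rule measurable_restrict_space1)
  have "closest_point H \<in> borel_measurable borel"
    using assms by (intro borel_measurable_continuous_onI continuous_on_closest_point
        affine_imp_convex affine_closed)
  then show "closest_point H \<in> borel_measurable lborel" by simp
qed

lemma emeasure_hyperplane_measure:
  assumes H: "affine H" "H \<noteq> {}" and A: "A \<in> sets borel"
  shows "emeasure (hyperplane_measure H) A =
    emeasure lborel {x. infdist x H \<le> 1/2 \<and> closest_point H x \<in> A}"
proof -
  let ?S = "{x. infdist x H \<le> 1/2}"
  have S: "?S \<in> sets borel"
    by (intro borel_closed closed_Collect_le continuous_intros)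
  have "emeasure (hyperplane_measure H) A =
     emeasure (restrict_space lborel ?S) (closest_point H -` A \<inter> space (restrict_space lborel ?S))"
    unfolding hyperplane_measure_def emeasure_distr[OF closest_point_measurable[OF H] A, symmetric]
    using A by simp
  also have "\<dots> = emeasure lborel (closest_point H -` A \<inter> ?S)"
    using S by (subst emeasure_restrict_space) (auto simp: space_restrict_space)
  also have "closest_point H -` A \<inter> ?S = {x. infdist x H \<le> 1/2 \<and> closest_point H x \<in> A}"
    by auto
  finally show ?thesis .
qed

lemma full_support_face:
  fixes e :: "'a::euclidean_space set"
  assumes e: "polyhedral_cell (int DIM('a) - 1) e"
  shows "full_support (face_measure e) e"
  unfolding full_support_def
proof (intro conjI allI impI)
  let ?H = "affine hull e"
  show ce: "compact e" using polyhedral_cell_compact[OF e] .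
  have "e \<noteq> {}" using polyhedral_cell_nonempty[OF e] DIM_positive[where 'a='a] by linarith
  then have H: "affine ?H" "?H \<noteq> {}" by auto
  have clH: "closed ?H" "convex ?H" by (auto simp: affine_closed affine_imp_convex)
  have dist: "dist x (closest_point ?H x) = infdist x ?H" for x
    using setdist_closest_point[OF clH(1) H(2)] by (simp add: infdist_eq_setdist)
  show "sets borel \<subseteq> sets (face_measure e)"
    unfolding face_measure_def hyperplane_measure_def by auto
  show "space (face_measure e) = UNIV"
    unfolding face_measure_def hyperplane_measure_def by simp
  have "{x. infdist x ?H \<le> 1/2 \<and> closest_point ?H x \<in> e} \<subseteq> {x + y |x y. x \<in> e \<and> y \<in> cball 0 (1/2)}"
  proof clarify
    fix x assume "infdist x ?H \<le> 1/2" "closest_point ?H x \<in> e"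
    then show "\<exists>a b. x = a + b \<and> a \<in> e \<and> b \<in> cball 0 (1/2)"
      using dist[of x]
      by (intro exI[of _ "closest_point ?H x"] exI[of _ "x - closest_point ?H x"])
         (auto simp: dist_norm norm_minus_commute)
  qed
  moreover have "bounded {x + y |x y. x \<in> e \<and> y \<in> cball (0::'a) (1/2)}"
    by (rule compact_imp_bounded[OF compact_sums[OF ce compact_cball]])
  ultimately have "bounded {x. infdist x ?H \<le> 1/2 \<and> closest_point ?H x \<in> e}"
    using bounded_subset by blast
  from emeasure_bounded_finite[OF this] show "emeasure (face_measure e) e < \<infinity>"
    unfolding face_measure_def emeasure_hyperplane_measure[OF H borel_compact[OF ce]] .
  fix U assume U: "open U \<and> e \<inter> U \<noteq> {}"
  then obtain x where x: "x \<in> rel_interior e" "x \<in> U"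
    using polyhedral_cell_meets_rel_interior[OF e] by blast
  then obtain \<epsilon>1 where 1: "\<epsilon>1 > 0" "ball x \<epsilon>1 \<inter> ?H \<subseteq> e"
    unfolding mem_rel_interior_ball by blast
  obtain \<epsilon>2 where 2: "\<epsilon>2 > 0" "ball x \<epsilon>2 \<subseteq> U"
    using U x(2) openE by blast
  define \<epsilon> where "\<epsilon> = min (min \<epsilon>1 \<epsilon>2) (1/2)"
  have \<epsilon>: "\<epsilon> > 0" using 1 2 unfolding \<epsilon>_def by auto
  have xH: "x \<in> ?H" using x(1) rel_interior_subset hull_subset by (metis subsetD)
  \<comment> \<open>the projection onto the hyperplane does not increase the distance to \<open>x\<close>\<close>
  have "ball x \<epsilon> \<subseteq> {y. infdist y ?H \<le> 1/2 \<and> closest_point ?H y \<in> e \<inter> U}"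
  proof
    fix y assume y: "y \<in> ball x \<epsilon>"
    have "dist (closest_point ?H x) (closest_point ?H y) \<le> dist x y"
      by (rule closest_point_lipschitz) (use clH H in auto)
    then have "closest_point ?H y \<in> ball x \<epsilon>"
      using y xH by (simp add: closest_point_self)
    moreover have "closest_point ?H y \<in> ?H" using closest_point_in_set[OF clH(1) H(2)] .
    moreover have "infdist y ?H \<le> dist y x" using xH by (rule infdist_le)
    ultimately show "y \<in> {y. infdist y ?H \<le> 1/2 \<and> closest_point ?H y \<in> e \<inter> U}"
      using 1 2 y unfolding \<epsilon>_def by (auto simp: dist_commute)
  qed
  moreover have "{y. infdist y ?H \<le> 1/2 \<and> closest_point ?H y \<in> e \<inter> U} \<in> sets lborel"
  proof -
    have "closest_point ?H \<in> borel_measurable borel"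
      by (intro borel_measurable_continuous_onI continuous_on_closest_point clH H)
    moreover have "e \<inter> U \<in> sets borel"
      using ce U by (intro sets.Int borel_compact borel_open) auto
    ultimately have "closest_point ?H -` (e \<inter> U) \<inter> space borel \<in> sets borel"
      by (rule measurable_sets)
    moreover have "{y. infdist y ?H \<le> 1/2} \<in> sets borel"
      by (intro borel_closed closed_Collect_le continuous_intros)
    ultimately have "{y. infdist y ?H \<le> 1/2} \<inter> (closest_point ?H -` (e \<inter> U) \<inter> space borel) \<in> sets borel"
      by blast
    moreover have "{y. infdist y ?H \<le> 1/2} \<inter> (closest_point ?H -` (e \<inter> U) \<inter> space borel) =
        {y. infdist y ?H \<le> 1/2 \<and> closest_point ?H y \<in> e \<inter> U}"
      by auto
    ultimately show ?thesis by (simp only: sets_lborel)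
  qed
  ultimately have "emeasure lborel (ball x \<epsilon>) \<le>
      emeasure lborel {y. infdist y ?H \<le> 1/2 \<and> closest_point ?H y \<in> e \<inter> U}"
    by (rule emeasure_mono)
  moreover have "emeasure lborel (ball x \<epsilon>) \<noteq> 0"
    using open_not_negligible[of "ball x \<epsilon>"] \<epsilon>
    by (auto simp: negligible_iff_null_sets null_sets_def)
  moreover have "e \<inter> U \<in> sets borel"
    using ce U by (intro sets.Int borel_compact borel_open) auto
  ultimately show "emeasure (face_measure e) (e \<inter> U) \<noteq> 0"
    unfolding face_measure_def emeasure_hyperplane_measure[OF H \<open>e \<inter> U \<in> sets borel\<close>]
    by (intro notI) (simp only: le_zero_eq)
qed

text \<open>The coefficient and the right-hand side are only controlled inside the domain, which an element
  may leave along a null set.\<close>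

lemma set_borel_measurable_lebesgue_null:
  fixes h :: "_ \<Rightarrow> real"
  assumes "set_borel_measurable lebesgue \<Omega> h" "T \<in> sets lebesgue" "negligible (T - \<Omega>)"
  shows "set_borel_measurable lebesgue T h"
  unfolding set_borel_measurable_def
proof (rule borel_measurable_AE)
  show "(\<lambda>x. indicator T x * (indicator \<Omega> x *\<^sub>R h x)) \<in> borel_measurable lebesgue"
    using assms(1,2) unfolding set_borel_measurable_def by (intro borel_measurable_times) auto
  have "AE x in lebesgue. x \<notin> T - \<Omega>"
    using assms(3) by (intro AE_not_in) (simp add: negligible_iff_null_sets)
  then show "AE x in lebesgue. indicator T x * (indicator \<Omega> x *\<^sub>R h x) = indicator T x *\<^sub>R h x"
    by eventually_elim (auto simp: indicator_def)
qed

lemma L2_on_lebesgue_null: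
  assumes "L2_on lebesgue \<Omega> f" "T \<in> sets lebesgue" "negligible (T - \<Omega>)"
  shows "L2_on lebesgue T f"
  unfolding L2_on_def
proof
  show m: "set_borel_measurable lebesgue T f"
    using assms set_borel_measurable_lebesgue_null unfolding L2_on_def by blast
  have "set_integrable lebesgue \<Omega> (\<lambda>x. (f x)\<^sup>2)" using assms(1) unfolding L2_on_def by blast
  then have i: "integrable lebesgue (\<lambda>x. indicator T x *\<^sub>R (indicator \<Omega> x *\<^sub>R (f x)\<^sup>2))"
    using assms(2) unfolding set_integrable_def by (rule integrable_mult_indicator[rotated])
  have "AE x in lebesgue. x \<notin> T - \<Omega>"
    using assms(3) by (intro AE_not_in) (simp add: negligible_iff_null_sets)
  then have ae: "AE x in lebesgue. indicator T x *\<^sub>R (indicator \<Omega> x *\<^sub>R (f x)\<^sup>2) = indicator T x *\<^sub>R (f x)\<^sup>2"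
    by eventually_elim (auto simp: indicator_def)
  show "set_integrable lebesgue T (\<lambda>x. (f x)\<^sup>2)"
    unfolding set_integrable_def
  proof (rule integrable_cong_AE_imp[OF i _ ae])
    show "(\<lambda>x. indicator T x *\<^sub>R (f x)\<^sup>2) \<in> borel_measurable lebesgue"
      using set_borel_measurable_mult[OF m m]
      unfolding set_borel_measurable_def power2_eq_square .
  qed
qed

lemma L2_on_subset:
  assumes "L2_on M S g" "K \<in> sets M" "K \<subseteq> S"
  shows "L2_on M K g"
  unfolding L2_on_def
proof
  have "(\<lambda>x. indicator S x *\<^sub>R g x) \<in> borel_measurable M"
    using assms(1) unfolding L2_on_def set_borel_measurable_def by blast
  then have "(\<lambda>x. indicator K x * (indicator S x *\<^sub>R g x)) \<in> borel_measurable M"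
    using assms(2) by (intro borel_measurable_times borel_measurable_indicator)
  moreover have "(\<lambda>x. indicator K x * (indicator S x *\<^sub>R g x)) = (\<lambda>x. indicator K x *\<^sub>R g x)"
    using assms(3) by (auto simp: indicator_def fun_eq_iff)
  ultimately show "set_borel_measurable M K g" unfolding set_borel_measurable_def by simp
  show "set_integrable M K (\<lambda>x. (g x)\<^sup>2)"
    using assms unfolding L2_on_def by (auto intro: set_integrable_subset[of M S])
qed

text \<open>The space \<open>P_space r K\<close> is a Hilbert space for the inner product of \<open>M\<close>, so every linear
  functional has a unique representative.\<close>

lemma poly_riesz:
  fixes K :: "(real^'n) set"
  assumes M: "full_support M K"
    and lin: "\<And>a p q. poly_of_degree r p \<Longrightarrow> poly_of_degree r q \<Longrightarrow> L (\<lambda>x. a * p x + q x) = a * L p + L q"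
    and local: "\<And>p q. poly_of_degree r p \<Longrightarrow> (\<And>x. x \<in> K \<Longrightarrow> p x = q x) \<Longrightarrow> L p = L q"
  shows "\<exists>!p. p \<in> P_space r K \<and> (\<forall>\<phi>\<in>P_space r K. (LINT x:K|M. p x * \<phi> x) = L \<phi>)"
proof -
  have int: "set_integrable M K (\<lambda>x. p x * q x)" if "poly_of_degree r p" "poly_of_degree r q" for p q
    using that by (intro full_support_integrable[OF M] continuous_intros poly_of_degree_continuous)
  let ?V = "poly_family UNIV (\<lambda>_::unit. r) :: (unit \<Rightarrow> real^'n \<Rightarrow> real) set"
  have V: "P \<in> ?V \<longleftrightarrow> poly_of_degree r (P ())" for P
    unfolding poly_family_def by auto
  have "\<exists>P\<in>?V. \<forall>Q\<in>?V. (LINT x:K|M. P () x * Q () x) = L (Q ())"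
  proof (rule variational_problem_solvable)
    fix Q assume Q: "Q \<in> ?V" and "\<And>P. P \<in> ?V \<Longrightarrow> (LINT x:K|M. P () x * Q () x) = 0"
    then have "(LINT x:K|M. (Q () x)\<^sup>2) = 0" by (simp add: power2_eq_square)
    then have "Q () x = 0" if "x \<in> K" for x
      using full_support_zero[OF M poly_of_degree_continuous] Q[unfolded V] that by blast
    then have "L (Q ()) = L (\<lambda>x. 0)" using Q V by (intro local) auto
    also have "\<dots> = 0" using lin[OF poly_of_degree_0 poly_of_degree_0, of 1] by simp
    finally show "L (Q ()) = 0" .
  next
    fix a P P' Q assume "P \<in> ?V" "P' \<in> ?V" "Q \<in> ?V"
    note P = this[unfolded V]
    show "(LINT x:K|M. (a * P () x + P' () x) * Q () x) =
        a * (LINT x:K|M. P () x * Q () x) + (LINT x:K|M. P' () x * Q () x)"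
      using P by (simp add: distrib_right mult.assoc set_integral_add int)
    show "(LINT x:K|M. Q () x * (a * P () x + P' () x)) =
        a * (LINT x:K|M. Q () x * P () x) + (LINT x:K|M. Q () x * P' () x)"
      using P by (simp add: distrib_left mult.left_commute[of _ a] set_integral_add int)
    show "L (\<lambda>x. a * P () x + P' () x) = a * L (P ()) + L (P' ())"
      using P by (intro lin)
  qed simp
  then obtain P where P: "P \<in> ?V" "\<And>Q. Q \<in> ?V \<Longrightarrow> (LINT x:K|M. P () x * Q () x) = L (Q ())"
    by blast
  define p where "p = P ()"
  have p: "poly_of_degree r p" "\<And>q. poly_of_degree r q \<Longrightarrow> (LINT x:K|M. p x * q x) = L q"
    using P(1) P(2)[of "\<lambda>_. q" for q] unfolding V p_def by auto
  have cong: "(LINT x:K|M. f x) = (LINT x:K|M. h x)" if "\<And>x. x \<in> K \<Longrightarrow> f x = h x" for f h :: "_ \<Rightarrow> real"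
    unfolding set_lebesgue_integral_def using that
    by (intro Bochner_Integration.integral_cong) (auto simp: indicator_def)
  show ?thesis
  proof (rule ex1I[of _ "restrict p K"])
    show "restrict p K \<in> P_space r K \<and> (\<forall>\<phi>\<in>P_space r K. (LINT x:K|M. restrict p K x * \<phi> x) = L \<phi>)"
    proof (intro conjI ballI)
      show "restrict p K \<in> P_space r K" using p(1) unfolding P_space_def by blast
      fix \<phi> assume "\<phi> \<in> P_space r K"
      then obtain q where q: "poly_of_degree r q" "\<phi> = restrict q K" unfolding P_space_def by blast
      have "(LINT x:K|M. restrict p K x * \<phi> x) = (LINT x:K|M. p x * q x)"
        by (rule cong) (simp add: q)
      also have "\<dots> = L \<phi>" using p(2)[OF q(1)] local[OF q(1), of \<phi>] q(2) by simp
      finally show "(LINT x:K|M. restrict p K x * \<phi> x) = L \<phi>" .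
    qed
    fix p' assume p': "p' \<in> P_space r K \<and> (\<forall>\<phi>\<in>P_space r K. (LINT x:K|M. p' x * \<phi> x) = L \<phi>)"
    then obtain q where q: "poly_of_degree r q" "p' = restrict q K" unfolding P_space_def by blast
    have "(LINT x:K|M. q x * (q x - p x)) = (LINT x:K|M. p x * (q x - p x))"
    proof -
      have d: "poly_of_degree r (\<lambda>x. q x - p x)" by (rule poly_of_degree_diff[OF q(1) p(1)])
      have "(LINT x:K|M. q x * (q x - p x)) = (LINT x:K|M. p' x * restrict (\<lambda>x. q x - p x) K x)"
        by (rule cong) (simp add: q)
      also have "\<dots> = L (restrict (\<lambda>x. q x - p x) K)"
        using p' d unfolding P_space_def by blast
      also have "\<dots> = L (\<lambda>x. q x - p x)" by (rule local[OF d, symmetric]) simp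
      finally show ?thesis using p(2)[OF d] by simp
    qed
    then have "(LINT x:K|M. (q x - p x)\<^sup>2) = 0"
      using set_integral_diff(2)[OF int int, of q "\<lambda>x. q x - p x" p "\<lambda>x. q x - p x"]
      by (simp add: q p poly_of_degree_diff power2_eq_square left_diff_distrib)
    then have "q x - p x = 0" if "x \<in> K" for x
      using full_support_zero[OF M poly_of_degree_continuous[OF poly_of_degree_diff[OF q(1) p(1)]]] that
      by blast
    then show "p' = restrict p K" unfolding q(2) by (intro restrict_ext) simp
  qed
qed

section \<open>Geometry of the mesh\<close>

lemma is_outer_normal_unique:
  assumes "is_outer_normal T e n1" "is_outer_normal T e n2" "rel_interior e \<noteq> {}"
  shows "n1 = n2"
proof (rule ccontr)
  assume neq: "n1 \<noteq> n2"
  obtain x where x: "x \<in> rel_interior e" using assms(3) by blast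
  obtain \<epsilon>1 where 1: "\<epsilon>1 > 0" "\<And>y. y \<in> ball x \<epsilon>1 \<Longrightarrow> y \<in> T \<longleftrightarrow> (y - x) \<bullet> n1 \<le> 0"
    using assms(1) x unfolding is_outer_normal_def by blast
  obtain \<epsilon>2 where 2: "\<epsilon>2 > 0" "\<And>y. y \<in> ball x \<epsilon>2 \<Longrightarrow> y \<in> T \<longleftrightarrow> (y - x) \<bullet> n2 \<le> 0"
    using assms(2) x unfolding is_outer_normal_def by blast
  have n: "n1 \<bullet> n1 = 1" "n2 \<bullet> n2 = 1"
    using assms(1,2) unfolding is_outer_normal_def by (simp_all add: norm_eq_1)
  have "0 < (n2 - n1) \<bullet> (n2 - n1)" using neq by simp
  then have lt: "n1 \<bullet> n2 < 1" using n by (simp add: inner_diff inner_commute)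
  define t where "t = min \<epsilon>1 \<epsilon>2 / 3"
  have t: "t > 0" "3 * t \<le> \<epsilon>1" "3 * t \<le> \<epsilon>2" using 1 2 unfolding t_def by auto
  \<comment> \<open>moving along \<open>n2 - n1\<close> leaves one half-space and stays in the other\<close>
  define y where "y = x + t *\<^sub>R (n2 - n1)"
  have "norm (n2 - n1) \<le> 2"
    using norm_triangle_ineq4[of n2 n1] n by (simp add: norm_eq_sqrt_inner)
  then have "t * norm (n2 - n1) \<le> t * 2" using t(1) by (intro mult_left_mono) auto
  then have "dist x y < 3 * t" using t(1) by (simp add: y_def dist_norm)
  then have "y \<in> ball x \<epsilon>1" "y \<in> ball x \<epsilon>2" using t by auto
  then have "((y - x) \<bullet> n1 \<le> 0) = ((y - x) \<bullet> n2 \<le> 0)" using 1 2 by blast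
  moreover have "(y - x) \<bullet> n1 = - (t * (1 - n1 \<bullet> n2))" "(y - x) \<bullet> n2 = t * (1 - n1 \<bullet> n2)"
    using n by (simp_all add: y_def inner_diff inner_commute algebra_simps)
  ultimately show False using t(1) lt by (simp add: mult_le_0_iff)
qed

text \<open>Two elements sharing a face fill a neighbourhood of each of its relative interior points.\<close>

lemma two_sided_neighbourhood:
  assumes n: "is_outer_normal T1 e n1" "is_outer_normal T2 e n2"
    and disj: "interior T1 \<inter> interior T2 = {}" and x: "x \<in> rel_interior e"
  shows "\<exists>\<epsilon>>0. ball x \<epsilon> \<subseteq> T1 \<union> T2"
proof -
  obtain \<epsilon>1 where 1: "\<epsilon>1 > 0" "\<And>y. y \<in> ball x \<epsilon>1 \<Longrightarrow> y \<in> T1 \<longleftrightarrow> (y - x) \<bullet> n1 \<le> 0"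
    using n(1) x unfolding is_outer_normal_def by blast
  obtain \<epsilon>2 where 2: "\<epsilon>2 > 0" "\<And>y. y \<in> ball x \<epsilon>2 \<Longrightarrow> y \<in> T2 \<longleftrightarrow> (y - x) \<bullet> n2 \<le> 0"
    using n(2) x unfolding is_outer_normal_def by blast
  have nn: "n1 \<bullet> n1 = 1" "n2 \<bullet> n2 = 1"
    using n unfolding is_outer_normal_def by (simp_all add: norm_eq_1)
  have inter: "z \<in> interior T1 \<inter> interior T2"
    if "z \<in> ball x \<epsilon>1 \<inter> ball x \<epsilon>2" "(z - x) \<bullet> n1 < 0" "(z - x) \<bullet> n2 < 0" for z
  proof -
    let ?Z = "ball x \<epsilon>1 \<inter> ball x \<epsilon>2 \<inter> {z. (z - x) \<bullet> n1 < 0} \<inter> {z. (z - x) \<bullet> n2 < 0}"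
    have "open ?Z" by (intro open_Int open_Collect_less continuous_intros) auto
    moreover have "?Z \<subseteq> T1" "?Z \<subseteq> T2" using 1 2 by auto
    ultimately show ?thesis using that interiorI by blast
  qed
  have "n2 = - n1"
  proof (rule ccontr)
    assume "n2 \<noteq> - n1"
    then have "n1 + n2 \<noteq> 0" by (metis add_eq_0_iff)
    then have "0 < (n1 + n2) \<bullet> (n1 + n2)" by simp
    then have gt: "- 1 < n1 \<bullet> n2" using nn by (simp add: inner_add inner_commute)
    define t where "t = min \<epsilon>1 \<epsilon>2 / 3"
    have t: "t > 0" "3 * t \<le> \<epsilon>1" "3 * t \<le> \<epsilon>2" using 1 2 unfolding t_def by auto
    define z where "z = x - t *\<^sub>R (n1 + n2)"
    have "norm (n1 + n2) \<le> 2"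
      using norm_triangle_ineq[of n1 n2] nn by (simp add: norm_eq_sqrt_inner)
    then have "t * norm (n1 + n2) \<le> t * 2" using t(1) by (intro mult_left_mono) auto
    then have "dist x z < 3 * t" using t(1) by (simp add: z_def dist_norm)
    then have "z \<in> ball x \<epsilon>1 \<inter> ball x \<epsilon>2" using t by auto
    moreover have "(z - x) \<bullet> n1 = - (t * (1 + n1 \<bullet> n2))" "(z - x) \<bullet> n2 = - (t * (1 + n1 \<bullet> n2))"
      using nn by (simp_all add: z_def inner_add inner_commute algebra_simps)
    moreover have "0 < t * (1 + n1 \<bullet> n2)" using t(1) gt by simp
    ultimately have "z \<in> interior T1 \<inter> interior T2" by (intro inter) simp_all
    then show False using disj by blast
  qed
  then have "ball x (min \<epsilon>1 \<epsilon>2) \<subseteq> T1 \<union> T2"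
    using 1 2 by (auto simp: inner_minus_right)
  then show ?thesis using 1 2 by (intro exI[of _ "min \<epsilon>1 \<epsilon>2"]) auto
qed

locale mesh =
  fixes \<Omega> :: "'a::euclidean_space set" and \<T> \<E> :: "'a set set"
  assumes polyhedral_mesh: "polyhedral_mesh \<Omega> \<T> \<E>"
begin

lemma finite_mesh: "finite \<T>" "finite \<E>"
  using polyhedral_mesh unfolding polyhedral_mesh_def by auto

lemma finite_faces: "finite (faces_of \<E> T)"
  using finite_mesh unfolding faces_of_def by auto

lemma cell: "T \<in> \<T> \<Longrightarrow> polyhedral_cell (int DIM('a)) T"
  using polyhedral_mesh unfolding polyhedral_mesh_def by blast

lemma face_cell: "e \<in> \<E> \<Longrightarrow> polyhedral_cell (int DIM('a) - 1) e"
  using polyhedral_mesh unfolding polyhedral_mesh_def by blast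

lemma cell_support: "T \<in> \<T> \<Longrightarrow> full_support lebesgue T"
  by (rule full_support_lebesgue[OF cell])

lemma face_support: "e \<in> \<E> \<Longrightarrow> full_support (face_measure e) e"
  by (rule full_support_face[OF face_cell])

lemma faces_ofD: "e \<in> faces_of \<E> T \<Longrightarrow> e \<in> \<E>"
  unfolding faces_of_def by auto

lemma face_subset: "T \<in> \<T> \<Longrightarrow> e \<in> faces_of \<E> T \<Longrightarrow> e \<subseteq> T"
  using frontier_subset_closed[OF compact_imp_closed[OF polyhedral_cell_compact[OF cell]]]
  unfolding faces_of_def by blast

lemma frontier_cell: "T \<in> \<T> \<Longrightarrow> frontier T = \<Union>(faces_of \<E> T)"
  using polyhedral_mesh unfolding polyhedral_mesh_def by blast

lemma rel_interior_face_nonempty: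
  assumes "e \<in> \<E>"
  shows "rel_interior e \<noteq> {}"
proof -
  have "0 \<le> int DIM('a) - 1" using DIM_positive[where 'a='a] by linarith
  then have "e \<inter> UNIV \<noteq> {}"
    using polyhedral_cell_nonempty[OF face_cell[OF assms]] by simp
  then show ?thesis
    by (rule polyhedral_cell_meets_rel_interior[OF face_cell[OF assms] open_UNIV]) blast
qed

lemma cell_interior_nonempty:
  assumes "T \<in> \<T>"
  obtains x where "x \<in> interior T"
proof -
  have "T \<inter> UNIV \<noteq> {}"
    using polyhedral_cell_nonempty[OF cell[OF assms]] by simp
  then show ?thesis
    by (rule polyhedral_cell_meets_rel_interior[OF cell[OF assms] open_UNIV])
       (use that full_cell_rel_interior[OF cell[OF assms]] in blast)
qed

lemma outer_normal: "T \<in> \<T> \<Longrightarrow> e \<in> faces_of \<E> T \<Longrightarrow> is_outer_normal T e (outer_normal T e)"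
proof -
  assume T: "T \<in> \<T>" and e: "e \<in> faces_of \<E> T"
  then obtain n where n: "is_outer_normal T e n"
    using polyhedral_mesh unfolding polyhedral_mesh_def by blast
  show ?thesis unfolding outer_normal_def
    using n is_outer_normal_unique[OF _ n rel_interior_face_nonempty[OF faces_ofD[OF e]]]
    by (rule theI)
qed

lemma outer_normal_unit: "T \<in> \<T> \<Longrightarrow> e \<in> faces_of \<E> T \<Longrightarrow> outer_normal T e \<bullet> outer_normal T e = 1"
  using outer_normal unfolding is_outer_normal_def by (simp add: norm_eq_1)

lemma diameter_pos: assumes "T \<in> \<T>" shows "diameter T > 0"
proof -
  obtain x where "x \<in> interior T" using cell_interior_nonempty[OF assms] .
  then obtain r where r: "r > 0" "cball x r \<subseteq> T" unfolding mem_interior_cball by blast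
  obtain b :: 'a where b: "b \<in> Basis" using nonempty_Basis by blast
  have "bounded T" using polyhedral_cell_compact[OF cell[OF assms]] compact_imp_bounded by blast
  moreover have "x \<in> T" "x + r *\<^sub>R b \<in> T" using r b by (auto simp: subset_eq dist_norm)
  ultimately have "dist x (x + r *\<^sub>R b) \<le> diameter T" using diameter_bounded_bound by blast
  then show ?thesis using r b by (simp add: dist_norm)
qed

lemma negligible_frontier_cell: assumes "T \<in> \<T>" shows "negligible (frontier T)"
  unfolding frontier_cell[OF assms]
proof (intro negligible_Union finite_faces)
  fix e assume "e \<in> faces_of \<E> T"
  then have "aff_dim e = int DIM('a) - 1"
    using face_cell faces_ofD unfolding polyhedral_cell_def by blast
  then show "negligible e" by (intro negligible_aff_dim) simp
qed

lemma negligible_outside_domain: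
  assumes "T \<in> \<T>" "interior (closure \<Omega>) = \<Omega>"
  shows "negligible (T - \<Omega>)"
proof -
  have "closure \<Omega> = \<Union>\<T>" using polyhedral_mesh unfolding polyhedral_mesh_def by blast
  then have "T \<subseteq> closure \<Omega>" using assms(1) by blast
  then have "interior T \<subseteq> \<Omega>" using assms(2) interior_mono by blast
  then have "T - \<Omega> \<subseteq> frontier T" unfolding frontier_def using closure_subset by blast
  then show ?thesis using negligible_frontier_cell[OF assms(1)] negligible_subset by blast
qed

lemma boundary_face_unique:
  assumes "e \<in> \<E>" "e \<subseteq> frontier \<Omega>"
  obtains T where "{T\<in>\<T>. e \<in> faces_of \<E> T} = {T}"
  using assms polyhedral_mesh unfolding polyhedral_mesh_def by (metis (no_types, lifting) card_1_singletonE)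

lemma interior_face_elements:
  assumes "e \<in> \<E>" "\<not> e \<subseteq> frontier \<Omega>"
  obtains T1 T2 where "T1 \<noteq> T2" "{T\<in>\<T>. e \<in> faces_of \<E> T} = {T1, T2}"
proof -
  have "card {T\<in>\<T>. e \<in> faces_of \<E> T} = 2"
    using assms polyhedral_mesh unfolding polyhedral_mesh_def by presburger
  then show ?thesis using that unfolding card_2_iff by blast
qed

text \<open>Starting in an element with a nonzero value, follow a ray that leaves the union of all elements
  with this value and avoids the relative boundaries of all faces. The last point of the ray in the
  union is a relative interior point of a face, which is not a boundary face as the value is nonzero.
  But then the union contains the elements on both sides of it and hence a neighbourhood of this
  point.\<close>

lemma facewise_equal_imp_zero:
  fixes c :: "'a set \<Rightarrow> real"
  assumes interior_face: "\<And>e T1 T2. e \<in> \<E> \<Longrightarrow> \<not> e \<subseteq> frontier \<Omega> \<Longrightarrow> T1 \<in> \<T> \<Longrightarrow> T2 \<in> \<T> \<Longrightarrow> T1 \<noteq> T2 \<Longrightarrow>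
       e \<in> faces_of \<E> T1 \<Longrightarrow> e \<in> faces_of \<E> T2 \<Longrightarrow> c T1 = c T2"
    and boundary_face: "\<And>e T. T \<in> \<T> \<Longrightarrow> e \<in> faces_of \<E> T \<Longrightarrow> e \<subseteq> frontier \<Omega> \<Longrightarrow> c T = 0"
    and T0: "T0 \<in> \<T>"
  shows "c T0 = 0"
proof (rule ccontr)
  assume c0: "c T0 \<noteq> 0"
  define U where "U = \<Union>{T\<in>\<T>. c T = c T0}"
  have TU: "T \<subseteq> U" if "T \<in> \<T>" "c T = c T0" for T unfolding U_def using that by blast
  have cU: "compact U"
    unfolding U_def using finite_mesh polyhedral_cell_compact[OF cell] by (intro compact_Union) auto
  obtain x0 where x0: "x0 \<in> interior T0" using cell_interior_nonempty[OF T0] .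
  have "\<forall>e\<in>\<E>. \<exists>\<S>. finite \<S> \<and> (\<forall>S\<in>\<S>. aff_dim S \<le> int DIM('a) - 1 - 1) \<and> e - rel_interior e \<subseteq> \<Union>\<S>"
    using polyhedral_cell_rel_boundary[OF face_cell] by blast
  from bchoice[OF this] obtain \<S> where
    "\<forall>e\<in>\<E>. finite (\<S> e) \<and> (\<forall>S\<in>\<S> e. aff_dim S \<le> int DIM('a) - 1 - 1) \<and> e - rel_interior e \<subseteq> \<Union>(\<S> e)"
    by blast
  then have \<S>: "\<And>e. e \<in> \<E> \<Longrightarrow> finite (\<S> e)"
    "\<And>e S. e \<in> \<E> \<Longrightarrow> S \<in> \<S> e \<Longrightarrow> aff_dim S \<le> int DIM('a) - 2"
    "\<And>e. e \<in> \<E> \<Longrightarrow> e - rel_interior e \<subseteq> \<Union>(\<S> e)"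
    by auto
  define N where "N = (\<Union>e\<in>\<E>. \<Union>S\<in>\<S> e. affine hull (insert x0 S))"
  have "negligible N"
    unfolding N_def
  proof (intro negligible_Union finite_imageI finite_mesh \<S>(1); clarify)
    fix e show "negligible (\<Union>S\<in>\<S> e. affine hull insert x0 S)" if "e \<in> \<E>"
    proof (intro negligible_Union finite_imageI \<S>(1) that; clarify)
      fix S assume "S \<in> \<S> e"
      then have "aff_dim (insert x0 S) < int DIM('a)"
        using \<S>(2)[OF that, of S] by (simp add: aff_dim_insert)
      then show "negligible (affine hull insert x0 S)"
        by (intro negligible_aff_dim) simp
    qed
  qed
  moreover obtain r where r: "U \<subseteq> cball 0 r"
    using compact_imp_bounded[OF cU] unfolding bounded_iff by force
  have "\<not> negligible (- cball (0::'a) r)"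
  proof (rule open_not_negligible)
    show "- cball (0::'a) r \<noteq> {}"
      using bounded_cball[of "0::'a" r] not_bounded_UNIV by (metis Compl_empty_eq double_complement)
  qed auto
  ultimately obtain y where y: "y \<notin> cball 0 r" "y \<notin> N"
    using negligible_subset[of N "- cball 0 r"] by blast
  then have yU: "y \<notin> U" using r by blast
  define p where "p t = x0 + t *\<^sub>R (y - x0)" for t :: real
  have contp: "continuous_on A p" for A unfolding p_def by (intro continuous_intros)
  define A where "A = {0..1} \<inter> p -` U"
  have "compact A"
    unfolding A_def using continuous_on_closed_vimage[of "{0..1::real}" p] contp compact_imp_closed[OF cU]
    by (intro compact_Int_closed) (auto intro: closed_vimage continuous_on_subset)
  moreover have "0 \<in> A"
    using x0 interior_subset TU[OF T0] unfolding A_def p_def by auto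
  ultimately obtain t where t: "t \<in> A" "\<And>s. s \<in> A \<Longrightarrow> s \<le> t"
    using compact_attains_sup[of A] by auto
  have t1: "0 \<le> t" "t < 1" "p t \<in> U"
    using t(1) yU unfolding A_def p_def by (auto simp: less_le)
  have noball: "\<not> ball (p t) \<epsilon> \<subseteq> U" if pos: "\<epsilon> > 0" for \<epsilon>
  proof
    assume sub: "ball (p t) \<epsilon> \<subseteq> U"
    have "isCont p t" using contp[of UNIV] by (simp add: continuous_on_eq_continuous_at)
    then obtain \<delta> where \<delta>: "\<delta> > 0" "\<And>s. dist s t < \<delta> \<Longrightarrow> dist (p s) (p t) < \<epsilon>"
      using pos unfolding continuous_at_eps_delta by blast
    define s where "s = min (t + \<delta>/2) 1"
    have "dist s t < \<delta>" "s > t" "s \<le> 1" using \<delta>(1) t1 unfolding s_def dist_real_def by auto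
    then have "s \<in> A" using \<delta>(2)[of s] sub t1 unfolding A_def by (auto simp: dist_commute subset_eq)
    then show False using t(2) \<open>s > t\<close> by force
  qed
  have noint: "p t \<notin> interior T" if "T \<in> \<T>" "c T = c T0" for T
  proof
    assume "p t \<in> interior T"
    then obtain \<epsilon> where "\<epsilon> > 0" "ball (p t) \<epsilon> \<subseteq> T" unfolding mem_interior by blast
    then show False using noball TU[OF that] by blast
  qed
  have tpos: "t > 0"
    using noint[OF T0 refl] x0 t1(1) unfolding p_def by (cases "t = 0") auto
  obtain T1 where T1: "T1 \<in> \<T>" "c T1 = c T0" "p t \<in> T1" using t1(3) unfolding U_def by blast
  then have "p t \<in> frontier T1"
    using noint closure_subset unfolding frontier_def by blast
  then obtain e where e: "e \<in> faces_of \<E> T1" "p t \<in> e" using frontier_cell[OF T1(1)] by blast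
  have eE: "e \<in> \<E>" using faces_ofD[OF e(1)] .
  have ri: "p t \<in> rel_interior e"
  proof (rule ccontr)
    assume "p t \<notin> rel_interior e"
    then obtain S where S: "S \<in> \<S> e" "p t \<in> S" using \<S>(3)[OF eE] e(2) by blast
    have "x0 \<in> affine hull (insert x0 S)" "p t \<in> affine hull (insert x0 S)"
      using S(2) by (auto intro: hull_inc)
    moreover have "y = (1 - 1 / t) *\<^sub>R x0 + (1 / t) *\<^sub>R p t"
      using tpos unfolding p_def by (simp add: algebra_simps)
    ultimately have "y \<in> affine hull (insert x0 S)"
      by (metis (no_types) affine_affine_hull diff_add_cancel mem_affine)
    then show False using y(2) eE S(1) unfolding N_def by blast
  qed
  have "\<not> e \<subseteq> frontier \<Omega>" using boundary_face[OF T1(1) e(1)] T1(2) c0 by auto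
  then obtain A B where AB: "A \<noteq> B" "{T\<in>\<T>. e \<in> faces_of \<E> T} = {A, B}"
    by (rule interior_face_elements[OF eE])
  then have "A \<in> \<T> \<and> e \<in> faces_of \<E> A" "B \<in> \<T> \<and> e \<in> faces_of \<E> B" by blast+
  with AB(1) obtain T2 where T2: "T2 \<in> \<T>" "T2 \<noteq> T1" "e \<in> faces_of \<E> T2"
    by (cases "A = T1") auto
  have "c T2 = c T0" using interior_face[OF eE \<open>\<not> e \<subseteq> frontier \<Omega>\<close> T2(1) T1(1) T2(2,3) e(1)] T1(2) by simp
  have "pairwise (\<lambda>T T'. interior T \<inter> interior T' = {}) \<T>"
    using polyhedral_mesh unfolding polyhedral_mesh_def by blast
  then have "interior T1 \<inter> interior T2 = {}"
    using T1(1) T2(1,2) by (simp add: pairwise_def)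
  from two_sided_neighbourhood[OF outer_normal[OF T1(1) e(1)] outer_normal[OF T2(1,3)] this ri]
  obtain \<epsilon> where "\<epsilon> > 0" "ball (p t) \<epsilon> \<subseteq> T1 \<union> T2" by blast
  then show False using noball TU[OF T1(1,2)] TU[OF T2(1) \<open>c T2 = c T0\<close>] by blast
qed

end

lemma poly_zero_gradient_constant:
  fixes T :: "(real^'n) set"
  assumes T: "polyhedral_cell (int DIM(real^'n)) T" and p: "poly_of_degree (Suc r) p"
    and zero: "\<And>x. x \<in> T \<Longrightarrow> grad p x = 0"
  shows "\<exists>c. \<forall>x\<in>T. p x = c"
proof -
  have "connected (interior T)"
    using T full_cell_rel_interior[OF T] unfolding polyhedral_cell_def by simp
  moreover have "(p has_derivative (\<lambda>h. 0)) (at x)" if "x \<in> interior T" for x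
    using poly_has_gradient[OF p, of x] zero[OF subsetD[OF interior_subset that]]
    unfolding gderiv_def by simp
  ultimately have "p x = p y" if "x \<in> interior T" "y \<in> interior T" for x y
    using has_derivative_zero_unique_connected[OF open_interior] that by blast
  then obtain c where c: "\<And>x. x \<in> interior T \<Longrightarrow> p x = c" by metis
  have "p x = c" if "x \<in> closure (interior T)" for x
    by (rule continuous_constant_on_closure[OF poly_of_degree_continuous[OF p] _ that]) (use c in auto)
  then show ?thesis
    using polyhedral_cell_closure_rel_interior[OF T] full_cell_rel_interior[OF T]
    by (intro exI[of _ c] ballI) auto
qed

section \<open>Coordinates for the discrete spaces\<close>

lemma sum_eq_single:
  assumes "finite A" "a \<in> A" "\<And>x. x \<in> A \<Longrightarrow> x \<noteq> a \<Longrightarrow> h x = (0::real)"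
  shows "sum h A = h a"
  using assms by (subst sum.remove[of A a]) (auto intro: sum.neutral)

text \<open>A discrete function is described by finitely many polynomials on the whole space: the Cartesian
  components of the interior flux and the potential of each element, the normal trace on each face
  as seen from each of its elements, and the multiplier on each face. In contrast to the extensional
  functions of the schemes these families can be added and scaled.\<close>

datatype ('s, 'i) component = Flux 's 'i | Trace 's 's | Potential 's | Multiplier 's

fun component_degree :: "nat \<Rightarrow> ('s, 'i) component \<Rightarrow> nat" where
  "component_degree k (Flux T i) = k"
| "component_degree k (Trace T e) = k"
| "component_degree k (Potential T) = Suc k"
| "component_degree k (Multiplier e) = k"

type_synonym 'n fields = "((real^'n) set, 'n) component \<Rightarrow> real^'n \<Rightarrow> real"

text \<open>All members are required to be polynomials of the right degree, also those with an index that does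
  not belong to the mesh.\<close>

definition poly_fields :: "nat \<Rightarrow> 'n::finite fields set" where
  "poly_fields k = {P. \<forall>j. poly_of_degree (component_degree k j) (P j)}"

text \<open>The polynomials with index \<open>Flux T i\<close> are the components of a vector field.\<close>

definition flux :: "'n::finite fields \<Rightarrow> (real^'n) set \<Rightarrow> real^'n \<Rightarrow> real^'n" where
  "flux P T x = (\<chi> i. P (Flux T i) x)"

lemma poly_fieldsD:
  assumes "P \<in> poly_fields k"
  shows "poly_of_degree k (P (Flux T i))" "poly_of_degree k (P (Trace T e))"
    "poly_of_degree (Suc k) (P (Potential T))" "poly_of_degree k (P (Multiplier e))"
proof -
  have "poly_of_degree (component_degree k j) (P j)" for j
    using assms unfolding poly_fields_def by blast
  from this[of "Flux T i"] this[of "Trace T e"] this[of "Potential T"] this[of "Multiplier e"]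
  show "poly_of_degree k (P (Flux T i))" "poly_of_degree k (P (Trace T e))"
    "poly_of_degree (Suc k) (P (Potential T))" "poly_of_degree k (P (Multiplier e))"
    by simp_all
qed

lemma continuous_on_fields:
  assumes "P \<in> poly_fields k"
  shows "continuous_on S (P j)"
  using assms unfolding poly_fields_def by (auto intro: poly_of_degree_continuous)

lemma continuous_on_flux:
  assumes "P \<in> poly_fields k"
  shows "continuous_on S (flux P T)"
  unfolding flux_def using continuous_on_fields[OF assms] by (intro continuous_on_vec_lambda)

lemma continuous_on_grad:
  assumes "P \<in> poly_fields k"
  shows "continuous_on S (grad (P (Potential T)))"
  by (rule poly_vec_continuous[OF poly_of_degree_grad[OF poly_fieldsD(3)[OF assms]]])

lemma poly_fields_lincomb:
  "P \<in> poly_fields k \<Longrightarrow> Q \<in> poly_fields k \<Longrightarrow> (\<lambda>j x. a * P j x + Q j x) \<in> poly_fields k"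
  unfolding poly_fields_def by (auto intro: poly_of_degree_lincomb)

lemma flux_lincomb: "flux (\<lambda>j x. a * P j x + Q j x) T x = a *\<^sub>R flux P T x + flux Q T x"
  by (simp add: flux_def vec_eq_iff)

lemma poly_fields_update:
  "P \<in> poly_fields k \<Longrightarrow> poly_of_degree (component_degree k j) p \<Longrightarrow> P(j := p) \<in> poly_fields k"
  unfolding poly_fields_def by auto

lemma poly_fields_zero: "(\<lambda>j x. 0) \<in> poly_fields k"
  unfolding poly_fields_def by (simp add: poly_of_degree_0)

text \<open>A mesh with the data of the problem. That \<open>\<Omega>\<close> is the interior of its closure makes the part of an
  element outside \<open>\<Omega>\<close> a null set.\<close>

locale wg_problem = mesh \<Omega> \<T> \<E> for \<Omega> :: "(real^'n) set" and \<T> \<E> +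
  fixes \<alpha> :: "real^'n \<Rightarrow> real^'n^'n" and f g :: "real^'n \<Rightarrow> real" and k :: nat
  assumes regular_domain: "interior (closure \<Omega>) = \<Omega>"
    and coefficient: "admissible_coefficient \<Omega> \<alpha>"
    and f_L2: "L2_on lebesgue \<Omega> f"
    and g_L2: "L2_boundary \<Omega> g"
begin

subsection \<open>Integrability\<close>

lemma AE_cell_in_domain:
  assumes "T \<in> \<T>" "AE x in lebesgue_on \<Omega>. A x"
  shows "AE x in lebesgue. x \<in> T \<longrightarrow> A x"
proof -
  have "open \<Omega>" using regular_domain open_interior by metis
  then have "AE x in lebesgue. x \<in> \<Omega> \<longrightarrow> A x"
    using assms(2) by (subst (asm) AE_restrict_space_iff) auto
  moreover have "AE x in lebesgue. x \<notin> T - \<Omega>"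
    using negligible_outside_domain[OF assms(1) regular_domain]
    by (intro AE_not_in) (simp add: negligible_iff_null_sets)
  ultimately show ?thesis by eventually_elim auto
qed

lemma cell_sets: "T \<in> \<T> \<Longrightarrow> T \<in> sets lebesgue"
  using polyhedral_cell_compact[OF cell] borel_compact by (metis sets_completionI_sets sets_lborel)

lemma coefficient_integrable:
  assumes T: "T \<in> \<T>" and v: "continuous_on T v" and w: "continuous_on T w"
  shows "set_integrable lebesgue T (\<lambda>x. (\<alpha> x *v v x) \<bullet> w x)"
proof -
  have "open \<Omega>" using regular_domain open_interior by metis
  obtain C where "AE x in lebesgue_on \<Omega>. \<forall>i j. \<bar>\<alpha> x $ i $ j\<bar> \<le> C"
    using coefficient unfolding admissible_coefficient_def by blast
  from AE_cell_in_domain[OF T this]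
  have C: "AE x in lebesgue. x \<in> T \<longrightarrow> \<bar>\<alpha> x $ i $ j\<bar> \<le> C" for i j
    by eventually_elim blast
  have "(\<lambda>x. \<alpha> x $ i $ j) \<in> borel_measurable (lebesgue_on \<Omega>)" for i j
    using coefficient unfolding admissible_coefficient_def
    by (intro borel_measurable_continuous_on[of "\<lambda>A. A $ i $ j" \<alpha>] continuous_intros) auto
  then have "set_borel_measurable lebesgue \<Omega> (\<lambda>x. \<alpha> x $ i $ j)" for i j
    using \<open>open \<Omega>\<close> unfolding set_borel_measurable_def
    by (subst borel_measurable_restrict_space_iff[symmetric]) auto
  then have m: "set_borel_measurable lebesgue T (\<lambda>x. \<alpha> x $ i $ j)" for i j
    by (rule set_borel_measurable_lebesgue_null[OF _ cell_sets[OF T]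
        negligible_outside_domain[OF T regular_domain]])
  have i: "set_integrable lebesgue T (\<lambda>x. \<alpha> x $ i $ j * (v x $ j * w x $ i))" for i j
    using v w
    by (intro set_integrable_bounded_mult[OF cell_support[OF T] m C] continuous_intros)
  have "(\<lambda>x. indicator T x *\<^sub>R ((\<alpha> x *v v x) \<bullet> w x)) =
      (\<lambda>x. \<Sum>i\<in>UNIV. \<Sum>j\<in>UNIV. indicator T x *\<^sub>R (\<alpha> x $ i $ j * (v x $ j * w x $ i)))"
    by (simp add: matrix_vector_mult_def inner_vec_def sum_distrib_left sum_distrib_right mult.assoc)
  moreover have "integrable lebesgue
      (\<lambda>x. \<Sum>i\<in>UNIV. \<Sum>j\<in>UNIV. indicator T x *\<^sub>R (\<alpha> x $ i $ j * (v x $ j * w x $ i)))"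
    using i unfolding set_integrable_def by (intro Bochner_Integration.integrable_sum)
  ultimately show ?thesis unfolding set_integrable_def by (simp only:)
qed

lemma cell_integrable_continuous:
  "T \<in> \<T> \<Longrightarrow> continuous_on T (F :: _ \<Rightarrow> real) \<Longrightarrow> set_integrable lebesgue T F"
  by (rule full_support_integrable[OF cell_support])

lemma face_integrable_continuous:
  "e \<in> \<E> \<Longrightarrow> continuous_on e (F :: _ \<Rightarrow> real) \<Longrightarrow> set_integrable (face_measure e) e F"
  by (rule full_support_integrable[OF face_support])

lemma f_integrable:
  "T \<in> \<T> \<Longrightarrow> continuous_on T F \<Longrightarrow> set_integrable lebesgue T (\<lambda>x. f x * F x)"
  by (rule set_integrable_L2_mult[OF cell_support L2_on_lebesgue_null[OF f_L2 cell_sets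
      negligible_outside_domain[OF _ regular_domain]]])

lemma g_integrable:
  assumes e: "e \<in> \<E>" "e \<subseteq> frontier \<Omega>" and F: "continuous_on e F"
  shows "set_integrable (face_measure e) e (\<lambda>x. g x * F x)"
proof (intro set_integrable_L2_mult[OF face_support[OF e(1)] _ F])
  have "aff_dim (affine hull e) = int DIM(real^'n) - 1"
    using face_cell[OF e(1)] unfolding polyhedral_cell_def by simp
  then have "L2_on (face_measure e) (frontier \<Omega>) g"
    using g_L2 affine_affine_hull[of e] unfolding L2_boundary_def face_measure_def by simp
  moreover have "e \<in> sets (face_measure e)"
    using face_support[OF e(1)] borel_compact[of e] unfolding full_support_def by auto
  ultimately show "L2_on (face_measure e) e g" using e(2) by (rule L2_on_subset)
qed

lemma cell_integral_lincomb:
  assumes "set_integrable lebesgue T F" "set_integrable lebesgue T G"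
  shows "cell_integral T (\<lambda>x. a * F x + G x) = a * cell_integral T F + cell_integral T G"
  using assms unfolding cell_integral_def by (simp add: set_integral_add)

lemma face_integral_lincomb:
  assumes "set_integrable (face_measure e) e F" "set_integrable (face_measure e) e G"
  shows "face_integral e (\<lambda>x. a * F x + G x) = a * face_integral e F + face_integral e G"
  using assms unfolding face_integral_def by (simp add: set_integral_add)

lemma face_integral_cong:
  "(\<And>x. x \<in> e \<Longrightarrow> F x = G x) \<Longrightarrow> face_integral e F = face_integral e G"
  unfolding face_integral_def set_lebesgue_integral_def
  by (intro Bochner_Integration.integral_cong) (auto simp: indicator_def)

lemma cell_integral_cong:
  "(\<And>x. x \<in> T \<Longrightarrow> F x = G x) \<Longrightarrow> cell_integral T F = cell_integral T G"
  unfolding cell_integral_def set_lebesgue_integral_def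
  by (intro Bochner_Integration.integral_cong) (auto simp: indicator_def)

text \<open>The gradient of a restricted polynomial is only determined inside the element.\<close>

lemma cell_integral_cong_interior:
  assumes T: "T \<in> \<T>" and F: "continuous_on T F" and "\<And>x. x \<in> interior T \<Longrightarrow> F x = G x"
  shows "cell_integral T F = cell_integral T G"
  unfolding cell_integral_def set_lebesgue_integral_def
proof (rule integral_cong_AE)
  show m: "(\<lambda>x. indicator T x *\<^sub>R F x) \<in> borel_measurable lebesgue"
    using full_support_set_measurable[OF cell_support[OF T] F] unfolding set_borel_measurable_def .
  have "AE x in lebesgue. x \<notin> frontier T"
    using negligible_frontier_cell[OF T] by (intro AE_not_in) (simp add: negligible_iff_null_sets)
  then show ae: "AE x in lebesgue. indicator T x *\<^sub>R F x = indicator T x *\<^sub>R G x"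
  proof eventually_elim
    case (elim x)
    then show ?case
      using assms(3)[of x] closure_subset[of T] unfolding frontier_def by (auto simp: indicator_def)
  qed
  show "(\<lambda>x. indicator T x *\<^sub>R G x) \<in> borel_measurable lebesgue"
    by (rule borel_measurable_AE[OF m ae])
qed

subsection \<open>The forms in coordinates\<close>

abbreviation \<nu> :: "(real^'n) set \<Rightarrow> (real^'n) set \<Rightarrow> real^'n" where "\<nu> T e \<equiv> outer_normal T e"

text \<open>The form \<open>a_form\<close>, including the stabilizer.\<close>

definition energy_form :: "(real^'n) set \<Rightarrow> 'n fields \<Rightarrow> 'n fields \<Rightarrow> real" where
  "energy_form T P Q = cell_integral T (\<lambda>x. (\<alpha> x *v flux P T x) \<bullet> flux Q T x) +
     diameter T * (\<Sum>e\<in>faces_of \<E> T. face_integral e (\<lambda>x.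
        (flux P T x \<bullet> \<nu> T e - P (Trace T e) x) * (flux Q T x \<bullet> \<nu> T e - Q (Trace T e) x)))"

text \<open>The weak divergence of the flux of \<open>P\<close> tested with the potential of \<open>Q\<close>.\<close>

definition div_form :: "(real^'n) set \<Rightarrow> 'n fields \<Rightarrow> 'n fields \<Rightarrow> real" where
  "div_form T P Q = - cell_integral T (\<lambda>x. flux P T x \<bullet> grad (Q (Potential T)) x) +
     (\<Sum>e\<in>faces_of \<E> T. face_integral e (\<lambda>x. P (Trace T e) x * Q (Potential T) x))"

text \<open>The normal trace of \<open>P\<close> tested with the multiplier of \<open>Q\<close>, and the two right-hand sides.\<close>

definition trace_form :: "(real^'n) set \<Rightarrow> 'n fields \<Rightarrow> 'n fields \<Rightarrow> real" where
  "trace_form T P Q = (\<Sum>e\<in>faces_of \<E> T. face_integral e (\<lambda>x. P (Trace T e) x * Q (Multiplier e) x))"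

definition load :: "(real^'n) set \<Rightarrow> 'n fields \<Rightarrow> real" where
  "load T P = cell_integral T (\<lambda>x. f x * P (Potential T) x)"

definition boundary_load :: "'n fields \<Rightarrow> real" where
  "boundary_load P = (\<Sum>T\<in>\<T>. \<Sum>e | e \<in> faces_of \<E> T \<and> e \<subseteq> frontier \<Omega>.
      face_integral e (\<lambda>x. g x * P (Trace T e) x))"

lemma sum_face_lincomb:
  assumes "\<And>e. e \<in> A \<Longrightarrow> e \<in> \<E>"
    "\<And>e. e \<in> A \<Longrightarrow> set_integrable (face_measure e) e (F e)"
    "\<And>e. e \<in> A \<Longrightarrow> set_integrable (face_measure e) e (G e)"
  shows "(\<Sum>e\<in>A. face_integral e (\<lambda>x. a * F e x + G e x)) =
     a * (\<Sum>e\<in>A. face_integral e (F e)) + (\<Sum>e\<in>A. face_integral e (G e))"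
  using assms by (simp add: face_integral_lincomb sum.distrib sum_distrib_left)

lemma energy_form_left:
  assumes T: "T \<in> \<T>" and P: "P \<in> poly_fields k" "P' \<in> poly_fields k" "Q \<in> poly_fields k"
  shows "energy_form T (\<lambda>j x. a * P j x + P' j x) Q = a * energy_form T P Q + energy_form T P' Q"
proof -
  let ?s = "\<lambda>R e x. flux R T x \<bullet> \<nu> T e - R (Trace T e) x"
  have "cell_integral T (\<lambda>x. (\<alpha> x *v flux (\<lambda>j x. a * P j x + P' j x) T x) \<bullet> flux Q T x) =
     cell_integral T (\<lambda>x. a * ((\<alpha> x *v flux P T x) \<bullet> flux Q T x) + (\<alpha> x *v flux P' T x) \<bullet> flux Q T x)"
    by (simp add: flux_lincomb matrix_vector_right_distrib inner_add_left scaleR_matrix_vector_assoc[symmetric]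
        matrix_vector_mult_scaleR)
  also have "\<dots> = a * cell_integral T (\<lambda>x. (\<alpha> x *v flux P T x) \<bullet> flux Q T x) +
       cell_integral T (\<lambda>x. (\<alpha> x *v flux P' T x) \<bullet> flux Q T x)"
    using P by (intro cell_integral_lincomb coefficient_integrable[OF T] continuous_on_flux)
  moreover have "(\<Sum>e\<in>faces_of \<E> T. face_integral e (\<lambda>x. ?s (\<lambda>j x. a * P j x + P' j x) e x * ?s Q e x)) =
     (\<Sum>e\<in>faces_of \<E> T. face_integral e (\<lambda>x. a * (?s P e x * ?s Q e x) + ?s P' e x * ?s Q e x))"
    unfolding flux_lincomb inner_add_left inner_scaleR_left by (simp add: algebra_simps)
  moreover have "\<dots> = a * (\<Sum>e\<in>faces_of \<E> T. face_integral e (\<lambda>x. ?s P e x * ?s Q e x)) +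
     (\<Sum>e\<in>faces_of \<E> T. face_integral e (\<lambda>x. ?s P' e x * ?s Q e x))"
    by (rule sum_face_lincomb)
       (use P in \<open>auto intro!: faces_ofD face_integrable_continuous continuous_intros
         P[THEN continuous_on_flux] P[THEN continuous_on_fields] P[THEN continuous_on_grad]\<close>)
  ultimately show ?thesis unfolding energy_form_def by (simp add: algebra_simps)
qed

lemma energy_form_right:
  assumes T: "T \<in> \<T>" and P: "P \<in> poly_fields k" "P' \<in> poly_fields k" "Q \<in> poly_fields k"
  shows "energy_form T Q (\<lambda>j x. a * P j x + P' j x) = a * energy_form T Q P + energy_form T Q P'"
proof -
  let ?s = "\<lambda>R e x. flux R T x \<bullet> \<nu> T e - R (Trace T e) x"
  have "cell_integral T (\<lambda>x. (\<alpha> x *v flux Q T x) \<bullet> flux (\<lambda>j x. a * P j x + P' j x) T x) =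
     cell_integral T (\<lambda>x. a * ((\<alpha> x *v flux Q T x) \<bullet> flux P T x) + (\<alpha> x *v flux Q T x) \<bullet> flux P' T x)"
    by (simp add: flux_lincomb inner_add_right)
  also have "\<dots> = a * cell_integral T (\<lambda>x. (\<alpha> x *v flux Q T x) \<bullet> flux P T x) +
       cell_integral T (\<lambda>x. (\<alpha> x *v flux Q T x) \<bullet> flux P' T x)"
    using P by (intro cell_integral_lincomb coefficient_integrable[OF T] continuous_on_flux)
  moreover have "(\<Sum>e\<in>faces_of \<E> T. face_integral e (\<lambda>x. ?s Q e x * ?s (\<lambda>j x. a * P j x + P' j x) e x)) =
     (\<Sum>e\<in>faces_of \<E> T. face_integral e (\<lambda>x. a * (?s Q e x * ?s P e x) + ?s Q e x * ?s P' e x))"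
    unfolding flux_lincomb inner_add_left inner_scaleR_left by (simp add: algebra_simps)
  moreover have "\<dots> = a * (\<Sum>e\<in>faces_of \<E> T. face_integral e (\<lambda>x. ?s Q e x * ?s P e x)) +
     (\<Sum>e\<in>faces_of \<E> T. face_integral e (\<lambda>x. ?s Q e x * ?s P' e x))"
    by (rule sum_face_lincomb)
       (use P in \<open>auto intro!: faces_ofD face_integrable_continuous continuous_intros
         P[THEN continuous_on_flux] P[THEN continuous_on_fields] P[THEN continuous_on_grad]\<close>)
  ultimately show ?thesis unfolding energy_form_def by (simp add: algebra_simps)
qed

lemma div_form_left:
  assumes T: "T \<in> \<T>" and P: "P \<in> poly_fields k" "P' \<in> poly_fields k" "Q \<in> poly_fields k"
  shows "div_form T (\<lambda>j x. a * P j x + P' j x) Q = a * div_form T P Q + div_form T P' Q"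
proof -
  have "cell_integral T (\<lambda>x. flux (\<lambda>j x. a * P j x + P' j x) T x \<bullet> grad (Q (Potential T)) x) =
     cell_integral T (\<lambda>x. a * (flux P T x \<bullet> grad (Q (Potential T)) x) + flux P' T x \<bullet> grad (Q (Potential T)) x)"
    by (simp add: flux_lincomb inner_add_left)
  also have "\<dots> = a * cell_integral T (\<lambda>x. flux P T x \<bullet> grad (Q (Potential T)) x) +
       cell_integral T (\<lambda>x. flux P' T x \<bullet> grad (Q (Potential T)) x)"
    using P by (intro cell_integral_lincomb cell_integrable_continuous[OF T] continuous_intros
         P[THEN continuous_on_flux] P[THEN continuous_on_fields] P[THEN continuous_on_grad])
  moreover have "(\<Sum>e\<in>faces_of \<E> T. face_integral e (\<lambda>x. (a * P (Trace T e) x + P' (Trace T e) x) * Q (Potential T) x)) =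
     (\<Sum>e\<in>faces_of \<E> T. face_integral e (\<lambda>x. a * (P (Trace T e) x * Q (Potential T) x) + P' (Trace T e) x * Q (Potential T) x))"
    by (simp add: algebra_simps)
  moreover have "\<dots> = a * (\<Sum>e\<in>faces_of \<E> T. face_integral e (\<lambda>x. P (Trace T e) x * Q (Potential T) x)) +
     (\<Sum>e\<in>faces_of \<E> T. face_integral e (\<lambda>x. P' (Trace T e) x * Q (Potential T) x))"
    by (rule sum_face_lincomb)
       (use P in \<open>auto intro!: faces_ofD face_integrable_continuous continuous_intros
         P[THEN continuous_on_flux] P[THEN continuous_on_fields] P[THEN continuous_on_grad]\<close>)
  ultimately show ?thesis unfolding div_form_def by (simp add: algebra_simps)
qed

lemma div_form_right:
  assumes T: "T \<in> \<T>" and P: "P \<in> poly_fields k" "P' \<in> poly_fields k" "Q \<in> poly_fields k"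
  shows "div_form T Q (\<lambda>j x. a * P j x + P' j x) = a * div_form T Q P + div_form T Q P'"
proof -
  have "cell_integral T (\<lambda>x. flux Q T x \<bullet> grad (\<lambda>x. a * P (Potential T) x + P' (Potential T) x) x) =
     cell_integral T (\<lambda>x. a * (flux Q T x \<bullet> grad (P (Potential T)) x) + flux Q T x \<bullet> grad (P' (Potential T)) x)"
    using P by (simp add: grad_lincomb[OF poly_fieldsD(3) poly_fieldsD(3)] inner_add_right)
  also have "\<dots> = a * cell_integral T (\<lambda>x. flux Q T x \<bullet> grad (P (Potential T)) x) +
       cell_integral T (\<lambda>x. flux Q T x \<bullet> grad (P' (Potential T)) x)"
    using P by (intro cell_integral_lincomb cell_integrable_continuous[OF T] continuous_intros
         P[THEN continuous_on_flux] P[THEN continuous_on_fields] P[THEN continuous_on_grad])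
  moreover have "(\<Sum>e\<in>faces_of \<E> T. face_integral e (\<lambda>x. Q (Trace T e) x * (a * P (Potential T) x + P' (Potential T) x))) =
     (\<Sum>e\<in>faces_of \<E> T. face_integral e (\<lambda>x. a * (Q (Trace T e) x * P (Potential T) x) + Q (Trace T e) x * P' (Potential T) x))"
    by (simp add: algebra_simps)
  moreover have "\<dots> = a * (\<Sum>e\<in>faces_of \<E> T. face_integral e (\<lambda>x. Q (Trace T e) x * P (Potential T) x)) +
     (\<Sum>e\<in>faces_of \<E> T. face_integral e (\<lambda>x. Q (Trace T e) x * P' (Potential T) x))"
    by (rule sum_face_lincomb)
       (use P in \<open>auto intro!: faces_ofD face_integrable_continuous continuous_intros
         P[THEN continuous_on_flux] P[THEN continuous_on_fields] P[THEN continuous_on_grad]\<close>)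
  ultimately show ?thesis unfolding div_form_def by (simp add: algebra_simps)
qed

lemma trace_form_left:
  assumes P: "P \<in> poly_fields k" "P' \<in> poly_fields k" "Q \<in> poly_fields k"
  shows "trace_form T (\<lambda>j x. a * P j x + P' j x) Q = a * trace_form T P Q + trace_form T P' Q"
  unfolding trace_form_def
  by (subst sum_face_lincomb[symmetric])
     (use P in \<open>auto intro!: faces_ofD face_integrable_continuous continuous_intros
         P[THEN continuous_on_flux] P[THEN continuous_on_fields] P[THEN continuous_on_grad] simp: algebra_simps\<close>)

lemma trace_form_right:
  assumes P: "P \<in> poly_fields k" "P' \<in> poly_fields k" "Q \<in> poly_fields k"
  shows "trace_form T Q (\<lambda>j x. a * P j x + P' j x) = a * trace_form T Q P + trace_form T Q P'"
  unfolding trace_form_def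
  by (subst sum_face_lincomb[symmetric])
     (use P in \<open>auto intro!: faces_ofD face_integrable_continuous continuous_intros
         P[THEN continuous_on_flux] P[THEN continuous_on_fields] P[THEN continuous_on_grad] simp: algebra_simps\<close>)

lemma load_lincomb:
  assumes T: "T \<in> \<T>" and P: "P \<in> poly_fields k" "P' \<in> poly_fields k"
  shows "load T (\<lambda>j x. a * P j x + P' j x) = a * load T P + load T P'"
  unfolding load_def
  by (subst cell_integral_lincomb[symmetric])
     (use P in \<open>auto intro!: f_integrable[OF T] continuous_intros
         P[THEN continuous_on_flux] P[THEN continuous_on_fields] P[THEN continuous_on_grad] simp: algebra_simps\<close>)

lemma boundary_load_lincomb:
  assumes P: "P \<in> poly_fields k" "P' \<in> poly_fields k"
  shows "boundary_load (\<lambda>j x. a * P j x + P' j x) = a * boundary_load P + boundary_load P'"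
proof -
  have "(\<Sum>e | e \<in> faces_of \<E> T \<and> e \<subseteq> frontier \<Omega>. face_integral e (\<lambda>x. g x * (a * P (Trace T e) x + P' (Trace T e) x))) =
     a * (\<Sum>e | e \<in> faces_of \<E> T \<and> e \<subseteq> frontier \<Omega>. face_integral e (\<lambda>x. g x * P (Trace T e) x)) +
     (\<Sum>e | e \<in> faces_of \<E> T \<and> e \<subseteq> frontier \<Omega>. face_integral e (\<lambda>x. g x * P' (Trace T e) x))" for T
    by (subst sum_face_lincomb[symmetric])
       (use P in \<open>auto intro!: faces_ofD g_integrable continuous_intros
         P[THEN continuous_on_flux] P[THEN continuous_on_fields] P[THEN continuous_on_grad] simp: algebra_simps\<close>)
  then show ?thesis unfolding boundary_load_def by (simp add: sum.distrib sum_distrib_left)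
qed

subsection \<open>From coordinates to discrete functions\<close>

text \<open>The extensional functions of the schemes that belong to a family of polynomials.\<close>

definition local_flux :: "(real^'n) set \<Rightarrow> 'n fields \<Rightarrow> 'n weak_fun" where
  "local_flux T P = (restrict (flux P T) T, \<lambda>e\<in>faces_of \<E> T. \<lambda>x\<in>e. P (Trace T e) x *\<^sub>R \<nu> T e)"

definition broken_flux :: "'n fields \<Rightarrow> (real^'n) set \<Rightarrow> 'n weak_fun" where
  "broken_flux P = (\<lambda>T\<in>\<T>. local_flux T P)"

definition potential :: "'n fields \<Rightarrow> (real^'n) set \<Rightarrow> real^'n \<Rightarrow> real" where
  "potential P = (\<lambda>T\<in>\<T>. restrict (P (Potential T)) T)"

definition multiplier :: "'n fields \<Rightarrow> (real^'n) set \<Rightarrow> real^'n \<Rightarrow> real" where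
  "multiplier P = (\<lambda>e\<in>\<E>. restrict (P (Multiplier e)) e)"

lemma broken_flux_apply: "T \<in> \<T> \<Longrightarrow> broken_flux P T = local_flux T P"
  unfolding broken_flux_def by simp

lemma restrict_in_P_space: "poly_of_degree r p \<Longrightarrow> restrict p D \<in> P_space r D"
  unfolding P_space_def by blast

lemma P_spaceE:
  assumes "p \<in> P_space r D"
  obtains q where "poly_of_degree r q" "p = restrict q D"
  using assms unfolding P_space_def by blast

lemma local_flux_in_V:
  assumes "P \<in> poly_fields k"
  shows "local_flux T P \<in> V_local k \<E> T"
  unfolding V_local_def local_flux_def
proof (intro SigmaI PiE_I)
  have "(\<lambda>x\<in>T. restrict (flux P T) T x $ i) = restrict (P (Flux T i)) T" for i
    by (auto simp: flux_def)
  then show "restrict (flux P T) T \<in> P_vec k T"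
    unfolding P_vec_def using restrict_in_P_space[OF poly_fieldsD(1)[OF assms]] by auto
  fix e assume e: "e \<in> faces_of \<E> T"
  have "(\<lambda>x\<in>e. P (Trace T e) x *\<^sub>R \<nu> T e) = (\<lambda>x\<in>e. restrict (P (Trace T e)) e x *\<^sub>R \<nu> T e)"
    by auto
  then show "(\<lambda>e\<in>faces_of \<E> T. \<lambda>x\<in>e. P (Trace T e) x *\<^sub>R \<nu> T e) e
      \<in> {\<lambda>x\<in>e. vb x *\<^sub>R \<nu> T e |vb. vb \<in> P_space k e}"
    using restrict_in_P_space[OF poly_fieldsD(2)[OF assms], of T e e]
    unfolding restrict_apply'[OF e] by blast
qed auto

text \<open>Conversely, all discrete functions arise in this way.\<close>

lemma local_fluxE:
  assumes "v \<in> V_local k \<E> T"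
  obtains p r where "\<And>i. poly_of_degree k (p i)" "\<And>e. poly_of_degree k (r e)"
    "v = (restrict (\<lambda>x. \<chi> i. p i x) T, \<lambda>e\<in>faces_of \<E> T. \<lambda>x\<in>e. r e x *\<^sub>R \<nu> T e)"
proof -
  obtain v0 vb where v: "v = (v0, vb)" "v0 \<in> P_vec k T"
    "vb \<in> (\<Pi>\<^sub>E e\<in>faces_of \<E> T. {\<lambda>x\<in>e. vb x *\<^sub>R \<nu> T e | vb. vb \<in> P_space k e})"
    using assms unfolding V_local_def by auto
  have "\<forall>i. \<exists>p. poly_of_degree k p \<and> (\<lambda>x\<in>T. v0 x $ i) = restrict p T"
    using v(2) unfolding P_vec_def P_space_def by blast
  then obtain p where p: "\<And>i. poly_of_degree k (p i)" "\<And>i. (\<lambda>x\<in>T. v0 x $ i) = restrict (p i) T"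
    by metis
  have "v0 x = restrict (\<lambda>x. \<chi> i. p i x) T x" for x
  proof (cases "x \<in> T")
    case True
    then have "v0 x $ i = p i x" for i using fun_cong[OF p(2)[of i], of x] by simp
    then show ?thesis using True by (simp add: vec_eq_iff)
  next
    case False
    then show ?thesis using v(2) unfolding P_vec_def by (auto simp: extensional_def)
  qed
  then have v0: "v0 = restrict (\<lambda>x. \<chi> i. p i x) T" by blast
  have "\<exists>r. poly_of_degree k r \<and> (e \<in> faces_of \<E> T \<longrightarrow> vb e = (\<lambda>x\<in>e. r x *\<^sub>R \<nu> T e))" for e
  proof (cases "e \<in> faces_of \<E> T")
    case True
    then obtain vb' where "vb' \<in> P_space k e" "vb e = (\<lambda>x\<in>e. vb' x *\<^sub>R \<nu> T e)"
      using PiE_mem[OF v(3) True] by blast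
    then obtain r where "poly_of_degree k r" "vb e = (\<lambda>x\<in>e. restrict r e x *\<^sub>R \<nu> T e)"
      by (auto elim: P_spaceE)
    then show ?thesis by (intro exI[of _ r]) auto
  qed (use poly_of_degree_0 in blast)
  then obtain r where r: "\<And>e. poly_of_degree k (r e)"
    "\<And>e. e \<in> faces_of \<E> T \<Longrightarrow> vb e = (\<lambda>x\<in>e. r e x *\<^sub>R \<nu> T e)"
    by metis
  have "vb e = (\<lambda>e\<in>faces_of \<E> T. \<lambda>x\<in>e. r e x *\<^sub>R \<nu> T e) e" for e
    using r(2) PiE_arb[OF v(3)] by simp
  then have "vb = (\<lambda>e\<in>faces_of \<E> T. \<lambda>x\<in>e. r e x *\<^sub>R \<nu> T e)" by blast
  then show ?thesis using that p(1) r(1) v(1) v0 by blast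
qed

lemma local_flux_surj:
  assumes "v \<in> V_local k \<E> T"
  obtains P where "P \<in> poly_fields k" "v = local_flux T P"
proof -
  obtain p r where pr: "\<And>i. poly_of_degree k (p i)" "\<And>e. poly_of_degree k (r e)"
    "v = (restrict (\<lambda>x. \<chi> i. p i x) T, \<lambda>e\<in>faces_of \<E> T. \<lambda>x\<in>e. r e x *\<^sub>R \<nu> T e)"
    using local_fluxE[OF assms] by blast
  define P :: "'n fields" where
    "P = (\<lambda>j. case j of Flux T i \<Rightarrow> p i | Trace T e \<Rightarrow> r e | _ \<Rightarrow> (\<lambda>x. 0))"
  have "P \<in> poly_fields k"
    unfolding poly_fields_def P_def using pr(1,2)
    by (auto split: component.split intro: poly_of_degree_0)
  moreover have "v = local_flux T P"
    unfolding pr(3) local_flux_def flux_def P_def by simp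
  ultimately show ?thesis using that by blast
qed

lemma fields_surj:
  assumes "q \<in> V_broken k \<T> \<E>" "u \<in> W_space k \<T>" "l \<in> Lambda_space k \<E>"
  obtains P where "P \<in> poly_fields k" "q = broken_flux P" "u = potential P" "l = multiplier P"
proof -
  have "\<exists>P. P \<in> poly_fields k \<and> (T \<in> \<T> \<longrightarrow> q T = local_flux T P)" for T
  proof (cases "T \<in> \<T>")
    case True
    then have "q T \<in> V_local k \<E> T" using assms(1) unfolding V_broken_def by blast
    then show ?thesis by (elim local_flux_surj) auto
  qed (use poly_fields_zero in blast)
  then obtain R where R: "\<And>T. R T \<in> poly_fields k" "\<And>T. T \<in> \<T> \<Longrightarrow> q T = local_flux T (R T)"
    by metis
  have "\<exists>p. poly_of_degree (Suc k) p \<and> (T \<in> \<T> \<longrightarrow> u T = restrict p T)" for T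
  proof (cases "T \<in> \<T>")
    case True
    then have "u T \<in> P_space (Suc k) T" using assms(2) unfolding W_space_def by auto
    then show ?thesis by (elim P_spaceE) auto
  qed (use poly_of_degree_0 in blast)
  then obtain p where p: "\<And>T. poly_of_degree (Suc k) (p T)" "\<And>T. T \<in> \<T> \<Longrightarrow> u T = restrict (p T) T"
    by metis
  have "\<exists>m. poly_of_degree k m \<and> (e \<in> \<E> \<longrightarrow> l e = restrict m e)" for e
  proof (cases "e \<in> \<E>")
    case True
    then have "l e \<in> P_space k e" using assms(3) unfolding Lambda_space_def by auto
    then show ?thesis by (elim P_spaceE) auto
  qed (use poly_of_degree_0 in blast)
  then obtain m where m: "\<And>e. poly_of_degree k (m e)" "\<And>e. e \<in> \<E> \<Longrightarrow> l e = restrict (m e) e"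
    by metis
  define P :: "'n fields" where "P = (\<lambda>j. case j of Flux T i \<Rightarrow> R T (Flux T i)
     | Trace T e \<Rightarrow> R T (Trace T e) | Potential T \<Rightarrow> p T | Multiplier e \<Rightarrow> m e)"
  have "P \<in> poly_fields k"
    unfolding poly_fields_def P_def using p(1) m(1) poly_fieldsD[OF R(1)]
    by (auto split: component.split)
  moreover have "q = broken_flux P"
  proof
    fix T show "q T = broken_flux P T"
    proof (cases "T \<in> \<T>")
      case True
      have "local_flux T (R T) = local_flux T P"
        unfolding local_flux_def flux_def P_def by simp
      then show ?thesis using R(2)[OF True] broken_flux_apply[OF True] by simp
    next
      case False
      then show ?thesis
        using PiE_arb[OF assms(1)[unfolded V_broken_def]] by (simp add: broken_flux_def)
    qed
  qed
  moreover have "u = potential P"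
  proof
    fix T show "u T = potential P T"
      using p(2)[of T] PiE_arb[OF assms(2)[unfolded W_space_def], of T]
      by (simp add: potential_def P_def)
  qed
  moreover have "l = multiplier P"
  proof
    fix e show "l e = multiplier P e"
      using m(2)[of e] PiE_arb[OF assms(3)[unfolded Lambda_space_def], of e]
      by (simp add: multiplier_def P_def)
  qed
  ultimately show ?thesis using that by blast
qed

lemma broken_flux_in_V: "P \<in> poly_fields k \<Longrightarrow> broken_flux P \<in> V_broken k \<T> \<E>"
  unfolding broken_flux_def V_broken_def using local_flux_in_V by auto

lemma potential_in_W: "P \<in> poly_fields k \<Longrightarrow> potential P \<in> W_space k \<T>"
  unfolding potential_def W_space_def using restrict_in_P_space[OF poly_fieldsD(3)] by auto

lemma multiplier_in_Lambda: "P \<in> poly_fields k \<Longrightarrow> multiplier P \<in> Lambda_space k \<E>"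
  unfolding multiplier_def Lambda_space_def using restrict_in_P_space[OF poly_fieldsD(4)] by auto

lemma Lambda_zero: "(\<lambda>e\<in>\<E>. \<lambda>x\<in>e. 0) \<in> Lambda_space k \<E>"
  unfolding Lambda_space_def using restrict_in_P_space[OF poly_of_degree_0] by auto

lemma W_zero: "(\<lambda>T\<in>\<T>. \<lambda>x\<in>T. 0) \<in> W_space k \<T>"
  unfolding W_space_def using restrict_in_P_space[OF poly_of_degree_0] by auto

lemma V_zero: "broken_flux (\<lambda>j x. 0) \<in> V_broken k \<T> \<E>"
  by (rule broken_flux_in_V[OF poly_fields_zero])

lemma broken_flux_eqI:
  assumes "\<And>T i x. T \<in> \<T> \<Longrightarrow> x \<in> T \<Longrightarrow> P (Flux T i) x = Q (Flux T i) x"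
    "\<And>T e x. T \<in> \<T> \<Longrightarrow> e \<in> faces_of \<E> T \<Longrightarrow> x \<in> e \<Longrightarrow> P (Trace T e) x = Q (Trace T e) x"
  shows "broken_flux P = broken_flux Q"
proof -
  have "local_flux T P = local_flux T Q" if T: "T \<in> \<T>" for T
  proof -
    have "restrict (flux P T) T = restrict (flux Q T) T"
      using assms(1)[OF T] by (intro restrict_ext) (simp add: flux_def vec_eq_iff)
    moreover have "(\<lambda>e\<in>faces_of \<E> T. \<lambda>x\<in>e. P (Trace T e) x *\<^sub>R \<nu> T e) =
        (\<lambda>e\<in>faces_of \<E> T. \<lambda>x\<in>e. Q (Trace T e) x *\<^sub>R \<nu> T e)"
      using assms(2)[OF T] by (intro restrict_ext) simp
    ultimately show ?thesis unfolding local_flux_def by simp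
  qed
  then show ?thesis unfolding broken_flux_def by (intro restrict_ext)
qed

subsection \<open>The forms of the schemes in coordinates\<close>

lemma normal_trace_local_flux:
  assumes "T \<in> \<T>" "e \<in> faces_of \<E> T" "x \<in> e"
  shows "normal_trace (local_flux T P) T e x = P (Trace T e) x"
  using assms outer_normal_unit unfolding normal_trace_def local_flux_def by simp

lemma a_form_local_flux:
  assumes T: "T \<in> \<T>"
  shows "a_form \<alpha> \<E> T (local_flux T P) (local_flux T Q) = energy_form T P Q"
proof -
  have "face_integral e (\<lambda>x. ((fst (local_flux T P) x - snd (local_flux T P) e x) \<bullet> \<nu> T e) *
       ((fst (local_flux T Q) x - snd (local_flux T Q) e x) \<bullet> \<nu> T e)) =
     face_integral e (\<lambda>x. (flux P T x \<bullet> \<nu> T e - P (Trace T e) x) * (flux Q T x \<bullet> \<nu> T e - Q (Trace T e) x))"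
    if e: "e \<in> faces_of \<E> T" for e
  proof (rule face_integral_cong)
    fix x assume "x \<in> e"
    moreover from this have "x \<in> T" using face_subset[OF T e] by blast
    ultimately show "((fst (local_flux T P) x - snd (local_flux T P) e x) \<bullet> \<nu> T e) *
       ((fst (local_flux T Q) x - snd (local_flux T Q) e x) \<bullet> \<nu> T e) =
       (flux P T x \<bullet> \<nu> T e - P (Trace T e) x) * (flux Q T x \<bullet> \<nu> T e - Q (Trace T e) x)"
      using e outer_normal_unit[OF T e] by (simp add: local_flux_def inner_diff_left)
  qed
  moreover have "cell_integral T (\<lambda>x. (\<alpha> x *v fst (local_flux T P) x) \<bullet> fst (local_flux T Q) x) =
     cell_integral T (\<lambda>x. (\<alpha> x *v flux P T x) \<bullet> flux Q T x)"
    by (rule cell_integral_cong) (simp add: local_flux_def)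
  ultimately show ?thesis
    unfolding a_form_def s_form_def energy_form_def boundary_integral_def by simp
qed

text \<open>The defining equation of the weak divergence.\<close>

lemma div_local_flux:
  assumes T: "T \<in> \<T>" and P: "P \<in> poly_fields k" and Q: "Q \<in> poly_fields k"
  shows "cell_integral T (\<lambda>x. weak_div k \<E> T (local_flux T P) x * restrict (Q (Potential T)) T x) =
    div_form T P Q"
proof -
  define L where "L \<phi> = - cell_integral T (\<lambda>x. fst (local_flux T P) x \<bullet> grad \<phi> x) +
     boundary_integral \<E> T (\<lambda>e x. normal_trace (local_flux T P) T e x * \<phi> x)" for \<phi>
  define D where "D p = - cell_integral T (\<lambda>x. flux P T x \<bullet> grad p x) +
     (\<Sum>e\<in>faces_of \<E> T. face_integral e (\<lambda>x. P (Trace T e) x * p x))" for p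
  have LD: "L \<phi> = D p" if p: "poly_of_degree (Suc k) p" and eq: "\<And>x. x \<in> T \<Longrightarrow> p x = \<phi> x" for p \<phi>
  proof -
    have "cell_integral T (\<lambda>x. flux P T x \<bullet> grad p x) = cell_integral T (\<lambda>x. fst (local_flux T P) x \<bullet> grad \<phi> x)"
    proof (rule cell_integral_cong_interior[OF T])
      show "continuous_on T (\<lambda>x. flux P T x \<bullet> grad p x)"
        by (intro continuous_intros continuous_on_flux[OF P]
            poly_vec_continuous[OF poly_of_degree_grad[OF p]])
      fix x assume x: "x \<in> interior T"
      have "GDERIV \<phi> x :> grad p x"
        using has_derivative_transform_within_open[OF
            poly_has_gradient[OF p, unfolded gderiv_def] open_interior x] eq interior_subset
        unfolding gderiv_def by blast
      then have "grad \<phi> x = grad p x" by (rule grad_eqI)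
      moreover have "x \<in> T" using x interior_subset by blast
      ultimately show "flux P T x \<bullet> grad p x = fst (local_flux T P) x \<bullet> grad \<phi> x"
        by (simp add: local_flux_def)
    qed
    moreover have "(\<Sum>e\<in>faces_of \<E> T. face_integral e (\<lambda>x. P (Trace T e) x * p x)) =
       boundary_integral \<E> T (\<lambda>e x. normal_trace (local_flux T P) T e x * \<phi> x)"
      unfolding boundary_integral_def
      by (intro sum.cong refl face_integral_cong)
         (use face_subset[OF T] eq normal_trace_local_flux[OF T] in auto)
    ultimately show ?thesis unfolding L_def D_def by simp
  qed
  have "\<exists>!p. p \<in> P_space (Suc k) T \<and> (\<forall>\<phi>\<in>P_space (Suc k) T. (LINT x:T|lebesgue. p x * \<phi> x) = L \<phi>)"
  proof (rule poly_riesz[OF cell_support[OF T]])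
    fix a and p q :: "real^'n \<Rightarrow> real"
    assume p: "poly_of_degree (Suc k) p" and q: "poly_of_degree (Suc k) q"
    let ?R = "P(Potential T := p)" and ?S = "P(Potential T := q)"
    have R: "?R \<in> poly_fields k" "?S \<in> poly_fields k"
      using P p q by (auto intro!: poly_fields_update)
    have D: "D p' = div_form T P (P(Potential T := p'))" for p'
      unfolding D_def div_form_def by simp
    have "div_form T P (P(Potential T := (\<lambda>x. a * p x + q x))) = div_form T P (\<lambda>j x. a * ?R j x + ?S j x)"
      unfolding div_form_def by simp
    also have "\<dots> = a * div_form T P ?R + div_form T P ?S"
      by (rule div_form_right[OF T R P])
    finally have "D (\<lambda>x. a * p x + q x) = a * D p + D q" unfolding D .
    then show "L (\<lambda>x. a * p x + q x) = a * L p + L q"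
      using LD[OF p refl] LD[OF q refl] LD[OF poly_of_degree_lincomb[OF p q] refl] by simp
  next
    fix p q assume p: "poly_of_degree (Suc k) p" and eq: "\<And>x. x \<in> T \<Longrightarrow> p x = q x"
    show "L p = L q" using LD[OF p refl] LD[OF p eq] by simp
  qed
  from theI'[OF this] have "\<forall>\<phi>\<in>P_space (Suc k) T.
      cell_integral T (\<lambda>x. weak_div k \<E> T (local_flux T P) x * \<phi> x) = L \<phi>"
    unfolding weak_div_def L_def cell_integral_def by simp
  then have "cell_integral T (\<lambda>x. weak_div k \<E> T (local_flux T P) x * restrict (Q (Potential T)) T x) =
      L (restrict (Q (Potential T)) T)"
    using restrict_in_P_space[OF poly_fieldsD(3)[OF Q]] by blast
  also have "\<dots> = D (Q (Potential T))"
    by (rule LD[OF poly_fieldsD(3)[OF Q]]) simp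
  also have "\<dots> = div_form T P Q" unfolding D_def div_form_def ..
  finally show ?thesis .
qed

lemma b_form_local_flux:
  "T \<in> \<T> \<Longrightarrow> P \<in> poly_fields k \<Longrightarrow> Q \<in> poly_fields k \<Longrightarrow>
     b_form k \<E> T (local_flux T P) (potential Q T) = div_form T P Q"
  unfolding b_form_def potential_def using div_local_flux by simp

lemma trace_form_local_flux:
  assumes "T \<in> \<T>"
  shows "boundary_integral \<E> T (\<lambda>e x. normal_trace (local_flux T P) T e x * multiplier Q e x) = trace_form T P Q"
    and "boundary_integral \<E> T (\<lambda>e x. multiplier Q e x * normal_trace (local_flux T P) T e x) = trace_form T P Q"
  unfolding trace_form_def boundary_integral_def multiplier_def
  by (intro sum.cong refl face_integral_cong;
      use assms faces_ofD in \<open>simp add: normal_trace_local_flux\<close>)+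

lemma load_potential:
  "T \<in> \<T> \<Longrightarrow> cell_integral T (\<lambda>x. f x * potential P T x) = load T P"
  unfolding load_def by (rule cell_integral_cong) (simp add: potential_def)

lemma boundary_load_broken_flux:
  "(\<Sum>T\<in>\<T>. \<Sum>e | e \<in> faces_of \<E> T \<and> e \<subseteq> frontier \<Omega>.
      face_integral e (\<lambda>x. g x * normal_trace (broken_flux P T) T e x)) = boundary_load P"
  unfolding boundary_load_def
  by (intro sum.cong refl face_integral_cong) (simp add: broken_flux_apply normal_trace_local_flux)

lemma Q_b_projection:
  assumes e: "e \<in> \<E>" "e \<subseteq> frontier \<Omega>"
  shows "Q_b k g e \<in> P_space k e"
    and "\<phi> \<in> P_space k e \<Longrightarrow> face_integral e (\<lambda>x. Q_b k g e x * \<phi> x) = face_integral e (\<lambda>x. g x * \<phi> x)"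
proof -
  have "\<exists>!p. p \<in> P_space k e \<and>
     (\<forall>\<phi>\<in>P_space k e. (LINT x:e|face_measure e. p x * \<phi> x) = face_integral e (\<lambda>x. g x * \<phi> x))"
  proof (rule poly_riesz[OF face_support[OF e(1)]])
    fix a and p q :: "real^'n \<Rightarrow> real"
    assume p: "poly_of_degree k p" "poly_of_degree k q"
    have "face_integral e (\<lambda>x. a * (g x * p x) + g x * q x) =
       a * face_integral e (\<lambda>x. g x * p x) + face_integral e (\<lambda>x. g x * q x)"
      using p by (intro face_integral_lincomb g_integrable[OF e] poly_of_degree_continuous)
    then show "face_integral e (\<lambda>x. g x * (a * p x + q x)) =
       a * face_integral e (\<lambda>x. g x * p x) + face_integral e (\<lambda>x. g x * q x)"
      by (simp add: algebra_simps)
  next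
    fix p q :: "real^'n \<Rightarrow> real" assume "\<And>x. x \<in> e \<Longrightarrow> p x = q x"
    then show "face_integral e (\<lambda>x. g x * p x) = face_integral e (\<lambda>x. g x * q x)"
      by (intro face_integral_cong) simp
  qed
  from theI'[OF this]
  show "Q_b k g e \<in> P_space k e"
    "\<phi> \<in> P_space k e \<Longrightarrow> face_integral e (\<lambda>x. Q_b k g e x * \<phi> x) = face_integral e (\<lambda>x. g x * \<phi> x)"
    unfolding Q_b_def face_integral_def by blast+
qed

subsection \<open>The schemes in coordinates\<close>

text \<open>The jump of the flux is zero on every interior face.\<close>

definition continuous_trace :: "'n fields \<Rightarrow> bool" where
  "continuous_trace P \<longleftrightarrow> (\<forall>e\<in>\<E>. \<not> e \<subseteq> frontier \<Omega> \<longrightarrow>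
     (\<forall>T1\<in>\<T>. \<forall>T2\<in>\<T>. T1 \<noteq> T2 \<and> e \<in> faces_of \<E> T1 \<and> e \<in> faces_of \<E> T2 \<longrightarrow>
        (\<forall>x\<in>e. P (Trace T1 e) x + P (Trace T2 e) x = 0)))"

text \<open>The multipliers of \<open>P\<close> belong to \<open>Lambda0_space\<close>.\<close>

definition boundary_multiplier_zero :: "'n fields \<Rightarrow> bool" where
  "boundary_multiplier_zero P \<longleftrightarrow> (\<forall>e\<in>\<E>. e \<subseteq> frontier \<Omega> \<longrightarrow> (\<forall>x\<in>e. P (Multiplier e) x = 0))"

text \<open>The two schemes for families of polynomials.\<close>

definition hybrid_fields :: "'n fields \<Rightarrow> bool" where
  "hybrid_fields P \<longleftrightarrow>
     (\<forall>e\<in>\<E>. e \<subseteq> frontier \<Omega> \<longrightarrow> restrict (P (Multiplier e)) e = Q_b k g e) \<and>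
     (\<forall>T\<in>\<T>. \<forall>V\<in>poly_fields k. energy_form T P V - div_form T V P = - trace_form T V P) \<and>
     (\<forall>T\<in>\<T>. \<forall>W\<in>poly_fields k. div_form T P W = load T W) \<and>
     (\<forall>\<Phi>\<in>poly_fields k. boundary_multiplier_zero \<Phi> \<longrightarrow> (\<Sum>T\<in>\<T>. trace_form T P \<Phi>) = 0)"

definition wg_fields :: "'n fields \<Rightarrow> bool" where
  "wg_fields P \<longleftrightarrow> continuous_trace P \<and>
     (\<forall>V\<in>poly_fields k. continuous_trace V \<longrightarrow>
        (\<Sum>T\<in>\<T>. energy_form T P V) - (\<Sum>T\<in>\<T>. div_form T V P) = - boundary_load V) \<and>
     (\<forall>W\<in>poly_fields k. (\<Sum>T\<in>\<T>. div_form T P W) = (\<Sum>T\<in>\<T>. load T W))"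

lemma broken_flux_in_V_space:
  assumes "P \<in> poly_fields k"
  shows "broken_flux P \<in> V_space \<Omega> k \<T> \<E> \<longleftrightarrow> continuous_trace P"
  unfolding V_space_def continuous_trace_def
  using broken_flux_in_V[OF assms] by (auto simp: broken_flux_apply normal_trace_local_flux)

lemma V_space_surj:
  assumes "v \<in> V_space \<Omega> k \<T> \<E>"
  obtains V where "V \<in> poly_fields k" "v = broken_flux V" "continuous_trace V"
proof -
  have "v \<in> V_broken k \<T> \<E>" using assms unfolding V_space_def by blast
  then obtain V where V: "V \<in> poly_fields k" "v = broken_flux V"
    by (rule fields_surj[OF _ W_zero Lambda_zero])
  then have "continuous_trace V" using assms broken_flux_in_V_space by simp
  with V show ?thesis by (rule that)
qed

lemma W_space_surj:
  assumes "w \<in> W_space k \<T>"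
  obtains W where "W \<in> poly_fields k" "w = potential W"
  by (rule fields_surj[OF V_zero assms Lambda_zero]) (rule that)

lemma wg_solutions_iff:
  assumes P: "P \<in> poly_fields k"
  shows "(broken_flux P, potential P) \<in> wg_solutions \<Omega> \<T> \<E> k \<alpha> f g \<longleftrightarrow> wg_fields P"
proof -
  have 1: "(\<Sum>T\<in>\<T>. a_form \<alpha> \<E> T (broken_flux P T) (broken_flux V T)) = (\<Sum>T\<in>\<T>. energy_form T P V)" for V
    by (intro sum.cong refl) (simp add: broken_flux_apply a_form_local_flux)
  have 2: "(\<Sum>T\<in>\<T>. b_form k \<E> T (broken_flux V T) (potential W T)) = (\<Sum>T\<in>\<T>. div_form T V W)"
    if "V \<in> poly_fields k" "W \<in> poly_fields k" for V W
    using that by (intro sum.cong refl) (simp add: broken_flux_apply b_form_local_flux)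
  have 3: "(\<Sum>T\<in>\<T>. cell_integral T (\<lambda>x. f x * potential W T x)) = (\<Sum>T\<in>\<T>. load T W)" for W
    by (intro sum.cong refl) (simp add: load_potential)
  have V: "(\<forall>v\<in>V_space \<Omega> k \<T> \<E>. A v) \<longleftrightarrow> (\<forall>V\<in>poly_fields k. continuous_trace V \<longrightarrow> A (broken_flux V))" for A
    using V_space_surj broken_flux_in_V_space by metis
  have W: "(\<forall>w\<in>W_space k \<T>. A w) \<longleftrightarrow> (\<forall>W\<in>poly_fields k. A (potential W))" for A
    using W_space_surj potential_in_W by metis
  show ?thesis
    unfolding wg_solutions_def wg_fields_def
    using P potential_in_W[OF P]
    by (simp add: V W 1 2 3 boundary_load_broken_flux broken_flux_in_V_space cong: ball_cong)
qed

lemma hybrid_solutions_iff: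
  assumes P: "P \<in> poly_fields k"
  shows "(broken_flux P, potential P, multiplier P) \<in> hybrid_solutions \<Omega> \<T> \<E> k \<alpha> f g \<longleftrightarrow> hybrid_fields P"
proof -
  have 0: "(\<forall>e\<in>\<E>. e \<subseteq> frontier \<Omega> \<longrightarrow> multiplier P e = Q_b k g e) \<longleftrightarrow>
     (\<forall>e\<in>\<E>. e \<subseteq> frontier \<Omega> \<longrightarrow> restrict (P (Multiplier e)) e = Q_b k g e)"
    by (auto simp: multiplier_def)
  have 1: "(\<forall>v\<in>V_local k \<E> T.
           s_form \<E> T (broken_flux P T) v + cell_integral T (\<lambda>x. (\<alpha> x *v fst (broken_flux P T) x) \<bullet> fst v x)
             - cell_integral T (\<lambda>x. weak_div k \<E> T v x * potential P T x) =
           - boundary_integral \<E> T (\<lambda>e x. multiplier P e x * normal_trace v T e x)) \<longleftrightarrow>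
      (\<forall>V\<in>poly_fields k. energy_form T P V - div_form T V P = - trace_form T V P)" if T: "T \<in> \<T>" for T
  proof -
    have V: "(\<forall>v\<in>V_local k \<E> T. A v) \<longleftrightarrow> (\<forall>V\<in>poly_fields k. A (local_flux T V))" for A
      using local_flux_surj local_flux_in_V by metis
    have a: "s_form \<E> T (broken_flux P T) (local_flux T V) +
       cell_integral T (\<lambda>x. (\<alpha> x *v fst (broken_flux P T) x) \<bullet> fst (local_flux T V) x) = energy_form T P V" for V
      using a_form_local_flux[OF T, of P V] unfolding a_form_def broken_flux_apply[OF T] by simp
    have d: "cell_integral T (\<lambda>x. weak_div k \<E> T (local_flux T V) x * potential P T x) = div_form T V P"
      if "V \<in> poly_fields k" for V
      using div_local_flux[OF T that P] T by (simp add: potential_def)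
    show ?thesis unfolding V a trace_form_local_flux(2)[OF T] using d by simp
  qed
  have 2: "(\<forall>w\<in>P_space (k + 1) T.
          cell_integral T (\<lambda>x. weak_div k \<E> T (broken_flux P T) x * w x) = cell_integral T (\<lambda>x. f x * w x)) \<longleftrightarrow>
      (\<forall>W\<in>poly_fields k. div_form T P W = load T W)" if T: "T \<in> \<T>" for T
  proof -
    have "\<exists>W\<in>poly_fields k. w = potential W T" if w: "w \<in> P_space (k + 1) T" for w
    proof -
      obtain p where p: "poly_of_degree (Suc k) p" "w = restrict p T" using w by (auto elim: P_spaceE)
      then have "(\<lambda>j x. 0)(Potential T := p) \<in> poly_fields k"
        by (intro poly_fields_update poly_fields_zero) simp
      then show ?thesis using p(2) T by (intro bexI) (auto simp: potential_def)
    qed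
    moreover have "potential W T \<in> P_space (k + 1) T" if "W \<in> poly_fields k" for W
      using potential_in_W[OF that] T unfolding W_space_def by auto
    ultimately have W: "(\<forall>w\<in>P_space (k + 1) T. A w) \<longleftrightarrow> (\<forall>W\<in>poly_fields k. A (potential W T))" for A
      by metis
    have "cell_integral T (\<lambda>x. weak_div k \<E> T (local_flux T P) x * potential W T x) = div_form T P W"
      if "W \<in> poly_fields k" for W
      using div_local_flux[OF T P that] T by (simp add: potential_def)
    then show ?thesis unfolding W broken_flux_apply[OF T] load_potential[OF T] by simp
  qed
  have 3: "(\<forall>\<phi>\<in>Lambda0_space \<Omega> k \<E>.
        (\<Sum>T\<in>\<T>. boundary_integral \<E> T (\<lambda>e x. normal_trace (broken_flux P T) T e x * \<phi> e x)) = 0) \<longleftrightarrow>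
     (\<forall>\<Phi>\<in>poly_fields k. boundary_multiplier_zero \<Phi> \<longrightarrow> (\<Sum>T\<in>\<T>. trace_form T P \<Phi>) = 0)"
  proof -
    have mem: "multiplier \<Phi> \<in> Lambda0_space \<Omega> k \<E> \<longleftrightarrow> boundary_multiplier_zero \<Phi>" if "\<Phi> \<in> poly_fields k" for \<Phi>
      using multiplier_in_Lambda[OF that] unfolding Lambda0_space_def boundary_multiplier_zero_def
      by (auto simp: multiplier_def)
    have "\<exists>\<Phi>\<in>poly_fields k. \<phi> = multiplier \<Phi>" if \<phi>: "\<phi> \<in> Lambda0_space \<Omega> k \<E>" for \<phi>
    proof -
      have "\<phi> \<in> Lambda_space k \<E>" using \<phi> unfolding Lambda0_space_def by blast
      then obtain \<Phi> where "\<Phi> \<in> poly_fields k" "\<phi> = multiplier \<Phi>"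
        by (rule fields_surj[OF V_zero W_zero])
      then show ?thesis by blast
    qed
    then have L: "(\<forall>\<phi>\<in>Lambda0_space \<Omega> k \<E>. A \<phi>) \<longleftrightarrow>
        (\<forall>\<Phi>\<in>poly_fields k. boundary_multiplier_zero \<Phi> \<longrightarrow> A (multiplier \<Phi>))" for A
      using mem by metis
    have "(\<Sum>T\<in>\<T>. boundary_integral \<E> T (\<lambda>e x. normal_trace (broken_flux P T) T e x * multiplier \<Phi> e x)) =
       (\<Sum>T\<in>\<T>. trace_form T P \<Phi>)" for \<Phi>
      by (intro sum.cong refl) (simp add: broken_flux_apply trace_form_local_flux)
    then show ?thesis unfolding L by simp
  qed
  show ?thesis
    unfolding hybrid_solutions_def hybrid_fields_def
    using broken_flux_in_V[OF P] potential_in_W[OF P] multiplier_in_Lambda[OF P]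
    by (simp only: mem_Collect_eq case_prod_conv 0 1 2 3 simp_thms cong: ball_cong)
qed

section \<open>Positivity of the energy\<close>

lemma continuous_traceD:
  assumes "continuous_trace P" "e \<in> \<E>" "\<not> e \<subseteq> frontier \<Omega>" "T1 \<in> \<T>" "T2 \<in> \<T>" "T1 \<noteq> T2"
    "e \<in> faces_of \<E> T1" "e \<in> faces_of \<E> T2" "x \<in> e"
  shows "P (Trace T1 e) x + P (Trace T2 e) x = 0"
  using assms unfolding continuous_trace_def by simp

text \<open>Both the interior part and the normal traces of the flux of \<open>P\<close> vanish on \<open>T\<close>.\<close>

definition flux_zero_on :: "(real^'n) set \<Rightarrow> 'n fields \<Rightarrow> bool" where
  "flux_zero_on T P \<longleftrightarrow> (\<forall>x\<in>T. flux P T x = 0) \<and> (\<forall>e\<in>faces_of \<E> T. \<forall>x\<in>e. P (Trace T e) x = 0)"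

lemma face_integral_zero: "(\<And>x. x \<in> e \<Longrightarrow> F x = 0) \<Longrightarrow> face_integral e F = 0"
  using face_integral_cong[of e F "\<lambda>x. 0"] unfolding face_integral_def by simp

lemma cell_integral_zero: "(\<And>x. x \<in> T \<Longrightarrow> F x = 0) \<Longrightarrow> cell_integral T F = 0"
  using cell_integral_cong[of T F "\<lambda>x. 0"] unfolding cell_integral_def by simp

lemma face_integral_square_zero:
  assumes "e \<in> \<E>" "continuous_on e F" "face_integral e (\<lambda>x. F x * F x) = 0" "x \<in> e"
  shows "F x = 0"
  using full_support_zero[OF face_support[OF assms(1)] assms(2) _ assms(4)] assms(3)
  unfolding face_integral_def power2_eq_square .

lemma face_integral_one: "e \<in> \<E> \<Longrightarrow> face_integral e (\<lambda>x. 1) \<noteq> 0"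
  using face_integral_square_zero[of e "\<lambda>x. 1"] rel_interior_face_nonempty[of e] rel_interior_subset[of e]
  by fastforce

lemma flux_zero_forms:
  assumes T: "T \<in> \<T>" and P: "flux_zero_on T P"
  shows "energy_form T P Q = 0" "energy_form T Q P = 0" "div_form T P Q = 0" "trace_form T P Q = 0"
proof -
  have z: "\<And>x. x \<in> T \<Longrightarrow> flux P T x = 0" "\<And>e x. e \<in> faces_of \<E> T \<Longrightarrow> x \<in> e \<Longrightarrow> P (Trace T e) x = 0"
    "\<And>e x. e \<in> faces_of \<E> T \<Longrightarrow> x \<in> e \<Longrightarrow> flux P T x = 0"
    using P face_subset[OF T] unfolding flux_zero_on_def by blast+
  show "energy_form T P Q = 0" "energy_form T Q P = 0" "div_form T P Q = 0" "trace_form T P Q = 0"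
    unfolding energy_form_def div_form_def trace_form_def
    by (simp_all add: z cell_integral_zero face_integral_zero)
qed

lemma energy_form_nonneg:
  assumes T: "T \<in> \<T>" and P: "P \<in> poly_fields k"
  shows "0 \<le> energy_form T P P"
    and "energy_form T P P = 0 \<Longrightarrow> flux_zero_on T P"
proof -
  let ?q = "flux P T" and ?s = "\<lambda>e x. flux P T x \<bullet> \<nu> T e - P (Trace T e) x"
  obtain c where c: "c > 0" "AE x in lebesgue_on \<Omega>. \<forall>\<xi>. c * (\<xi> \<bullet> \<xi>) \<le> (\<alpha> x *v \<xi>) \<bullet> \<xi>"
    using coefficient unfolding admissible_coefficient_def by blast
  define I where "I = cell_integral T (\<lambda>x. (\<alpha> x *v ?q x) \<bullet> ?q x)"
  define J where "J = cell_integral T (\<lambda>x. (norm (?q x))\<^sup>2)"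
  define S where "S e = face_integral e (\<lambda>x. (?s e x)\<^sup>2)" for e
  have iJ: "set_integrable lebesgue T (\<lambda>x. (norm (?q x))\<^sup>2)"
    by (intro cell_integrable_continuous[OF T] continuous_intros continuous_on_flux[OF P])
  have "(LINT x:T|lebesgue. c * (norm (?q x))\<^sup>2) \<le> (LINT x:T|lebesgue. (\<alpha> x *v ?q x) \<bullet> ?q x)"
  proof (rule set_integral_mono_AE)
    show "AE x\<in>T in lebesgue. c * (norm (?q x))\<^sup>2 \<le> (\<alpha> x *v ?q x) \<bullet> ?q x"
      using AE_cell_in_domain[OF T c(2)] by eventually_elim (auto simp: power2_norm_eq_inner)
  qed (use iJ coefficient_integrable[OF T] continuous_on_flux[OF P] in auto)
  then have cJ: "c * J \<le> I" unfolding I_def J_def cell_integral_def by simp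
  have J0: "0 \<le> J"
    unfolding J_def cell_integral_def set_lebesgue_integral_def by (intro Bochner_Integration.integral_nonneg) simp
  have S0: "0 \<le> S e" for e
    unfolding S_def face_integral_def set_lebesgue_integral_def by (intro Bochner_Integration.integral_nonneg) simp
  have en: "energy_form T P P = I + diameter T * (\<Sum>e\<in>faces_of \<E> T. S e)"
    unfolding energy_form_def I_def S_def power2_eq_square ..
  have "0 \<le> c * J" using c(1) J0 by simp
  then have I0: "0 \<le> I" using cJ by linarith
  have SS: "0 \<le> (\<Sum>e\<in>faces_of \<E> T. S e)" using S0 by (intro sum_nonneg) simp
  have dS: "0 \<le> diameter T * (\<Sum>e\<in>faces_of \<E> T. S e)" using diameter_pos[OF T] SS by simp
  show "0 \<le> energy_form T P P" using en I0 dS by linarith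
  assume "energy_form T P P = 0"
  then have 0: "I = 0" "diameter T * (\<Sum>e\<in>faces_of \<E> T. S e) = 0" using en I0 dS by linarith+
  have "c * J = 0" using 0(1) cJ \<open>0 \<le> c * J\<close> by linarith
  then have "J = 0" using c(1) by simp
  then have "norm (?q x) = 0" if "x \<in> T" for x
    using full_support_zero[OF cell_support[OF T] continuous_on_norm[OF continuous_on_flux[OF P]] _ that]
    unfolding J_def cell_integral_def by blast
  then have q: "?q x = 0" if "x \<in> T" for x using that by simp
  have "(\<Sum>e\<in>faces_of \<E> T. S e) = 0" using 0(2) diameter_pos[OF T] by simp
  then have "S e = 0" if "e \<in> faces_of \<E> T" for e
    using that S0 finite_faces[of T] by (simp add: sum_nonneg_eq_0_iff)
  then have s: "?s e x = 0" if "e \<in> faces_of \<E> T" "x \<in> e" for e x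
    by (intro face_integral_square_zero[of e "?s e"] continuous_intros faces_ofD[of e T] that
          continuous_on_flux[OF P] continuous_on_fields[OF P])
       (use that in \<open>simp add: S_def power2_eq_square\<close>)
  have "P (Trace T e) x = 0" if "e \<in> faces_of \<E> T" "x \<in> e" for e x
    using s[OF that] q[of x] face_subset[OF T that(1)] that(2) by auto
  then show "flux_zero_on T P" using q unfolding flux_zero_on_def by blast
qed

lemma energy_sum_zero:
  assumes "P \<in> poly_fields k" "(\<Sum>T\<in>\<T>. energy_form T P P) = 0" "T \<in> \<T>"
  shows "flux_zero_on T P"
proof -
  have "energy_form T P P = 0"
    using assms energy_form_nonneg(1)[OF _ assms(1)] finite_mesh(1)
    by (simp add: sum_nonneg_eq_0_iff)
  then show ?thesis by (rule energy_form_nonneg(2)[OF assms(3,1)])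
qed

section \<open>The kernel of the divergence form\<close>

lemma div_form_single_trace:
  assumes T: "T \<in> \<T>" "e \<in> faces_of \<E> T"
  shows "(\<Sum>T'\<in>\<T>. div_form T' ((\<lambda>j x. 0)(Trace T e := p)) W) = face_integral e (\<lambda>x. p x * W (Potential T) x)"
proof -
  let ?V = "(\<lambda>j x. 0)(Trace T e := p) :: 'n fields"
  have fl: "flux ?V T' x = 0" for T' x by (simp add: flux_def vec_eq_iff)
  have "(\<Sum>T'\<in>\<T>. div_form T' ?V W) = div_form T ?V W"
  proof (rule sum_eq_single[OF finite_mesh(1) T(1)])
    fix T' assume "T' \<in> \<T>" "T' \<noteq> T"
    then have "flux_zero_on T' ?V" using fl unfolding flux_zero_on_def by simp
    then show "div_form T' ?V W = 0" using flux_zero_forms(3) \<open>T' \<in> \<T>\<close> by blast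
  qed
  also have "\<dots> = (\<Sum>e'\<in>faces_of \<E> T. face_integral e' (\<lambda>x. ?V (Trace T e') x * W (Potential T) x))"
    unfolding div_form_def by (simp add: fl cell_integral_zero)
  also have "\<dots> = face_integral e (\<lambda>x. ?V (Trace T e) x * W (Potential T) x)"
    by (rule sum_eq_single[OF finite_faces T(2)]) (auto intro: face_integral_zero)
  finally show ?thesis by simp
qed

text \<open>A potential that is orthogonal to the weak divergences of all fluxes without jumps has zero
  gradient, as the gradient itself may serve as interior flux. Single normal traces then show that
  its values on both sides of an interior face are equal and that it is zero at boundary faces.\<close>

lemma div_form_kernel:
  assumes W: "W \<in> poly_fields k"
    and zero: "\<And>V. V \<in> poly_fields k \<Longrightarrow> continuous_trace V \<Longrightarrow> (\<Sum>T\<in>\<T>. div_form T V W) = 0"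
    and T: "T \<in> \<T>" and x: "x \<in> T"
  shows "W (Potential T) x = 0"
proof -
  have grad0: "grad (W (Potential T)) x = 0" if T: "T \<in> \<T>" and x: "x \<in> T" for T x
  proof -
    let ?G = "grad (W (Potential T))"
    define V :: "'n fields" where
      "V j = (case j of Flux T' i \<Rightarrow> if T' = T then (\<lambda>x. ?G x $ i) else (\<lambda>x. 0) | _ \<Rightarrow> (\<lambda>x. 0))" for j
    have V: "V \<in> poly_fields k"
      unfolding poly_fields_def V_def
      by (auto split: component.split simp: poly_of_degree_0 poly_of_degree_grad[OF poly_fieldsD(3)[OF W]])
    have "continuous_trace V" unfolding continuous_trace_def V_def by simp
    then have "(\<Sum>T\<in>\<T>. div_form T V W) = 0" by (rule zero[OF V])
    moreover have "(\<Sum>T'\<in>\<T>. div_form T' V W) = div_form T V W"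
    proof (rule sum_eq_single[OF finite_mesh(1) T])
      fix T' assume "T' \<in> \<T>" "T' \<noteq> T"
      then have "flux_zero_on T' V" unfolding flux_zero_on_def V_def flux_def by (simp add: vec_eq_iff)
      then show "div_form T' V W = 0" using flux_zero_forms(3) \<open>T' \<in> \<T>\<close> by blast
    qed
    moreover have "flux V T x = ?G x" for x unfolding V_def flux_def by simp
    then have "div_form T V W = - cell_integral T (\<lambda>x. (norm (?G x))\<^sup>2)"
      unfolding div_form_def power2_norm_eq_inner by (simp add: V_def face_integral_zero)
    ultimately have "(LINT x:T|lebesgue. (norm (?G x))\<^sup>2) = 0" unfolding cell_integral_def by simp
    then have "norm (?G x) = 0"
      by (rule full_support_zero[OF cell_support[OF T] continuous_on_norm[OF continuous_on_grad[OF W]] _ x])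
    then show ?thesis by simp
  qed
  have "\<forall>T\<in>\<T>. \<exists>c. \<forall>x\<in>T. W (Potential T) x = c"
    using poly_zero_gradient_constant[OF cell poly_fieldsD(3)[OF W]] grad0 by blast
  from bchoice[OF this] obtain c where c: "\<And>T x. T \<in> \<T> \<Longrightarrow> x \<in> T \<Longrightarrow> W (Potential T) x = c T" by blast
  let ?\<tau> = "\<lambda>T e. (\<lambda>j x. 0)(Trace T e := (\<lambda>x. 1)) :: 'n fields"
  have \<tau>: "?\<tau> T e \<in> poly_fields k" for T e
    by (intro poly_fields_update poly_fields_zero) (simp add: poly_of_degree_const)
  have val: "(\<Sum>T'\<in>\<T>. div_form T' (?\<tau> T e) W) = c T * face_integral e (\<lambda>x. 1)"
    if T: "T \<in> \<T>" "e \<in> faces_of \<E> T" for T e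
  proof -
    have "face_integral e (\<lambda>x. 1 * W (Potential T) x) = face_integral e (\<lambda>x. c T * 1)"
      by (rule face_integral_cong) (use c[OF T(1)] face_subset[OF T] in auto)
    moreover have "face_integral e (\<lambda>x. c T * 1) = c T * face_integral e (\<lambda>x. 1)"
      unfolding face_integral_def by (rule set_integral_mult_right)
    ultimately show ?thesis unfolding div_form_single_trace[OF T] by (rule trans)
  qed
  have "c T = 0"
  proof (rule facewise_equal_imp_zero[OF _ _ T])
    fix e T1 T2
    assume e: "e \<in> \<E>" "\<not> e \<subseteq> frontier \<Omega>" and T: "T1 \<in> \<T>" "T2 \<in> \<T>" "T1 \<noteq> T2"
      "e \<in> faces_of \<E> T1" "e \<in> faces_of \<E> T2"
    obtain A B where "A \<noteq> B" and AB: "{T\<in>\<T>. e \<in> faces_of \<E> T} = {A, B}" by (rule interior_face_elements[OF e])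
    have el: "T = T1 \<or> T = T2" if "T \<in> \<T>" "e \<in> faces_of \<E> T" for T
    proof -
      have "T \<in> {A, B}" "T1 \<in> {A, B}" "T2 \<in> {A, B}" using AB T that by blast+
      then show ?thesis using T(3) by auto
    qed
    let ?V = "\<lambda>j x. (-1) * ?\<tau> T2 e j x + ?\<tau> T1 e j x"
    have "continuous_trace ?V"
      unfolding continuous_trace_def using el T(3) by auto
    then have "(\<Sum>T\<in>\<T>. div_form T ?V W) = 0" by (rule zero[OF poly_fields_lincomb[OF \<tau> \<tau>]])
    moreover have "(\<Sum>T\<in>\<T>. div_form T ?V W) = (\<Sum>T\<in>\<T>. (-1) * div_form T (?\<tau> T2 e) W + div_form T (?\<tau> T1 e) W)"
      by (intro sum.cong refl div_form_left \<tau> W)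
    moreover have "\<dots> = c T1 * face_integral e (\<lambda>x. 1) - c T2 * face_integral e (\<lambda>x. 1)"
      unfolding val[OF T(1,4), symmetric] val[OF T(2,5), symmetric]
      by (simp add: sum_negf sum.distrib sum_subtractf)
    ultimately have "c T1 * face_integral e (\<lambda>x. 1) = c T2 * face_integral e (\<lambda>x. 1)" by linarith
    then show "c T1 = c T2" using face_integral_one[OF e(1)] by auto
  next
    fix e T assume T: "T \<in> \<T>" "e \<in> faces_of \<E> T" and e: "e \<subseteq> frontier \<Omega>"
    have "continuous_trace (?\<tau> T e)" unfolding continuous_trace_def using e by auto
    then have "c T * face_integral e (\<lambda>x. 1) = 0" using zero[OF \<tau>] val[OF T] by simp
    then show "c T = 0" using face_integral_one[OF faces_ofD[OF T(2)]] by simp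
  qed
  then show ?thesis using c[OF T x] by simp
qed

section \<open>Uniqueness for both schemes\<close>

lemma wg_fields_unique:
  assumes P: "P \<in> poly_fields k" "wg_fields P" and Q: "Q \<in> poly_fields k" "wg_fields Q"
  shows "broken_flux P = broken_flux Q" "potential P = potential Q"
proof -
  define D where "D = (\<lambda>j x. (-1) * Q j x + P j x)"
  have D: "D \<in> poly_fields k" unfolding D_def by (intro poly_fields_lincomb P Q)
  have "continuous_trace P" "continuous_trace Q" using P(2) Q(2) unfolding wg_fields_def by blast+
  then have ct: "continuous_trace D"
    unfolding continuous_trace_def[of D]
  proof (intro ballI impI, goal_cases)
    case (1 e T1 T2 x)
    then show ?case
      using continuous_traceD[of P e T1 T2 x] continuous_traceD[of Q e T1 T2 x] unfolding D_def by simp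
  qed
  have dD: "(\<Sum>T\<in>\<T>. div_form T D W) = 0" if W: "W \<in> poly_fields k" for W
  proof -
    have "(\<Sum>T\<in>\<T>. div_form T D W) = (\<Sum>T\<in>\<T>. (-1) * div_form T Q W + div_form T P W)"
      unfolding D_def by (intro sum.cong refl div_form_left P Q W)
    then show ?thesis using P(2) Q(2) W unfolding wg_fields_def by (simp add: sum_negf sum.distrib sum_subtractf)
  qed
  have eq: "(\<Sum>T\<in>\<T>. energy_form T D V) - (\<Sum>T\<in>\<T>. div_form T V D) = 0"
    if V: "V \<in> poly_fields k" "continuous_trace V" for V
  proof -
    have "(\<Sum>T\<in>\<T>. energy_form T D V) = (\<Sum>T\<in>\<T>. (-1) * energy_form T Q V + energy_form T P V)"
      "(\<Sum>T\<in>\<T>. div_form T V D) = (\<Sum>T\<in>\<T>. (-1) * div_form T V Q + div_form T V P)"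
      unfolding D_def
      using energy_form_left[OF _ Q(1) P(1) V(1), of _ "-1"] div_form_right[OF _ Q(1) P(1) V(1), of _ "-1"]
      by (simp_all cong: sum.cong)
    moreover have "(\<Sum>T\<in>\<T>. energy_form T P V) - (\<Sum>T\<in>\<T>. div_form T V P) = - boundary_load V"
      "(\<Sum>T\<in>\<T>. energy_form T Q V) - (\<Sum>T\<in>\<T>. div_form T V Q) = - boundary_load V"
      using P(2) Q(2) V unfolding wg_fields_def by blast+
    ultimately show ?thesis by (simp add: sum_subtractf)
  qed
  have "(\<Sum>T\<in>\<T>. energy_form T D D) = 0" using eq[OF D ct] dD[OF D] by simp
  then have z: "flux_zero_on T D" if "T \<in> \<T>" for T using energy_sum_zero[OF D] that by blast
  show "broken_flux P = broken_flux Q"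
  proof (rule broken_flux_eqI)
    fix T i x assume T: "T \<in> \<T>" "x \<in> T"
    then have "flux D T x $ i = 0" using z unfolding flux_zero_on_def by simp
    then show "P (Flux T i) x = Q (Flux T i) x" unfolding flux_def D_def by simp
  next
    fix T e x assume T: "T \<in> \<T>" "e \<in> faces_of \<E> T" "x \<in> e"
    then have "D (Trace T e) x = 0" using z unfolding flux_zero_on_def by blast
    then show "P (Trace T e) x = Q (Trace T e) x" unfolding D_def by simp
  qed
  have "D (Potential T) x = 0" if T: "T \<in> \<T>" "x \<in> T" for T x
  proof (rule div_form_kernel[OF D _ T])
    fix V assume "V \<in> poly_fields k" "continuous_trace V"
    moreover have "(\<Sum>T\<in>\<T>. energy_form T D V) = 0"
      by (intro sum.neutral ballI flux_zero_forms(1) z)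
    ultimately show "(\<Sum>T\<in>\<T>. div_form T V D) = 0" using eq by fastforce
  qed
  then show "potential P = potential Q"
    unfolding potential_def by (intro restrict_ext) (simp add: D_def)
qed

text \<open>With single-valued multipliers the interior faces do not contribute to the trace form of a
  continuous normal trace, since the two contributions of each of them add up to zero.\<close>

lemma interior_traces_cancel:
  assumes V: "V \<in> poly_fields k" "continuous_trace V" and R: "R \<in> poly_fields k"
  shows "(\<Sum>T\<in>\<T>. \<Sum>e | e \<in> faces_of \<E> T \<and> \<not> e \<subseteq> frontier \<Omega>.
     face_integral e (\<lambda>x. V (Trace T e) x * R (Multiplier e) x)) = 0"
proof -
  let ?a = "\<lambda>T e. face_integral e (\<lambda>x. V (Trace T e) x * R (Multiplier e) x)"
  let ?E = "{e\<in>\<E>. \<not> e \<subseteq> frontier \<Omega>}"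
  have "(\<Sum>T\<in>\<T>. \<Sum>e | e \<in> faces_of \<E> T \<and> \<not> e \<subseteq> frontier \<Omega>. ?a T e) =
     (\<Sum>T\<in>\<T>. \<Sum>e | e \<in> ?E \<and> e \<in> faces_of \<E> T. ?a T e)"
    by (intro sum.cong refl) (auto dest: faces_ofD)
  also have "\<dots> = (\<Sum>e\<in>?E. \<Sum>T | T \<in> \<T> \<and> e \<in> faces_of \<E> T. ?a T e)"
    using finite_mesh by (intro sum.swap_restrict) auto
  also have "\<dots> = 0"
  proof (rule sum.neutral, rule ballI)
    fix e assume "e \<in> ?E"
    then have e: "e \<in> \<E>" "\<not> e \<subseteq> frontier \<Omega>" by auto
    obtain A B where AB: "A \<noteq> B" "{T\<in>\<T>. e \<in> faces_of \<E> T} = {A, B}" by (rule interior_face_elements[OF e])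
    then have T: "A \<in> \<T>" "B \<in> \<T>" "e \<in> faces_of \<E> A" "e \<in> faces_of \<E> B" by blast+
    have "(\<Sum>T | T \<in> \<T> \<and> e \<in> faces_of \<E> T. ?a T e) = 1 * ?a A e + ?a B e"
      unfolding AB(2) using AB(1) by simp
    also have "\<dots> = face_integral e (\<lambda>x. 1 * (V (Trace A e) x * R (Multiplier e) x) + V (Trace B e) x * R (Multiplier e) x)"
      by (intro face_integral_lincomb[symmetric] face_integrable_continuous[OF e(1)]
          continuous_intros V(1)[THEN continuous_on_fields] R[THEN continuous_on_fields])
    also have "\<dots> = face_integral e (\<lambda>x. (V (Trace A e) x + V (Trace B e) x) * R (Multiplier e) x)"
      by (simp add: algebra_simps)
    also have "\<dots> = 0"
      by (rule face_integral_zero) (simp add: continuous_traceD[OF V(2) e T(1,2) AB(1) T(3,4)])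
    finally show "(\<Sum>T | T \<in> \<T> \<and> e \<in> faces_of \<E> T. ?a T e) = 0" .
  qed
  finally show ?thesis .
qed

lemma trace_form_split:
  "trace_form T V R =
     (\<Sum>e | e \<in> faces_of \<E> T \<and> e \<subseteq> frontier \<Omega>. face_integral e (\<lambda>x. V (Trace T e) x * R (Multiplier e) x)) +
     (\<Sum>e | e \<in> faces_of \<E> T \<and> \<not> e \<subseteq> frontier \<Omega>. face_integral e (\<lambda>x. V (Trace T e) x * R (Multiplier e) x))"
  unfolding trace_form_def
  by (subst sum.union_disjoint[symmetric]) (auto simp: finite_faces intro!: sum.cong)

text \<open>On boundary faces the projected data may be replaced by \<open>g\<close> when tested with polynomials.\<close>

lemma boundary_multiplier_projection:
  assumes "e \<in> \<E>" "e \<subseteq> frontier \<Omega>" "restrict (R (Multiplier e)) e = Q_b k g e" "poly_of_degree k p"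
  shows "face_integral e (\<lambda>x. p x * R (Multiplier e) x) = face_integral e (\<lambda>x. g x * p x)"
proof -
  have "face_integral e (\<lambda>x. p x * R (Multiplier e) x) =
      face_integral e (\<lambda>x. restrict (R (Multiplier e)) e x * restrict p e x)"
    by (rule face_integral_cong) simp
  also have "\<dots> = face_integral e (\<lambda>x. g x * restrict p e x)"
    unfolding assms(3) by (intro Q_b_projection(2)[OF assms(1,2)] restrict_in_P_space assms(4))
  also have "\<dots> = face_integral e (\<lambda>x. g x * p x)"
    by (rule face_integral_cong) simp
  finally show ?thesis .
qed

lemma trace_form_single_multiplier:
  "trace_form T P ((\<lambda>j x. 0)(Multiplier e := \<phi>)) =
    (if e \<in> faces_of \<E> T then face_integral e (\<lambda>x. P (Trace T e) x * \<phi> x) else 0)"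
proof (cases "e \<in> faces_of \<E> T")
  case True
  let ?h = "\<lambda>e'. face_integral e' (\<lambda>x. P (Trace T e') x * ((\<lambda>j x. 0)(Multiplier e := \<phi>) :: 'n fields) (Multiplier e') x)"
  have "sum ?h (faces_of \<E> T) = ?h e"
    by (rule sum_eq_single[OF finite_faces True]) (auto intro: face_integral_zero)
  then show ?thesis using True unfolding trace_form_def by simp
next
  case False
  then show ?thesis unfolding trace_form_def by (auto intro!: sum.neutral face_integral_zero)
qed

text \<open>The third equation of the hybridized scheme forces the jumps of the flux to be zero, and then only
  the boundary multipliers remain in the sum of the local equations.\<close>

lemma hybrid_imp_wg_fields:
  assumes P: "P \<in> poly_fields k" and hyb: "hybrid_fields P"
  shows "wg_fields P"
proof -
  have bd: "restrict (P (Multiplier e)) e = Q_b k g e" if "e \<in> \<E>" "e \<subseteq> frontier \<Omega>" for e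
    using hyb that unfolding hybrid_fields_def by blast
  have "continuous_trace P"
    unfolding continuous_trace_def
  proof (intro ballI impI)
    fix e T1 T2 x
    assume e: "e \<in> \<E>" "\<not> e \<subseteq> frontier \<Omega>" and "T1 \<in> \<T>" "T2 \<in> \<T>" and x: "x \<in> e"
      and "T1 \<noteq> T2 \<and> e \<in> faces_of \<E> T1 \<and> e \<in> faces_of \<E> T2"
    then have T: "T1 \<in> \<T>" "T2 \<in> \<T>" "T1 \<noteq> T2" "e \<in> faces_of \<E> T1" "e \<in> faces_of \<E> T2" by auto
    \<comment> \<open>the jump itself is an admissible multiplier\<close>
    define J where "J x = P (Trace T1 e) x + P (Trace T2 e) x" for x
    let ?\<Phi> = "(\<lambda>j x. 0)(Multiplier e := J) :: 'n fields"
    have J: "poly_of_degree k J" unfolding J_def by (intro poly_of_degree_add poly_fieldsD P)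
    have "?\<Phi> \<in> poly_fields k" using J by (intro poly_fields_update poly_fields_zero) simp
    moreover have "boundary_multiplier_zero ?\<Phi>"
      unfolding boundary_multiplier_zero_def using e(2) by auto
    ultimately have "0 = (\<Sum>T\<in>\<T>. trace_form T P ?\<Phi>)" using hyb unfolding hybrid_fields_def by simp
    also have "\<dots> = (\<Sum>T | T \<in> \<T> \<and> e \<in> faces_of \<E> T. face_integral e (\<lambda>x. P (Trace T e) x * J x))"
      unfolding trace_form_single_multiplier using finite_mesh(1) by (simp add: sum.inter_filter)
    also have "{T. T \<in> \<T> \<and> e \<in> faces_of \<E> T} = {T1, T2}"
    proof -
      obtain A B where AB: "A \<noteq> B" "{T\<in>\<T>. e \<in> faces_of \<E> T} = {A, B}" by (rule interior_face_elements[OF e])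
      then have "T1 \<in> {A, B}" "T2 \<in> {A, B}" using T by blast+
      then show ?thesis using AB T(3) by auto
    qed
    also have "(\<Sum>T\<in>{T1, T2}. face_integral e (\<lambda>x. P (Trace T e) x * J x)) =
       1 * face_integral e (\<lambda>x. P (Trace T1 e) x * J x) + face_integral e (\<lambda>x. P (Trace T2 e) x * J x)"
      using T(3) by simp
    also have "\<dots> = face_integral e (\<lambda>x. 1 * (P (Trace T1 e) x * J x) + P (Trace T2 e) x * J x)"
      by (intro face_integral_lincomb[symmetric] face_integrable_continuous[OF e(1)]
          continuous_intros continuous_on_fields[OF P] poly_of_degree_continuous[OF J])
    also have "\<dots> = face_integral e (\<lambda>x. J x * J x)"
      by (rule face_integral_cong) (simp add: J_def algebra_simps)
    finally have "J x = 0"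
      using face_integral_square_zero[OF e(1) poly_of_degree_continuous[OF J] _ x] by simp
    then show "P (Trace T1 e) x + P (Trace T2 e) x = 0" unfolding J_def .
  qed
  moreover have "(\<Sum>T\<in>\<T>. energy_form T P V) - (\<Sum>T\<in>\<T>. div_form T V P) = - boundary_load V"
    if V: "V \<in> poly_fields k" "continuous_trace V" for V
  proof -
    have "(\<Sum>T\<in>\<T>. trace_form T V P) =
       (\<Sum>T\<in>\<T>. \<Sum>e | e \<in> faces_of \<E> T \<and> e \<subseteq> frontier \<Omega>. face_integral e (\<lambda>x. V (Trace T e) x * P (Multiplier e) x))"
      unfolding trace_form_split sum.distrib interior_traces_cancel[OF V P] by simp
    also have "\<dots> = boundary_load V"
      unfolding boundary_load_def
      by (intro sum.cong refl boundary_multiplier_projection bd poly_fieldsD(2)[OF V(1)]) (auto dest: faces_ofD)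
    finally have tr: "(\<Sum>T\<in>\<T>. trace_form T V P) = boundary_load V" .
    have "(\<Sum>T\<in>\<T>. energy_form T P V - div_form T V P) = (\<Sum>T\<in>\<T>. - trace_form T V P)"
      using hyb V(1) unfolding hybrid_fields_def by (intro sum.cong refl) blast
    then show ?thesis using tr by (simp add: sum_subtractf sum_negf)
  qed
  moreover have "(\<Sum>T\<in>\<T>. div_form T P W) = (\<Sum>T\<in>\<T>. load T W)" if "W \<in> poly_fields k" for W
    using hyb that unfolding hybrid_fields_def by (intro sum.cong refl) blast
  ultimately show ?thesis unfolding wg_fields_def by blast
qed

lemma trace_form_single_trace:
  assumes T: "T \<in> \<T>" "e \<in> faces_of \<E> T"
  shows "trace_form T ((\<lambda>j x. 0)(Trace T e := p)) R = face_integral e (\<lambda>x. p x * R (Multiplier e) x)"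
proof -
  let ?h = "\<lambda>e'. face_integral e' (\<lambda>x. ((\<lambda>j x. 0)(Trace T e := p) :: 'n fields) (Trace T e') x * R (Multiplier e') x)"
  have "sum ?h (faces_of \<E> T) = ?h e"
    by (rule sum_eq_single[OF finite_faces T(2)]) (auto intro: face_integral_zero)
  then show ?thesis unfolding trace_form_def by simp
qed

text \<open>The first equation, tested with single traces, determines the multiplier on every face.\<close>

lemma hybrid_multiplier_unique:
  assumes P: "P \<in> poly_fields k" "hybrid_fields P" and Q: "Q \<in> poly_fields k" "hybrid_fields Q"
    and eq: "broken_flux P = broken_flux Q" "potential P = potential Q"
  shows "multiplier P = multiplier Q"
  unfolding multiplier_def
proof (intro restrict_ext)
  fix e x assume e: "e \<in> \<E>" and x: "x \<in> e"
  obtain T where T: "T \<in> \<T>" "e \<in> faces_of \<E> T"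
  proof (cases "e \<subseteq> frontier \<Omega>")
    case True
    obtain T where "{T\<in>\<T>. e \<in> faces_of \<E> T} = {T}" by (rule boundary_face_unique[OF e True])
    then show ?thesis using that[of T] by blast
  next
    case False
    obtain T T' where "T \<noteq> T'" "{T\<in>\<T>. e \<in> faces_of \<E> T} = {T, T'}" by (rule interior_face_elements[OF e False])
    then show ?thesis using that[of T] by blast
  qed
  define p where "p x = P (Multiplier e) x - Q (Multiplier e) x" for x
  have p: "poly_of_degree k p" unfolding p_def by (intro poly_of_degree_diff poly_fieldsD P Q)
  let ?V = "(\<lambda>j x. 0)(Trace T e := p) :: 'n fields"
  have V: "?V \<in> poly_fields k" using p by (intro poly_fields_update poly_fields_zero) simp
  have "energy_form T P ?V = energy_form T Q ?V"
    using fun_cong[OF eq(1), of T] a_form_local_flux[OF T(1)] broken_flux_apply[OF T(1)] by metis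
  moreover have "div_form T ?V P = div_form T ?V Q"
    using fun_cong[OF eq(2), of T] div_local_flux[OF T(1) V P(1)] div_local_flux[OF T(1) V Q(1)] T(1)
    unfolding potential_def by simp
  moreover have "energy_form T P ?V - div_form T ?V P = - trace_form T ?V P"
    "energy_form T Q ?V - div_form T ?V Q = - trace_form T ?V Q"
    using P(2) Q(2) T(1) V unfolding hybrid_fields_def by blast+
  ultimately have "trace_form T ?V P = trace_form T ?V Q" by simp
  then have "0 = (-1) * face_integral e (\<lambda>x. p x * Q (Multiplier e) x) + face_integral e (\<lambda>x. p x * P (Multiplier e) x)"
    unfolding trace_form_single_trace[OF T] by simp
  also have "\<dots> = face_integral e (\<lambda>x. (-1) * (p x * Q (Multiplier e) x) + p x * P (Multiplier e) x)"
    by (intro face_integral_lincomb[symmetric] face_integrable_continuous[OF e] continuous_intros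
        poly_of_degree_continuous[OF p] continuous_on_fields[OF P(1)] continuous_on_fields[OF Q(1)])
  also have "\<dots> = face_integral e (\<lambda>x. p x * p x)"
    by (rule face_integral_cong) (simp add: p_def algebra_simps)
  finally have "p x = 0"
    using face_integral_square_zero[OF e poly_of_degree_continuous[OF p] _ x] by simp
  then show "P (Multiplier e) x = Q (Multiplier e) x" unfolding p_def by simp
qed

section \<open>Existence\<close>

text \<open>The components which matter for the schemes. Boundary multipliers are left out, since they are
  prescribed.\<close>

definition unknowns :: "((real^'n) set, 'n) component set" where
  "unknowns = {j. case j of Flux T i \<Rightarrow> T \<in> \<T> | Trace T e \<Rightarrow> T \<in> \<T> \<and> e \<in> faces_of \<E> T
     | Potential T \<Rightarrow> T \<in> \<T> | Multiplier e \<Rightarrow> e \<in> \<E> \<and> \<not> e \<subseteq> frontier \<Omega>}"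

text \<open>The family obtained from \<open>P\<close> by setting all components but the unknowns in \<open>A\<close> to zero.\<close>

definition select :: "((real^'n) set, 'n) component set \<Rightarrow> 'n fields \<Rightarrow> 'n fields" where
  "select A P = (\<lambda>j. if j \<in> A \<inter> unknowns then P j else (\<lambda>x. 0))"

lemma finite_unknowns: "finite unknowns"
proof -
  have "unknowns \<subseteq> (\<Union>T\<in>\<T>. range (Flux T)) \<union> (\<Union>T\<in>\<T>. Trace T ` \<E>) \<union>
      Potential ` \<T> \<union> Multiplier ` \<E>"
  proof
    fix j assume "j \<in> unknowns"
    then show "j \<in> (\<Union>T\<in>\<T>. range (Flux T)) \<union> (\<Union>T\<in>\<T>. Trace T ` \<E>) \<union>
        Potential ` \<T> \<union> Multiplier ` \<E>"
      unfolding unknowns_def by (cases j) (auto simp: faces_of_def)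
  qed
  then show ?thesis using finite_mesh by (elim finite_subset) auto
qed

lemma select_in_family:
  "P \<in> poly_fields k \<Longrightarrow> select A P \<in> poly_family unknowns (component_degree k)"
  unfolding select_def poly_fields_def poly_family_def by (auto intro: poly_of_degree_0)

lemma poly_family_in_fields:
  assumes "P \<in> poly_family unknowns (component_degree k)"
  shows "P \<in> poly_fields k"
proof -
  have "poly_of_degree (component_degree k j) (P j)" for j
    using assms poly_of_degree_0 unfolding poly_family_def by (cases "j \<in> unknowns") auto
  then show ?thesis unfolding poly_fields_def by blast
qed

text \<open>The three equations of the hybridized scheme as a single variational equation. Taking the last
  equation with a negative sign cancels all terms but the energy when \<open>P = Q\<close>. The prescribed
  boundary multipliers have moved to the right-hand side, where \<open>g\<close> may stand for its projection.\<close>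

definition system_form :: "'n fields \<Rightarrow> 'n fields \<Rightarrow> real" where
  "system_form P Q = (\<Sum>T\<in>\<T>. energy_form T P Q - div_form T Q P + trace_form T Q P
     + div_form T P Q - trace_form T P Q)"

definition system_load :: "'n fields \<Rightarrow> real" where
  "system_load Q = (\<Sum>T\<in>\<T>. load T Q) - boundary_load Q"

lemma system_form_lincomb:
  assumes "P \<in> poly_fields k" "P' \<in> poly_fields k" "Q \<in> poly_fields k"
  shows "system_form (\<lambda>j x. a * P j x + P' j x) Q = a * system_form P Q + system_form P' Q"
    and "system_form Q (\<lambda>j x. a * P j x + P' j x) = a * system_form Q P + system_form Q P'"
proof -
  have "energy_form T (\<lambda>j x. a * P j x + P' j x) Q - div_form T Q (\<lambda>j x. a * P j x + P' j x)
      + trace_form T Q (\<lambda>j x. a * P j x + P' j x) + div_form T (\<lambda>j x. a * P j x + P' j x) Q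
      - trace_form T (\<lambda>j x. a * P j x + P' j x) Q =
    a * (energy_form T P Q - div_form T Q P + trace_form T Q P + div_form T P Q - trace_form T P Q) +
    (energy_form T P' Q - div_form T Q P' + trace_form T Q P' + div_form T P' Q - trace_form T P' Q)"
    if T: "T \<in> \<T>" for T
    unfolding energy_form_left[OF T assms] div_form_left[OF T assms] div_form_right[OF T assms]
      trace_form_left[OF assms] trace_form_right[OF assms] by (simp add: algebra_simps)
  then show "system_form (\<lambda>j x. a * P j x + P' j x) Q = a * system_form P Q + system_form P' Q"
    unfolding system_form_def sum_distrib_left sum.distrib[symmetric] by (intro sum.cong refl)
  have "energy_form T Q (\<lambda>j x. a * P j x + P' j x) - div_form T (\<lambda>j x. a * P j x + P' j x) Q
      + trace_form T (\<lambda>j x. a * P j x + P' j x) Q + div_form T Q (\<lambda>j x. a * P j x + P' j x)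
      - trace_form T Q (\<lambda>j x. a * P j x + P' j x) =
    a * (energy_form T Q P - div_form T P Q + trace_form T P Q + div_form T Q P - trace_form T Q P) +
    (energy_form T Q P' - div_form T P' Q + trace_form T P' Q + div_form T Q P' - trace_form T Q P')"
    if T: "T \<in> \<T>" for T
    unfolding energy_form_right[OF T assms] div_form_left[OF T assms] div_form_right[OF T assms]
      trace_form_left[OF assms] trace_form_right[OF assms] by (simp add: algebra_simps)
  then show "system_form Q (\<lambda>j x. a * P j x + P' j x) = a * system_form Q P + system_form Q P'"
    unfolding system_form_def sum_distrib_left sum.distrib[symmetric] by (intro sum.cong refl)
qed

lemma system_load_lincomb:
  assumes "P \<in> poly_fields k" "P' \<in> poly_fields k"
  shows "system_load (\<lambda>j x. a * P j x + P' j x) = a * system_load P + system_load P'"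
proof -
  have "(\<Sum>T\<in>\<T>. load T (\<lambda>j x. a * P j x + P' j x)) = (\<Sum>T\<in>\<T>. a * load T P + load T P')"
    by (intro sum.cong refl load_lincomb assms)
  then show ?thesis
    unfolding system_load_def boundary_load_lincomb[OF assms]
    by (simp add: sum.distrib sum_distrib_left algebra_simps)
qed

lemma load_zero: "(\<And>x. x \<in> T \<Longrightarrow> Q (Potential T) x = 0) \<Longrightarrow> load T Q = 0"
  unfolding load_def by (rule cell_integral_zero) simp

lemma boundary_load_zero: "(\<And>T. T \<in> \<T> \<Longrightarrow> flux_zero_on T Q) \<Longrightarrow> boundary_load Q = 0"
  unfolding boundary_load_def flux_zero_on_def
  by (intro sum.neutral ballI face_integral_zero) simp

text \<open>Inserting \<open>Q\<close> itself for \<open>P\<close> makes its flux vanish, and then its potential is orthogonal to the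
  weak divergences of all fluxes without jumps.\<close>

lemma system_kernel:
  assumes Q: "Q \<in> poly_family unknowns (component_degree k)"
    and zero: "\<And>P. P \<in> poly_family unknowns (component_degree k) \<Longrightarrow> system_form P Q = 0"
  shows "system_load Q = 0"
proof -
  have QP: "Q \<in> poly_fields k" by (rule poly_family_in_fields[OF Q])
  have "(\<Sum>T\<in>\<T>. energy_form T Q Q) = 0" using zero[OF Q] unfolding system_form_def by simp
  then have z: "flux_zero_on T Q" if "T \<in> \<T>" for T using energy_sum_zero[OF QP] that by blast
  have "Q (Potential T) x = 0" if T: "T \<in> \<T>" "x \<in> T" for T x
  proof (rule div_form_kernel[OF QP _ T])
    fix V assume V: "V \<in> poly_fields k" "continuous_trace V"
    \<comment> \<open>passing to the unknowns changes neither form\<close>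
    let ?V = "select UNIV V"
    have same: "div_form T ?V Q = div_form T V Q" "trace_form T ?V Q = trace_form T V Q" if "T \<in> \<T>" for T
      using that unfolding div_form_def trace_form_def flux_def select_def unknowns_def by simp_all
    have "(\<Sum>T\<in>\<T>. div_form T ?V Q - trace_form T ?V Q) = system_form ?V Q"
      unfolding system_form_def by (intro sum.cong refl) (simp add: flux_zero_forms z)
    also have "\<dots> = 0" by (rule zero[OF select_in_family[OF V(1)]])
    finally have "(\<Sum>T\<in>\<T>. div_form T V Q) = (\<Sum>T\<in>\<T>. trace_form T V Q)"
      by (simp add: same sum_subtractf)
    also have "\<dots> = (\<Sum>T\<in>\<T>. \<Sum>e | e \<in> faces_of \<E> T \<and> e \<subseteq> frontier \<Omega>.
        face_integral e (\<lambda>x. V (Trace T e) x * Q (Multiplier e) x))"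
      unfolding trace_form_split sum.distrib interior_traces_cancel[OF V QP] by simp
    also have "\<dots> = 0"
    proof (intro sum.neutral ballI face_integral_zero)
      fix T e x assume "e \<in> {e. e \<in> faces_of \<E> T \<and> e \<subseteq> frontier \<Omega>}"
      then have "Multiplier e \<notin> unknowns" unfolding unknowns_def by simp
      then show "V (Trace T e) x * Q (Multiplier e) x = 0" using Q unfolding poly_family_def by simp
    qed
    finally show "(\<Sum>T\<in>\<T>. div_form T V Q) = 0" .
  qed
  then have "(\<Sum>T\<in>\<T>. load T Q) = 0" by (intro sum.neutral ballI load_zero)
  moreover have "boundary_load Q = 0" by (rule boundary_load_zero[OF z])
  ultimately show ?thesis unfolding system_load_def by simp
qed

text \<open>The three equations are recovered by testing with fluxes, potentials and multipliers separately.\<close>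

lemma hybrid_fields_exist: "\<exists>R\<in>poly_fields k. hybrid_fields R"
proof -
  let ?fam = "poly_family unknowns (component_degree k) :: 'n fields set"
  have "\<exists>P\<in>?fam. \<forall>Q\<in>?fam. system_form P Q = system_load Q"
    by (rule variational_problem_solvable[OF finite_unknowns])
       (simp_all add: poly_family_in_fields system_form_lincomb system_load_lincomb system_kernel)
  then obtain P where Pf: "P \<in> ?fam" and sys: "\<And>Q. Q \<in> ?fam \<Longrightarrow> system_form P Q = system_load Q" by blast
  have P: "P \<in> poly_fields k" by (rule poly_family_in_fields[OF Pf])
  have "\<exists>p. poly_of_degree k p \<and> (e \<in> \<E> \<longrightarrow> e \<subseteq> frontier \<Omega> \<longrightarrow> restrict p e = Q_b k g e)" for e
  proof (cases "e \<in> \<E> \<and> e \<subseteq> frontier \<Omega>")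
    case True
    then show ?thesis using Q_b_projection(1)[of e] by (auto elim!: P_spaceE)
  qed (use poly_of_degree_0 in blast)
  then obtain p where p: "\<And>e. poly_of_degree k (p e)"
    "\<And>e. e \<in> \<E> \<Longrightarrow> e \<subseteq> frontier \<Omega> \<Longrightarrow> restrict (p e) e = Q_b k g e"
    by metis
  \<comment> \<open>the solution of the system with the prescribed boundary multipliers put back\<close>
  define R :: "'n fields" where
    "R j = (case j of Multiplier e \<Rightarrow> if e \<subseteq> frontier \<Omega> then p e else P j | _ \<Rightarrow> P j)" for j
  have R: "R \<in> poly_fields k"
    unfolding poly_fields_def R_def using p(1) poly_fieldsD[OF P] by (auto split: component.split)
  have RP: "R (Flux T i) = P (Flux T i)" "R (Trace T e) = P (Trace T e)" "R (Potential T) = P (Potential T)"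
    "\<not> e \<subseteq> frontier \<Omega> \<Longrightarrow> R (Multiplier e) = P (Multiplier e)" for T i e
    unfolding R_def by auto
  have forms: "energy_form T R V = energy_form T P V" "div_form T V R = div_form T V P"
    "div_form T R V = div_form T P V" "trace_form T R V = trace_form T P V" for T V
    unfolding energy_form_def div_form_def trace_form_def flux_def RP by simp_all
  have bd: "restrict (R (Multiplier e)) e = Q_b k g e" if "e \<in> \<E>" "e \<subseteq> frontier \<Omega>" for e
    using p(2)[OF that] that unfolding R_def by simp
  have grad0: "grad (\<lambda>x. 0) x = (0 :: real^'n)" for x by (rule grad_eqI) (simp add: gderiv_def)
  have "energy_form T R V - div_form T V R = - trace_form T V R"
    if T: "T \<in> \<T>" and V: "V \<in> poly_fields k" for T V
  proof -
    let ?Q = "select (range (Flux T) \<union> range (Trace T)) V"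
    have comp: "?Q (Flux T i) = V (Flux T i)" "e \<in> faces_of \<E> T \<Longrightarrow> ?Q (Trace T e) = V (Trace T e)"
      "?Q (Potential T') = (\<lambda>x. 0)" "?Q (Multiplier e) = (\<lambda>x. 0)" for i e T'
      using T unfolding select_def unknowns_def by auto
    have far: "flux_zero_on T' ?Q" if "T' \<noteq> T" for T'
      using that unfolding flux_zero_on_def flux_def select_def by (auto simp: vec_eq_iff)
    have trP: "trace_form T' P ?Q = 0" "div_form T' P ?Q = 0" "load T' ?Q = 0" for T'
      unfolding trace_form_def div_form_def load_def comp
      by (simp_all add: grad0 cell_integral_zero face_integral_zero)
    have "system_form P ?Q = energy_form T P ?Q - div_form T ?Q P + trace_form T ?Q P"
      unfolding system_form_def
      by (subst sum_eq_single[OF finite_mesh(1) T]) (simp_all add: trP flux_zero_forms far)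
    also have "\<dots> = energy_form T P V - div_form T V P + trace_form T V P"
      unfolding energy_form_def div_form_def trace_form_def flux_def by (simp add: comp)
    finally have 1: "energy_form T P V - div_form T V P + trace_form T V P = system_load ?Q"
      using sys[OF select_in_family[OF V]] by simp
    let ?B = "{e. e \<in> faces_of \<E> T \<and> e \<subseteq> frontier \<Omega>}"
    have "boundary_load ?Q = (\<Sum>e\<in>?B. face_integral e (\<lambda>x. g x * ?Q (Trace T e) x))"
      unfolding boundary_load_def
    proof (rule sum_eq_single[OF finite_mesh(1) T])
      fix T' assume "T' \<noteq> T"
      then show "(\<Sum>e | e \<in> faces_of \<E> T' \<and> e \<subseteq> frontier \<Omega>. face_integral e (\<lambda>x. g x * ?Q (Trace T' e) x)) = 0"
        using far[of T'] unfolding flux_zero_on_def by (intro sum.neutral ballI face_integral_zero) auto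
    qed
    also have "\<dots> = (\<Sum>e\<in>?B. face_integral e (\<lambda>x. V (Trace T e) x * R (Multiplier e) x))"
      by (intro sum.cong refl)
         (auto simp: comp boundary_multiplier_projection bd poly_fieldsD[OF V] dest: faces_ofD)
    finally have 2: "system_load ?Q = - (\<Sum>e\<in>?B. face_integral e (\<lambda>x. V (Trace T e) x * R (Multiplier e) x))"
      unfolding system_load_def by (simp add: trP)
    have "(\<Sum>e\<in>?B. face_integral e (\<lambda>x. V (Trace T e) x * P (Multiplier e) x)) = 0"
    proof (intro sum.neutral ballI face_integral_zero)
      fix e x assume "e \<in> ?B"
      then have "Multiplier e \<notin> unknowns" unfolding unknowns_def by simp
      then show "V (Trace T e) x * P (Multiplier e) x = 0" using Pf unfolding poly_family_def by simp
    qed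
    then have "trace_form T V R = trace_form T V P +
        (\<Sum>e\<in>?B. face_integral e (\<lambda>x. V (Trace T e) x * R (Multiplier e) x))"
      unfolding trace_form_split[of T V] by (simp add: RP(4))
    then show ?thesis using 1 2 unfolding forms by simp
  qed
  moreover have "div_form T R W = load T W" if T: "T \<in> \<T>" and W: "W \<in> poly_fields k" for T W
  proof -
    let ?Q = "select {Potential T} W"
    have comp: "?Q (Potential T) = W (Potential T)" "T' \<noteq> T \<Longrightarrow> ?Q (Potential T') = (\<lambda>x. 0)"
      "?Q (Multiplier e) = (\<lambda>x. 0)" for e T'
      using T unfolding select_def unknowns_def by auto
    have flux: "flux_zero_on T' ?Q" for T'
      unfolding flux_zero_on_def flux_def select_def by (auto simp: vec_eq_iff)
    have tr: "trace_form T' P ?Q = 0" for T'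
      unfolding trace_form_def comp by (simp add: face_integral_zero)
    have far: "div_form T' P ?Q = 0" "load T' ?Q = 0" if "T' \<noteq> T" for T'
      using that unfolding div_form_def load_def
      by (simp_all add: comp grad0 cell_integral_zero face_integral_zero)
    have "system_form P ?Q = div_form T P ?Q"
      unfolding system_form_def
      by (subst sum_eq_single[OF finite_mesh(1) T]) (simp_all add: T tr flux_zero_forms flux far)
    moreover have "system_load ?Q = load T ?Q"
      unfolding system_load_def
      by (subst sum_eq_single[OF finite_mesh(1) T]) (simp_all add: far boundary_load_zero flux)
    moreover have "div_form T P ?Q = div_form T P W" "load T ?Q = load T W"
      unfolding div_form_def load_def comp by simp_all
    ultimately have "div_form T P W = load T W" using sys[OF select_in_family[OF W]] by simp
    then show ?thesis unfolding forms .
  qed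
  moreover have "(\<Sum>T\<in>\<T>. trace_form T R \<Phi>) = 0"
    if \<Phi>: "\<Phi> \<in> poly_fields k" "boundary_multiplier_zero \<Phi>" for \<Phi>
  proof -
    let ?Q = "select (range Multiplier) \<Phi>"
    have comp: "?Q (Potential T) = (\<lambda>x. 0)" for T unfolding select_def by auto
    have flux: "flux_zero_on T ?Q" for T
      unfolding flux_zero_on_def flux_def select_def by (auto simp: vec_eq_iff)
    have dv: "div_form T P ?Q = 0" "load T ?Q = 0" for T
      unfolding div_form_def load_def comp by (simp_all add: grad0 cell_integral_zero face_integral_zero)
    have "?Q (Multiplier e) x = \<Phi> (Multiplier e) x" if "e \<in> \<E>" "x \<in> e" for e x
      using \<Phi>(2) that unfolding boundary_multiplier_zero_def select_def unknowns_def by auto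
    then have "trace_form T P ?Q = trace_form T P \<Phi>" for T
      unfolding trace_form_def by (intro sum.cong refl face_integral_cong) (auto dest: faces_ofD)
    then have "system_form P ?Q = - (\<Sum>T\<in>\<T>. trace_form T P \<Phi>)"
      unfolding system_form_def sum_negf[symmetric]
      by (intro sum.cong refl) (simp add: flux_zero_forms flux dv)
    moreover have "system_load ?Q = 0"
      unfolding system_load_def by (simp add: dv boundary_load_zero flux)
    ultimately show ?thesis using sys[OF select_in_family[OF \<Phi>(1)]] unfolding forms by simp
  qed
  ultimately have "hybrid_fields R" using bd unfolding hybrid_fields_def by blast
  then show ?thesis using R by blast
qed

section \<open>Equivalence and unique solvability\<close>

lemma hybrid_solutionE:
  assumes "(q, u, l) \<in> hybrid_solutions \<Omega> \<T> \<E> k \<alpha> f g"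
  obtains P where "P \<in> poly_fields k" "hybrid_fields P" "q = broken_flux P" "u = potential P" "l = multiplier P"
proof -
  have "q \<in> V_broken k \<T> \<E>" "u \<in> W_space k \<T>" "l \<in> Lambda_space k \<E>"
    using assms unfolding hybrid_solutions_def by auto
  then obtain P where P: "P \<in> poly_fields k" "q = broken_flux P" "u = potential P" "l = multiplier P"
    by (rule fields_surj)
  then show ?thesis using that assms hybrid_solutions_iff[OF P(1)] by blast
qed

lemma wg_solutionE:
  assumes "(q, u) \<in> wg_solutions \<Omega> \<T> \<E> k \<alpha> f g"
  obtains P where "P \<in> poly_fields k" "wg_fields P" "q = broken_flux P" "u = potential P"
proof -
  have "q \<in> V_broken k \<T> \<E>" "u \<in> W_space k \<T>"
    using assms unfolding wg_solutions_def V_space_def by auto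
  then obtain P where P: "P \<in> poly_fields k" "q = broken_flux P" "u = potential P"
    using fields_surj[OF _ _ Lambda_zero] by metis
  then show ?thesis using that assms wg_solutions_iff[OF P(1)] by blast
qed

theorem hybrid_solution_eq_wg_solution:
  assumes "(q, u, l) \<in> hybrid_solutions \<Omega> \<T> \<E> k \<alpha> f g" "(q', u') \<in> wg_solutions \<Omega> \<T> \<E> k \<alpha> f g"
  shows "q = q' \<and> u = u'"
proof -
  obtain P where P: "P \<in> poly_fields k" "hybrid_fields P" "q = broken_flux P" "u = potential P"
    by (rule hybrid_solutionE[OF assms(1)])
  obtain Q where Q: "Q \<in> poly_fields k" "wg_fields Q" "q' = broken_flux Q" "u' = potential Q"
    by (rule wg_solutionE[OF assms(2)])
  show ?thesis
    using wg_fields_unique[OF P(1) hybrid_imp_wg_fields[OF P(1,2)] Q(1,2)] P(3,4) Q(3,4) by simp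
qed

theorem hybrid_solution_exists_unique: "\<exists>!s. s \<in> hybrid_solutions \<Omega> \<T> \<E> k \<alpha> f g"
proof (rule ex_ex1I)
  obtain R where "R \<in> poly_fields k" "hybrid_fields R" using hybrid_fields_exist by blast
  then show "\<exists>s. s \<in> hybrid_solutions \<Omega> \<T> \<E> k \<alpha> f g" using hybrid_solutions_iff by blast
  fix s s' assume s: "s \<in> hybrid_solutions \<Omega> \<T> \<E> k \<alpha> f g" "s' \<in> hybrid_solutions \<Omega> \<T> \<E> k \<alpha> f g"
  obtain q u l q' u' l' where eq: "s = (q, u, l)" "s' = (q', u', l')" by (metis prod_cases3)
  obtain P where P: "P \<in> poly_fields k" "hybrid_fields P" "q = broken_flux P" "u = potential P" "l = multiplier P"
    by (rule hybrid_solutionE[OF s(1)[unfolded eq]])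
  obtain Q where Q: "Q \<in> poly_fields k" "hybrid_fields Q" "q' = broken_flux Q" "u' = potential Q" "l' = multiplier Q"
    by (rule hybrid_solutionE[OF s(2)[unfolded eq]])
  have "broken_flux P = broken_flux Q" "potential P = potential Q"
    using wg_fields_unique P(1,2) Q(1,2) hybrid_imp_wg_fields by blast+
  then show "s = s'"
    using hybrid_multiplier_unique[OF P(1,2) Q(1,2)] P(3-5) Q(3-5) eq by simp
qed

end

theorem theorem4p2:
  fixes \<Omega> :: "(real^'n) set" and \<T> \<E> :: "(real^'n) set set"
    and \<alpha> :: "real^'n \<Rightarrow> real^'n^'n" and f g :: "real^'n \<Rightarrow> real" and k :: nat
  assumes "CARD('n) = 2 \<or> CARD('n) = 3"
    and "polyhedral_domain \<Omega>"
    and "admissible_coefficient \<Omega> \<alpha>"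
    and "L2_on lebesgue \<Omega> f"
    and "L2_boundary \<Omega> g"
    and "polyhedral_mesh \<Omega> \<T> \<E>"
    and "shape_regular \<T> \<E>"
  shows "(\<forall>q u l q' u'.
            (q, u, l) \<in> hybrid_solutions \<Omega> \<T> \<E> k \<alpha> f g \<and> (q', u') \<in> wg_solutions \<Omega> \<T> \<E> k \<alpha> f g
            \<longrightarrow> q = q' \<and> u = u') \<and>
         (\<exists>!s. s \<in> hybrid_solutions \<Omega> \<T> \<E> k \<alpha> f g)"
proof -
  interpret wg_problem \<Omega> \<T> \<E> \<alpha> f g k
  proof
    show "interior (closure \<Omega>) = \<Omega>" using assms(2) unfolding polyhedral_domain_def by blast
  qed (use assms in auto)
  show ?thesis using hybrid_solution_eq_wg_solution hybrid_solution_exists_unique by blast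
qed

end
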